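(* Let $C,A_1,\ldots,A_m\in\mathbb{S}^n$ with $\sum_{i=1}^m y_iA_i=0$ if and only if $y=0$. Let $\mathcal{T}=(\{J_1,\ldots,J_\ell\},T)$ be a tree decomposition for the sparsity graph of $C,A_1,\ldots,A_m$, let $\omega=\max_j|J_j|=1+\mathrm{wid}(\mathcal{T})$, and consider a corresponding clique tree conversion with split matrices $A_{i,j}$ and vectorized constraint data $\mathbf{A},\mathbf{N}$. Suppose that for each $i\in\{1,\ldots,m\}$ there exists $v_i\in V(T)$ such that $$A_{i,j}\ne0\quad\implies\quad j=v_i\ \text{ or }\ j=p(v_i).$$ Let $\mathbf{D}_s=\mathrm{diag}(\mathbf{D}_{s,1},\ldots,\mathbf{D}_{s,\ell})$ be block-diagonal with dense blocks $\mathbf{D}_{s,j}\succ0$ of order $\frac12|J_j|(|J_j|+1)$, let $\sigma>0$, let $w$ be a real vector of compatible length, and define $$\mathbf{H}=\mathbf{D}_s+\sigma\mathbf{A}^T\mathbf{A}+\sigma\mathbf{N}^T\mathbf{N},\qquad\mathbf{q}=\begin{bmatrix}\mathbf{A}^T&\mathbf{N}^T\end{bmatrix}w.$$ Then: 1. (Forming) It costs $O(\omega^6n)$ time and $O(\omega^4n)$ space to form $\mathbf{H}$ and $\mathbf{q}$. 2. (Factoring) Let $\pi$ be a topological ordering on $T$, and let $\Pi$ be the associated block topological permutation. Then it costs $O(\omega^6n)$ time and $O(\omega^4n)$ space to factor $\Pi\mathbf{H}\Pi^T$ into $\mathbf{L}\mathbf{L}^T$ with $\mathbf{L}$ its (lower-triangular)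 Cholesky factor. 3. (Solving) Given $r$, $\mathbf{q}$, $\Pi$, and the Cholesky factor $\mathbf{L}$ satisfying $\mathbf{L}\mathbf{L}^T=\Pi\mathbf{H}\Pi^T$, it costs $O(\omega^4n)$ time and space to solve $(\mathbf{H}+\mathbf{q}\mathbf{q}^T)u=r$ for $u$.
   Context: Notation: $\mathbb{S}^n$ is the space of real symmetric $n\times n$ matrices; $A\bullet X=\mathrm{tr}(A^TX)$; $X[I,J]$ is the submatrix with rows $I$ and columns $J$; $\succ0$ means positive definite. $\mathrm{svec}(X)$ lists the lower-triangular entries of a symmetric matrix $X$ column by column, off-diagonal ones multiplied by $\sqrt2$, so $\mathrm{svec}(X)^T\mathrm{svec}(Y)=X\bullet Y$. Sparsity graph of a set of $n\times n$ matrices: an undirected simple graph $G$ on $\{1,\ldots,n\}$ with $(i,j)\in E(G)$ whenever $i\ne j$ and some matrix of the set has nonzero $(i,j)$ entry. Tree decomposition: a pair $\mathcal{T}=(\{J_1,\ldots,J_\ell\},T)$ with bags $J_j\subseteq V(G)$, $T$ a tree on $\ell\le n$ nodes $1,\ldots,\ell$, such that every vertex lies in a bag; for every edge $(u,v)\in E(G)$ some bag contains $u$ and $v$; and if $v\in J_i\cap J_j$ then $v\in J_k$ for every $k$ on the path from $i$ to $j$ in $T$. $\mathrm{wid}(\mathcal{T})=\max_k|J_k|-1$. The tree $T$ is rooted at a node $r_0$; $p(v)$ is the parent of $v\ne r_0$, and $p(r_0)=r_0$. Clique tree conversion: choose $A_{i,j}\in\mathbb{S}^{|J_j|}$ with $\sum_{j=1}^{\ell}A_{i,j}\bullet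 X[J_j,J_j]=A_i\bullet X$ for all $X\in\mathbb{S}^n$ and all $i$ (and similarly for $C$). $\mathbf{A}$ is the $m$-row matrix whose $(i,j)$ block is $\mathrm{svec}(A_{i,j})^T$, $j=1,\ldots,\ell$. $\mathbf{N}=[\mathbf{N}_{i,j}]_{i,j=1}^{\ell}$ acts on $[\mathrm{svec}(X_j)]_{j=1}^{\ell}$, $X_j\in\mathbb{S}^{|J_j|}$ (rows/columns indexed by $J_j$), and has, for each non-root node $i$, a block row with $\mathbf{N}_{i,i}\,\mathrm{svec}(X_i)=\mathrm{svec}$ of the submatrix of $X_i$ indexed by $J_i\cap J_{p(i)}$, $\mathbf{N}_{i,p(i)}\,\mathrm{svec}(X_{p(i)})=-\mathrm{svec}$ of the submatrix of $X_{p(i)}$ indexed by $J_i\cap J_{p(i)}$, and $\mathbf{N}_{i,j}=0$ otherwise (the root's block row is empty). Topological ordering: a bijection $\pi:\{1,\ldots,\ell\}\to V(T)$ such that, designating $\pi(\ell)$ as the root of $T$, each node is indexed before its parent, i.e. $\pi^{-1}(v)<\pi^{-1}(p(v))$ for all non-root $v$. Block topological permutation: partition $\mathbf{H}=[\mathbf{H}_{i,j}]_{i,j=1}^{\ell}$ conformally with the blocks $\mathrm{svec}(X_1),\ldots,\mathrm{svec}(X_\ell)$; $\Pi$ is the permutation matrix such that the $(i,j)$ block of $\Pi\mathbf{H}\Pi^T$ is $\mathbf{H}_{\pi(i),\pi(j)}$. Costs count real-arithmetic operations and stored real numbers, with sparse matrices stored by nonzeros or nonzero blocks and dense factorizations/solves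 of order $k$ costing $O(k^3)$ / $O(k^2)$. *)

theory Defs
  imports Complex_Main "Jordan_Normal_Form.DL_Submatrix"
begin

section \<open>Matrices\<close>

text \<open>Row, column, vertex, bag and constraint indices all start at 0.\<close>

definition sym_mats :: "nat \<Rightarrow> real mat set" where
  "sym_mats n = {X \<in> carrier_mat n n. transpose_mat X = X}"

definition mat_trace :: "real mat \<Rightarrow> real" where
  "mat_trace X = (\<Sum>i<dim_row X. X $$ (i, i))"

definition frob_inner :: "real mat \<Rightarrow> real mat \<Rightarrow> real" where
  "frob_inner A X = mat_trace (transpose_mat A * X)"

definition pos_def :: "nat \<Rightarrow> real mat \<Rightarrow> bool" where
  "pos_def k M \<longleftrightarrow> M \<in> sym_mats k \<and>
     (\<forall>x \<in> carrier_vec k. x \<noteq> 0\<^sub>v k \<longrightarrow> x \<bullet> (M *\<^sub>v x) > 0)"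

definition lin_comb_mats :: "nat \<Rightarrow> nat \<Rightarrow> real vec \<Rightarrow> (nat \<Rightarrow> real mat) \<Rightarrow> real mat" where
  "lin_comb_mats n m y A = mat n n (\<lambda>ab. \<Sum>i<m. y $ i * A i $$ ab)"

definition cholesky_factor :: "real mat \<Rightarrow> real mat \<Rightarrow> bool" where
  "cholesky_factor M L \<longleftrightarrow>
     L \<in> carrier_mat (dim_row M) (dim_row M) \<and>
     upper_triangular (transpose_mat L) \<and>
     (\<forall>i < dim_row M. L $$ (i, i) > 0) \<and>
     L * transpose_mat L = M"

definition outer :: "real vec \<Rightarrow> real mat" where
  "outer q = mat (dim_vec q) (dim_vec q) (\<lambda>(i, j). q $ i * q $ j)"

definition tri :: "nat \<Rightarrow> nat" where
  "tri k = k * (k + 1) div 2"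

text \<open>Positions of the lower triangle of a matrix of order \<open>k\<close>, column by column.\<close>

definition lower_positions :: "nat \<Rightarrow> (nat \<times> nat) list" where
  "lower_positions k = concat (map (\<lambda>j. map (\<lambda>i. (i, j)) [j..<k]) [0..<k])"

definition svec :: "real mat \<Rightarrow> real vec" where
  "svec X = vec_of_list (map (\<lambda>(i, j). if i = j then X $$ (i, j) else sqrt 2 * X $$ (i, j))
     (lower_positions (dim_row X)))"

text \<open>For blocks of sizes \<open>f 0, f 1, \<dots>\<close>, block \<open>i\<close> occupies the indices
  \<open>offset f i, \<dots>, offset f i + f i - 1\<close>, and \<open>offset f l\<close> is the total size of \<open>l\<close> blocks.\<close>

definition offset :: "(nat \<Rightarrow> nat) \<Rightarrow> nat \<Rightarrow> nat" where
  "offset f i = (\<Sum>k<i. f k)"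

definition block :: "(nat \<Rightarrow> nat) \<Rightarrow> (nat \<Rightarrow> nat) \<Rightarrow> real mat \<Rightarrow> nat \<Rightarrow> nat \<Rightarrow> real mat" where
  "block rs cs M i j =
     mat (rs i) (cs j) (\<lambda>(a, b). M $$ (offset rs i + a, offset cs j + b))"

text \<open>All positions in those blocks \<open>(i, j)\<close> for which \<open>R i j\<close> holds.\<close>

definition block_positions ::
  "(nat \<Rightarrow> nat) \<Rightarrow> nat \<Rightarrow> (nat \<Rightarrow> nat) \<Rightarrow> nat \<Rightarrow> (nat \<Rightarrow> nat \<Rightarrow> bool) \<Rightarrow> (nat \<times> nat) set" where
  "block_positions rs k cs l R =
     {(offset rs i + a, offset cs j + b) | i j a b. i < k \<and> j < l \<and> a < rs i \<and> b < cs j \<and> R i j}"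

definition concat_vecs :: "nat \<Rightarrow> (nat \<Rightarrow> real vec) \<Rightarrow> real vec" where
  "concat_vecs l f = vec_of_list (concat (map (\<lambda>j. list_of_vec (f j)) [0..<l]))"


section \<open>Graphs, trees and tree decompositions\<close>

text \<open>Edges of an undirected simple graph are two-element sets of vertices.\<close>

definition simple_graph :: "nat set \<Rightarrow> nat set set \<Rightarrow> bool" where
  "simple_graph V E \<longleftrightarrow> finite V \<and> (\<forall>e\<in>E. \<exists>u\<in>V. \<exists>v\<in>V. u \<noteq> v \<and> e = {u, v})"

definition path_between :: "nat set set \<Rightarrow> nat \<Rightarrow> nat list \<Rightarrow> nat \<Rightarrow> bool" where
  "path_between E u xs v \<longleftrightarrow>
     xs \<noteq> [] \<and> hd xs = u \<and> last xs = v \<and> distinct xs \<and> successively (\<lambda>a b. {a, b} \<in> E) xs"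

definition is_tree :: "nat set \<Rightarrow> nat set set \<Rightarrow> bool" where
  "is_tree V E \<longleftrightarrow> simple_graph V E \<and> V \<noteq> {} \<and>
     (\<forall>u\<in>V. \<forall>v\<in>V. \<exists>xs. path_between E u xs v) \<and>
     \<not> (\<exists>u v xs. path_between E u xs v \<and> length xs \<ge> 3 \<and> {v, u} \<in> E)"

text \<open>The parent of \<open>v\<close> in the tree with edges \<open>E\<close> rooted at \<open>r\<close>: the successor of \<open>v\<close>
  on the path from \<open>v\<close> to \<open>r\<close>.\<close>

definition tree_parent :: "nat set set \<Rightarrow> nat \<Rightarrow> nat \<Rightarrow> nat" where
  "tree_parent E r v = (if v = r then r else (THE u. \<exists>xs. path_between E v (v # u # xs) r))"

definition sparsity_edges :: "nat \<Rightarrow> real mat set \<Rightarrow> nat set set" where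
  "sparsity_edges n Ms =
     {{i, j} | i j. i < n \<and> j < n \<and> i \<noteq> j \<and> (\<exists>M\<in>Ms. M $$ (i, j) \<noteq> 0)}"

text \<open>\<open>J 0, \<dots>, J (l - 1)\<close> are the bags and \<open>E\<close> is the edge set of a tree on \<open>{..<l}\<close>;
  the decomposed graph has vertex set \<open>{..<n}\<close> and edge set \<open>G\<close>.\<close>

definition tree_decomposition ::
  "nat \<Rightarrow> nat set set \<Rightarrow> nat \<Rightarrow> (nat \<Rightarrow> nat set) \<Rightarrow> nat set set \<Rightarrow> bool" where
  "tree_decomposition n G l J E \<longleftrightarrow>
     l \<le> n \<and> is_tree {..<l} E \<and> (\<forall>j<l. J j \<subseteq> {..<n}) \<and>
     (\<forall>a<n. \<exists>j<l. a \<in> J j) \<and>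
     (\<forall>a b. {a, b} \<in> G \<longrightarrow> (\<exists>j<l. a \<in> J j \<and> b \<in> J j)) \<and>
     (\<forall>i<l. \<forall>j<l. \<forall>xs. path_between E i xs j \<longrightarrow> (\<forall>k\<in>set xs. J i \<inter> J j \<subseteq> J k))"

text \<open>The root is designated by \<open>\<pi>\<close> itself and need not be the root used elsewhere.\<close>

definition topological_ordering :: "nat \<Rightarrow> nat set set \<Rightarrow> (nat \<Rightarrow> nat) \<Rightarrow> bool" where
  "topological_ordering l E \<pi> \<longleftrightarrow> bij_betw \<pi> {..<l} {..<l} \<and>
     (let r = \<pi> (l - 1); idx = inv_into {..<l} \<pi> in
        \<forall>v<l. v \<noteq> r \<longrightarrow> idx v < idx (tree_parent E r v))"


section \<open>Clique tree conversion\<close>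

text \<open>The combinatorial (non-numerical) part of a problem instance. \<open>host i\<close> is the node
  such that constraint \<open>i\<close> is supported on the bags of \<open>host i\<close> and of its parent.\<close>

record ctc_structure =
  size_n :: nat
  num_cons :: nat
  num_bags :: nat
  bag :: "nat \<Rightarrow> nat set"
  tree_edges :: "nat set set"
  root_node :: nat
  host :: "nat \<Rightarrow> nat"

definition parent :: "ctc_structure \<Rightarrow> nat \<Rightarrow> nat" where
  "parent S = tree_parent (tree_edges S) (root_node S)"

definition max_bag :: "ctc_structure \<Rightarrow> nat" where
  "max_bag S = Max ((\<lambda>j. card (bag S j)) ` {..<num_bags S})"

definition bag_dim :: "ctc_structure \<Rightarrow> nat \<Rightarrow> nat" where
  "bag_dim S j = tri (card (bag S j))"

definition overlap_dim :: "ctc_structure \<Rightarrow> nat \<Rightarrow> nat" where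
  "overlap_dim S i =
     (if i = root_node S then 0 else tri (card (bag S i \<inter> bag S (parent S i))))"

definition total_dim :: "ctc_structure \<Rightarrow> nat" where
  "total_dim S = offset (bag_dim S) (num_bags S)"

definition is_split :: "ctc_structure \<Rightarrow> real mat \<Rightarrow> (nat \<Rightarrow> real mat) \<Rightarrow> bool" where
  "is_split S M Ms \<longleftrightarrow>
     (\<forall>j<num_bags S. Ms j \<in> sym_mats (card (bag S j))) \<and>
     (\<forall>X \<in> sym_mats (size_n S).
        (\<Sum>j<num_bags S. frob_inner (Ms j) (submatrix X (bag S j) (bag S j))) = frob_inner M X)"

definition constraint_matrix :: "ctc_structure \<Rightarrow> (nat \<Rightarrow> nat \<Rightarrow> real mat) \<Rightarrow> real mat" where
  "constraint_matrix S As = mat_of_rows (total_dim S)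
     (map (\<lambda>i. concat_vecs (num_bags S) (\<lambda>j. svec (As i j))) [0..<num_cons S])"

text \<open>\<open>restrict_bag I K X\<close>: the rows and columns of \<open>X\<close> are labelled by the elements of \<open>I\<close> in
  increasing order, and those with label in \<open>K\<close> are kept.\<close>

definition restrict_bag :: "nat set \<Rightarrow> nat set \<Rightarrow> real mat \<Rightarrow> real mat" where
  "restrict_bag I K X =
     (let T = {t. t < card I \<and> pick I t \<in> K} in submatrix X T T)"

definition overlap_matrix :: "ctc_structure \<Rightarrow> real mat \<Rightarrow> bool" where
  "overlap_matrix S N \<longleftrightarrow>
     N \<in> carrier_mat (offset (overlap_dim S) (num_bags S)) (total_dim S) \<and>
     (\<forall>i<num_bags S. i \<noteq> root_node S \<longrightarrow>
        (let p = parent S i; K = bag S i \<inter> bag S p;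
             B = block (overlap_dim S) (bag_dim S) N in
          (\<forall>X \<in> sym_mats (card (bag S i)).
             B i i *\<^sub>v svec X = svec (restrict_bag (bag S i) K X)) \<and>
          (\<forall>X \<in> sym_mats (card (bag S p)).
             B i p *\<^sub>v svec X = - svec (restrict_bag (bag S p) K X)) \<and>
          (\<forall>j<num_bags S. j \<noteq> i \<and> j \<noteq> p \<longrightarrow>
             B i j = 0\<^sub>m (overlap_dim S i) (bag_dim S j))))"

definition block_diag :: "ctc_structure \<Rightarrow> (nat \<Rightarrow> real mat) \<Rightarrow> real mat" where
  "block_diag S D = diag_block_mat (map D [0..<num_bags S])"

definition H_mat :: "real mat \<Rightarrow> real \<Rightarrow> real mat \<Rightarrow> real mat \<Rightarrow> real mat" where
  "H_mat Ds \<sigma> A N =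
     Ds + \<sigma> \<cdot>\<^sub>m (transpose_mat A * A) + \<sigma> \<cdot>\<^sub>m (transpose_mat N * N)"

text \<open>\<open>(A @\<^sub>r N)\<^sup>T\<close> is the row of blocks \<open>[A\<^sup>T N\<^sup>T]\<close>.\<close>

definition q_vec :: "real mat \<Rightarrow> real mat \<Rightarrow> real vec \<Rightarrow> real vec" where
  "q_vec A N w = transpose_mat (A @\<^sub>r N) *\<^sub>v w"

definition block_perm_mat :: "ctc_structure \<Rightarrow> (nat \<Rightarrow> nat) \<Rightarrow> real mat" where
  "block_perm_mat S \<pi> = mat (total_dim S) (total_dim S) (\<lambda>(r, c).
     if \<exists>i<num_bags S. \<exists>t<bag_dim S (\<pi> i).
          r = offset (bag_dim S \<circ> \<pi>) i + t \<and> c = offset (bag_dim S) (\<pi> i) + t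
     then 1 else 0)"

definition permute_blocks :: "ctc_structure \<Rightarrow> (nat \<Rightarrow> nat) \<Rightarrow> real mat \<Rightarrow> real mat" where
  "permute_blocks S \<pi> H = block_perm_mat S \<pi> * H * transpose_mat (block_perm_mat S \<pi>)"


section \<open>Cost model\<close>

text \<open>Straight-line programs of real-arithmetic instructions over addressable cells, each
  holding one real number; the first argument of an instruction is the destination.
  Time is the number of instructions. Space is the number of distinct cells that hold the
  input or the output or are accessed by the program. Division by zero and square roots of
  negative numbers make the execution fail. An algorithm is a family of such programs indexed
  by the combinatorial structure alone: index computations are free, while the one program
  belonging to a structure has to be correct for all numerical data of that structure.\<close>

datatype 'c instr =
    Const 'c int
  | Add 'c 'c 'c
  | Sub 'c 'c 'c
  | Mul 'c 'c 'c
  | Div 'c 'c 'c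
  | Sqrt 'c 'c

primrec exec :: "'c instr \<Rightarrow> ('c \<Rightarrow> real) \<Rightarrow> ('c \<Rightarrow> real) option" where
  "exec (Const z k) s = Some (s(z := of_int k))"
| "exec (Add z x y) s = Some (s(z := s x + s y))"
| "exec (Sub z x y) s = Some (s(z := s x - s y))"
| "exec (Mul z x y) s = Some (s(z := s x * s y))"
| "exec (Div z x y) s = (if s y = 0 then None else Some (s(z := s x / s y)))"
| "exec (Sqrt z x) s = (if s x < 0 then None else Some (s(z := sqrt (s x))))"

primrec run :: "'c instr list \<Rightarrow> ('c \<Rightarrow> real) \<Rightarrow> ('c \<Rightarrow> real) option" where
  "run [] s = Some s"
| "run (i # is) s = Option.bind (exec i s) (run is)"

definition accessed :: "'c instr list \<Rightarrow> 'c set" where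
  "accessed prog = (\<Union>i\<in>set prog. set_instr i)"

text \<open>The initial memory is constrained only by \<open>pre\<close>; all other cells start with arbitrary
  contents.\<close>

definition program_meets ::
  "'c instr list \<Rightarrow> 'c set \<Rightarrow> (('c \<Rightarrow> real) \<Rightarrow> bool) \<Rightarrow> 'c set \<Rightarrow> (('c \<Rightarrow> real) \<Rightarrow> bool)
     \<Rightarrow> nat \<Rightarrow> nat \<Rightarrow> bool" where
  "program_meets prog inp pre outp post time space \<longleftrightarrow>
     (\<forall>s. pre s \<longrightarrow> (\<exists>s'. run prog s = Some s' \<and> post s')) \<and>
     length prog \<le> time \<and>
     finite (inp \<union> outp \<union> accessed prog) \<and> card (inp \<union> outp \<union> accessed prog) \<le> space"


section \<open>Sparse storage of the data\<close>

text \<open>A matrix with a known block sparsity pattern is stored by its nonzero blocks, \<open>N\<close> by its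
  nonzero entries (which depend on the structure only).\<close>

datatype array = Arr_A | Arr_N | Arr_D | Arr_sigma | Arr_w | Arr_H | Arr_q | Arr_L | Arr_r | Arr_u | Work

text \<open>Entry \<open>(i, j)\<close> of the matrix stored in array \<open>x\<close> has the address \<open>(x, i, j)\<close>; vectors and
  scalars are stored as a single column.\<close>

type_synonym cell = "array \<times> nat \<times> nat"

definition mat_cells :: "array \<Rightarrow> (nat \<times> nat) set \<Rightarrow> cell set" where
  "mat_cells x P = {x} \<times> P"

definition vec_cells :: "array \<Rightarrow> nat \<Rightarrow> cell set" where
  "vec_cells x k = {(x, i, 0) | i. i < k}"

definition holds_mat :: "array \<Rightarrow> (nat \<times> nat) set \<Rightarrow> real mat \<Rightarrow> (cell \<Rightarrow> real) \<Rightarrow> bool" where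
  "holds_mat x P M s \<longleftrightarrow> (\<forall>ij\<in>P. s (x, ij) = M $$ ij)"

definition holds_vec :: "array \<Rightarrow> real vec \<Rightarrow> (cell \<Rightarrow> real) \<Rightarrow> bool" where
  "holds_vec x v s \<longleftrightarrow> (\<forall>i<dim_vec v. s (x, i, 0) = v $ i)"

definition holds_scalar :: "array \<Rightarrow> real \<Rightarrow> (cell \<Rightarrow> real) \<Rightarrow> bool" where
  "holds_scalar x a s \<longleftrightarrow> s (x, 0, 0) = a"

definition zero_outside :: "(nat \<times> nat) set \<Rightarrow> real mat \<Rightarrow> bool" where
  "zero_outside P M \<longleftrightarrow>
     (\<forall>i<dim_row M. \<forall>j<dim_col M. (i, j) \<notin> P \<longrightarrow> M $$ (i, j) = 0)"

definition nonzero_positions :: "real mat \<Rightarrow> (nat \<times> nat) set" where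
  "nonzero_positions M = {(i, j). i < dim_row M \<and> j < dim_col M \<and> M $$ (i, j) \<noteq> 0}"

definition A_positions :: "ctc_structure \<Rightarrow> (nat \<times> nat) set" where
  "A_positions S = block_positions (\<lambda>_. 1) (num_cons S) (bag_dim S) (num_bags S)
     (\<lambda>i j. j = host S i \<or> j = parent S (host S i))"

definition D_positions :: "ctc_structure \<Rightarrow> (nat \<times> nat) set" where
  "D_positions S =
     block_positions (bag_dim S) (num_bags S) (bag_dim S) (num_bags S) (\<lambda>i j. i = j)"

definition H_positions :: "ctc_structure \<Rightarrow> (nat \<times> nat) set" where
  "H_positions S = block_positions (bag_dim S) (num_bags S) (bag_dim S) (num_bags S)
     (\<lambda>i j. i = j \<or> {i, j} \<in> tree_edges S)"

text \<open>The lower triangle of the permuted positions of \<open>H\<close>: no room is left for fill-in.\<close>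

definition L_positions :: "ctc_structure \<Rightarrow> (nat \<Rightarrow> nat) \<Rightarrow> (nat \<times> nat) set" where
  "L_positions S \<pi> = {(r, c). c \<le> r \<and>
     (r, c) \<in> block_positions (bag_dim S \<circ> \<pi>) (num_bags S) (bag_dim S \<circ> \<pi>) (num_bags S)
       (\<lambda>i j. \<pi> i = \<pi> j \<or> {\<pi> i, \<pi> j} \<in> tree_edges S)}"

end

theory Submission
  imports Defs
begin

text \<open>
  Every node of the tree has at most \<open>\<omega>\<^sup>2\<close> variables, and every row of \<open>A\<close> and of \<open>N\<close> is supported
  on a node and its parent. Hence \<open>H\<close> has blocks only on the diagonal and on the edges of the tree,
  and the cost of forming it is the sum over the rows of \<open>A\<close> and \<open>N\<close> of the squared row lengths,
  \<open>O(\<omega>\<^sup>4)\<close> for each of \<open>O(\<omega>\<^sup>2 n)\<close> rows. There are at most as many constraints as variables because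
  the \<open>A\<^sub>i\<close> are linearly independent and determined by their splits. In a topological ordering the
  only later neighbour of a node is its parent, so eliminating a node couples only that node and its
  parent: Cholesky factorization creates no fill-in, each column of \<open>L\<close> has at most \<open>2 \<omega>\<^sup>2\<close> nonzeros,
  and the factorization costs the sum of the squared column lengths. The rank-one update by \<open>q\<close> is
  absorbed by one more forward substitution.
\<close>

section \<open>Straight-line programs\<close>

text \<open>A program may depend on the structure only, while its correctness concerns all numerical
  data. Each program is therefore checked against a target memory \<open>val\<close> fixed in
  advance: the Cholesky factor and the solutions of the triangular systems are first shown to exist
  by plain algebra, and a run merely enlarges the set of cells that agree with \<open>val\<close>.
  Choosing the program before the data also means that the nonzero pattern of \<open>N\<close> has
  to be recovered from the structure; this is the purpose of the uniqueness proof for overlap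
  matrices. Two roots are in play: \<open>root_node S\<close>, which shapes \<open>A\<close> and
  \<open>N\<close>, and the last node of \<open>\<pi>\<close>, which governs elimination. Sparsity
  is phrased by adjacency in the tree, which knows no root; each root only orients the edges. A node
  can have many children, so rows of \<open>H\<close> and of \<open>L\<close> can be long, and
  counting has to go along the direction from child to parent.\<close>

definition valid :: "(('c \<Rightarrow> real) \<Rightarrow> bool) \<Rightarrow> 'c instr list \<Rightarrow> (('c \<Rightarrow> real) \<Rightarrow> bool) \<Rightarrow> bool" where
  "valid P p Q \<longleftrightarrow> (\<forall>s. P s \<longrightarrow> (\<exists>s'. run p s = Some s' \<and> Q s'))"

text \<open>\<open>val\<close> prescribes the final content of the cells once and for all. A
  finished cell is never changed again, so the progress of a computation reduces to the set
  \<open>K\<close> of cells already correct; cells outside \<open>K\<close> may hold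
  anything.\<close>

definition agree :: "('c \<Rightarrow> real) \<Rightarrow> 'c set \<Rightarrow> ('c \<Rightarrow> real) \<Rightarrow> bool" where
  "agree val K s \<longleftrightarrow> (\<forall>c\<in>K. s c = val c)"

lemma run_append: "run (p @ q) s = Option.bind (run p s) (run q)"
proof (induction p arbitrary: s)
  case (Cons i p)
  then show ?case by (cases "exec i s") auto
qed simp

lemma valid_append: "valid P p Q \<Longrightarrow> valid Q q R \<Longrightarrow> valid P (p @ q) R"
  unfolding valid_def by (fastforce simp: run_append)

lemma valid_weaken: "valid P p Q \<Longrightarrow> (\<And>s. P' s \<Longrightarrow> P s) \<Longrightarrow> (\<And>s. Q s \<Longrightarrow> Q' s) \<Longrightarrow> valid P' p Q'"
  unfolding valid_def by blast

lemma valid_agree_mono: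
  "valid (agree val K) p (agree val L) \<Longrightarrow> K \<subseteq> K' \<Longrightarrow> L' \<subseteq> L \<Longrightarrow> valid (agree val K') p (agree val L')"
  by (erule valid_weaken) (auto simp: agree_def)

lemma valid_loop:
  assumes "\<And>i. i < n \<Longrightarrow> valid (agree val (K i)) (p i) (agree val (K (Suc i)))"
  shows "valid (agree val (K 0)) (concat (map p [0..<n])) (agree val (K n))"
  using assms
proof (induction n)
  case 0
  show ?case by (simp add: valid_def)
next
  case (Suc n)
  then show ?case by (auto intro: valid_append)
qed

lemma accessed_append [simp]: "accessed (p @ q) = accessed p \<union> accessed q"
  by (auto simp: accessed_def)

lemma accessed_Nil [simp]: "accessed [] = {}"
  by (simp add: accessed_def)

lemma accessed_Cons [simp]: "accessed (i # p) = set_instr i \<union> accessed p"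
  by (simp add: accessed_def)

lemma accessed_concat [simp]: "accessed (concat ps) = (\<Union>p\<in>set ps. accessed p)"
  by (induction ps) auto

section \<open>Inner products with postprocessing as the unit of computation\<close>

definition dot :: "'c \<Rightarrow> 'c \<Rightarrow> ('c \<times> 'c) list \<Rightarrow> 'c instr list" where
  "dot z t xs = concat (map (\<lambda>(x, y). [Mul t x y, Add z z t]) xs)"

lemma dot_Nil [simp]: "dot z t [] = []"
  and dot_Cons [simp]: "dot z t (xy # xs) = Mul t (fst xy) (snd xy) # Add z z t # dot z t xs"
  by (auto simp: dot_def split: prod.split)

lemma run_dot:
  assumes "z \<noteq> t" "\<forall>(x, y)\<in>set xs. x \<notin> {z, t} \<and> y \<notin> {z, t}"
  shows "\<exists>s'. run (dot z t xs) s = Some s' \<and> s' z = s z + (\<Sum>(x, y)\<leftarrow>xs. s x * s y) \<and>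
    (\<forall>c. c \<notin> {z, t} \<longrightarrow> s' c = s c)"
  using assms
proof (induction xs arbitrary: s)
  case Nil
  then show ?case by (simp add: dot_def)
next
  case (Cons a xs)
  obtain x y where a: "a = (x, y)" by force
  let ?s = "s(t := s x * s y, z := s z + s x * s y)"
  have "\<exists>s'. run (dot z t xs) ?s = Some s' \<and> s' z = ?s z + (\<Sum>(x, y)\<leftarrow>xs. ?s x * ?s y) \<and>
      (\<forall>c. c \<notin> {z, t} \<longrightarrow> s' c = ?s c)"
    using Cons.prems by (intro Cons.IH) auto
  then obtain s' where s': "run (dot z t xs) ?s = Some s'"
    "s' z = ?s z + (\<Sum>(x, y)\<leftarrow>xs. ?s x * ?s y)" "\<forall>c. c \<notin> {z, t} \<longrightarrow> s' c = ?s c"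
    by blast
  have "(\<Sum>(x, y)\<leftarrow>xs. ?s x * ?s y) = (\<Sum>(x, y)\<leftarrow>xs. s x * s y)"
    using Cons.prems(2) by (intro arg_cong[where f = sum_list] map_cong) auto
  with s' Cons.prems show ?case
    by (intro exI[of _ s']) (auto simp: a dot_def)
qed

lemma length_dot [simp]: "length (dot z t xs) = 2 * length xs"
  by (induction xs) (auto simp: dot_def)

lemma accessed_dot: "accessed (dot z t xs) \<subseteq> {z, t} \<union> fst ` set xs \<union> snd ` set xs"
  by (induction xs) auto

text \<open>Initial memory is arbitrary, so the accumulator \<open>z\<close> has to be cleared.
  Every entry of \<open>H\<close>, \<open>q\<close> and \<open>L\<close> and every component of a
  triangular solve is one such task, with at most two instructions in \<open>fin\<close>.\<close>

definition task :: "'c \<Rightarrow> 'c \<Rightarrow> ('c \<times> 'c) list \<Rightarrow> 'c instr list \<Rightarrow> 'c instr list" where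
  "task z t xs fin = Const z 0 # dot z t xs @ fin"

lemma length_task [simp]: "length (task z t xs fin) = 1 + 2 * length xs + length fin"
  by (simp add: task_def)

lemma accessed_task:
  "accessed (task z t xs fin) \<subseteq> {z, t} \<union> fst ` set xs \<union> snd ` set xs \<union> accessed fin"
  using accessed_dot[of z t xs] by (auto simp: task_def)

text \<open>The inner product reads only cells of \<open>K\<close>, and only \<open>z\<close> and
  the scratch cell \<open>t\<close>, both outside \<open>K\<close>, are written, so nothing correct
  is spoiled. \<open>fin\<close> starts from the exact inner product in \<open>z\<close>. No promise
  is made about \<open>t\<close>, which can be reused by the next task.\<close>

lemma valid_task:
  assumes "z \<noteq> t" "z \<notin> K" "t \<notin> K" "\<And>x y. (x, y) \<in> set xs \<Longrightarrow> x \<in> K \<and> y \<in> K"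
    and fin: "\<And>s. agree val K s \<Longrightarrow> s z = (\<Sum>(x, y)\<leftarrow>xs. val x * val y) \<Longrightarrow>
      \<exists>s'. run fin s = Some s' \<and> s' z = val z \<and> (\<forall>c. c \<notin> {z, t} \<longrightarrow> s' c = s c)"
  shows "valid (agree val K) (task z t xs fin) (agree val (insert z K))"
  unfolding valid_def
proof (intro allI impI)
  fix s
  assume s: "agree val K s"
  let ?s = "s(z := 0)"
  have s0: "agree val K ?s" using s assms(2) by (auto simp: agree_def)
  have "\<forall>(x, y)\<in>set xs. x \<notin> {z, t} \<and> y \<notin> {z, t}" using assms(2-4) by blast
  from run_dot[OF assms(1) this, of ?s] obtain s1 where s1: "run (dot z t xs) ?s = Some s1"
    "s1 z = (\<Sum>(x, y)\<leftarrow>xs. ?s x * ?s y)" "\<forall>c. c \<notin> {z, t} \<longrightarrow> s1 c = ?s c"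
    by auto
  have "(\<Sum>(x, y)\<leftarrow>xs. ?s x * ?s y) = (\<Sum>(x, y)\<leftarrow>xs. val x * val y)"
    using assms(4) s0 unfolding agree_def
    by (intro arg_cong[where f = sum_list] map_cong) auto
  moreover have a1: "agree val K s1" 
    unfolding agree_def
  proof
    fix c
    assume "c \<in> K"
    then have "c \<noteq> z" "c \<noteq> t" using assms(2,3) by auto
    then show "s1 c = val c" using s1(3) s \<open>c \<in> K\<close> by (simp add: agree_def)
  qed
  ultimately obtain s2 where "run fin s1 = Some s2" "s2 z = val z"
    "\<forall>c. c \<notin> {z, t} \<longrightarrow> s2 c = s1 c"
    using fin[of s1] s1(2) by auto
  then show "\<exists>s'. run (task z t xs fin) s = Some s' \<and> agree val (insert z K) s'"
    using s1(1) a1 assms(2,3) unfolding agree_def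
    by (intro exI[of _ s2]) (force simp: task_def run_append)
qed

lemma sum_list_upt_filter:
  fixes n :: nat and f :: "nat \<Rightarrow> real"
  shows "(\<Sum>k\<leftarrow>filter P [0..<n]. f k) = (\<Sum>k | k < n \<and> P k. f k)"
proof -
  have "(\<Sum>k\<leftarrow>filter P [0..<n]. f k) = sum f (set (filter P [0..<n]))"
    by (rule sum_list_distinct_conv_sum_set) simp
  also have "set (filter P [0..<n]) = {k. k < n \<and> P k}" by auto
  finally show ?thesis .
qed

lemma length_filter_upt:
  fixes n :: nat
  shows "length (filter P [0..<n]) = card {k. k < n \<and> P k}"
proof -
  have "length (filter P [0..<n]) = card (set (filter P [0..<n]))"
    by (rule distinct_card[symmetric]) simp
  also have "set (filter P [0..<n]) = {k. k < n \<and> P k}" by auto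
  finally show ?thesis .
qed

lemma length_concat_upt: "length (concat (map p [0..<n])) = (\<Sum>i<n. length (p i))"
  by (induction n) auto


text \<open>Row-major order is one in which the Cholesky recurrence can be evaluated. The column
  bound \<open>g\<close> serves both shapes in use: the lower triangle with \<open>g = Suc\<close>
  and the full square with constant \<open>g\<close>.\<close>

definition sweep ::
  "nat \<Rightarrow> (nat \<Rightarrow> nat) \<Rightarrow> (nat \<times> nat) set \<Rightarrow> (nat \<Rightarrow> nat \<Rightarrow> 'c instr list) \<Rightarrow> 'c instr list" where
  "sweep n g P p = concat (map (\<lambda>r. concat (map (\<lambda>c. if (r, c) \<in> P then p r c else []) [0..<g r])) [0..<n])"

lemma valid_sweep:
  assumes P: "P \<subseteq> (SIGMA r:{..<n}. {..<g r})"
    and step: "\<And>r c. (r, c) \<in> P \<Longrightarrow>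
      valid (agree val (K \<union> z ` {(a, b) \<in> P. a < r \<or> a = r \<and> b < c})) (p r c)
        (agree val (insert (z (r, c)) (K \<union> z ` {(a, b) \<in> P. a < r \<or> a = r \<and> b < c})))"
  shows "valid (agree val K) (sweep n g P p) (agree val (K \<union> z ` P))"
proof -
  let ?K = "\<lambda>r c. K \<union> z ` {(a, b) \<in> P. a < r \<or> a = r \<and> b < c}"
  let ?row = "\<lambda>r. concat (map (\<lambda>c. if (r, c) \<in> P then p r c else []) [0..<g r])"
  have entry: "valid (agree val (?K r c)) (if (r, c) \<in> P then p r c else []) (agree val (?K r (Suc c)))"
    for r c
  proof (cases "(r, c) \<in> P")
    case True
    have "valid (agree val (?K r c)) (p r c) (agree val (?K r (Suc c)))"
      by (rule valid_agree_mono[OF step[OF True]]) (auto simp: less_Suc_eq)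
    with True show ?thesis by simp
  next
    case False
    then have "?K r (Suc c) = ?K r c" by (auto simp: less_Suc_eq)
    with False show ?thesis by (simp add: valid_def)
  qed
  have "valid (agree val (?K r 0)) (?row r) (agree val (?K (Suc r) 0))" for r
  proof -
    have "valid (agree val (?K r 0)) (?row r) (agree val (?K r (g r)))"
      by (rule valid_loop[where K = "?K r"]) (rule entry)
    \<comment> \<open>\<open>P\<close> has no entry in row \<open>r\<close> from column
      \<open>g r\<close> on, so a completed row leaves the set with which the next row
      starts.\<close>
    then show ?thesis
      by (rule valid_agree_mono) (use P in \<open>auto simp: less_Suc_eq\<close>)
  qed
  then have "valid (agree val (?K 0 0)) (sweep n g P p) (agree val (?K n 0))"
    unfolding sweep_def by (intro valid_loop[where K = "\<lambda>r. ?K r 0"])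
  then show ?thesis
    by (rule valid_agree_mono) (use P in auto)
qed

lemma length_sweep:
  assumes P: "P \<subseteq> (SIGMA r:{..<n}. {..<g r})"
  shows "length (sweep n g P p) = (\<Sum>(r, c)\<in>P. length (p r c))"
proof -
  have "length (sweep n g P p) = (\<Sum>r<n. \<Sum>c<g r. if (r, c) \<in> P then length (p r c) else 0)"
    by (simp add: sweep_def length_concat_upt if_distrib cong: if_cong)
  also have "\<dots> = (\<Sum>(r, c)\<in>(SIGMA r:{..<n}. {..<g r}). if (r, c) \<in> P then length (p r c) else 0)"
    by (rule sum.Sigma) auto
  also have "\<dots> = (\<Sum>(r, c)\<in>P. length (p r c))"
    using P by (intro sum.mono_neutral_cong_right) auto
  finally show ?thesis .
qed

lemma accessed_sweep: "accessed (sweep n g P p) \<subseteq> (\<Union>(r, c)\<in>P. accessed (p r c))"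
  by (auto simp: sweep_def split: if_splits)

section \<open>Block indices\<close>

lemma offset_0 [simp]: "offset f 0 = 0"
  and offset_Suc [simp]: "offset f (Suc i) = offset f i + f i"
  by (simp_all add: offset_def)

lemma offset_mono: "i \<le> j \<Longrightarrow> offset f i \<le> offset f j"
  unfolding offset_def by (rule sum_mono2) auto

lemma offset_add_less: "i < l \<Longrightarrow> a < f i \<Longrightarrow> offset f i + a < offset f l"
  using offset_mono[of "Suc i" l f] by simp

lemma offset_decompose:
  assumes "r < offset f l"
  obtains i a where "i < l" "a < f i" "r = offset f i + a"
  using assms
proof (induction l arbitrary: thesis)
  case (Suc l)
  show ?case
  proof (cases "r < offset f l")
    case True
    then show ?thesis using Suc.IH Suc.prems(1) less_SucI by metis
  next
    case False
    then show ?thesis using Suc.prems(1)[of l "r - offset f l"] Suc.prems(2) by auto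
  qed
qed simp

text \<open>Blocks may be empty, as the block row of the root in \<open>N\<close> always is. The
  least \<open>i\<close> is nevertheless the block containing \<open>r\<close>: an empty block
  before it ends at or below \<open>r\<close>, and one after it has a larger index.\<close>

definition block_of :: "(nat \<Rightarrow> nat) \<Rightarrow> nat \<Rightarrow> nat" where
  "block_of f r = (LEAST i. r < offset f (Suc i))"

lemma block_of_offset [simp]: "a < f i \<Longrightarrow> block_of f (offset f i + a) = i"
  unfolding block_of_def
proof (rule Least_equality)
  fix y
  assume "a < f i" "offset f i + a < offset f (Suc y)"
  then show "i \<le> y" using offset_mono[of "Suc y" i f] by (cases "i \<le> y") auto
qed simp

lemma block_of_eqD:
  assumes "r < offset f l"
  shows "block_of f r < l" "offset f (block_of f r) \<le> r" "r - offset f (block_of f r) < f (block_of f r)"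
  using assms by (auto elim!: offset_decompose)

lemma mem_block_positions:
  "(r, c) \<in> block_positions rs k cs l R \<longleftrightarrow>
     r < offset rs k \<and> c < offset cs l \<and> R (block_of rs r) (block_of cs c)"
proof
  assume "(r, c) \<in> block_positions rs k cs l R"
  then show "r < offset rs k \<and> c < offset cs l \<and> R (block_of rs r) (block_of cs c)"
    unfolding block_positions_def by (auto intro: offset_add_less)
next
  assume *: "r < offset rs k \<and> c < offset cs l \<and> R (block_of rs r) (block_of cs c)"
  then obtain i a j b where "i < k" "a < rs i" "r = offset rs i + a"
    "j < l" "b < cs j" "c = offset cs j + b"
    by (meson offset_decompose)
  with * show "(r, c) \<in> block_positions rs k cs l R"
    unfolding block_positions_def by auto
qed

lemma offset_le: "(\<And>j. j < l \<Longrightarrow> f j \<le> B) \<Longrightarrow> offset f l \<le> l * B"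
  unfolding offset_def using sum_bounded_above[of "{..<l}" f B] by simp

lemma offset_const_1 [simp]: "offset (\<lambda>_. Suc 0) i = i"
  by (simp add: offset_def)

lemma block_of_const_1 [simp]: "block_of (\<lambda>_. Suc 0) i = i"
  using block_of_offset[of 0 "\<lambda>_. Suc 0" i] by simp

lemma card_blocks_le:
  assumes "\<And>j. j < l \<Longrightarrow> f j \<le> B" "finite X"
  shows "finite {c. c < offset f l \<and> block_of f c \<in> X}"
    and "card {c. c < offset f l \<and> block_of f c \<in> X} \<le> card X * B"
proof -
  let ?U = "\<Union>j\<in>X \<inter> {..<l}. {offset f j..<offset f j + f j}"
  have sub: "{c. c < offset f l \<and> block_of f c \<in> X} \<subseteq> ?U"
    by (auto elim!: offset_decompose)
  show "finite {c. c < offset f l \<and> block_of f c \<in> X}" by simp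
  have "card {c. c < offset f l \<and> block_of f c \<in> X} \<le> card ?U"
    using assms(2) by (intro card_mono sub) auto
  also have "\<dots> \<le> (\<Sum>j\<in>X \<inter> {..<l}. card {offset f j..<offset f j + f j})"
    using assms(2) by (intro card_UN_le) auto
  also have "\<dots> \<le> (\<Sum>j\<in>X \<inter> {..<l}. B)"
    using assms(1) by (intro sum_mono) auto
  also have "\<dots> \<le> card X * B"
    using assms(2) by (simp add: card_mono)
  finally show "card {c. c < offset f l \<and> block_of f c \<in> X} \<le> card X * B" .
qed

lemma sum_offset:
  fixes g :: "nat \<Rightarrow> 'a :: comm_monoid_add"
  shows "sum g {..<offset f l} = (\<Sum>i<l. \<Sum>a<f i. g (offset f i + a))"
proof (induction l)
  case (Suc l)
  have "sum g {..<offset f l + k} = sum g {..<offset f l} + (\<Sum>a<k. g (offset f l + a))" for k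
    by (induction k) (auto simp: add.assoc)
  with Suc show ?case by simp
qed simp

text \<open>Double counting of the triples \<open>(r, c, k)\<close>: for each \<open>k\<close> there
  are at most \<open>B * B\<close> pairs. Here \<open>k\<close> is the summation index of the inner
  products, so the sum is their total length; it runs over the rows of \<open>A\<close> or
  \<open>N\<close> when \<open>H\<close> is formed and over the columns of \<open>L\<close> in the
  factorization.\<close>

lemma sum_card_pairs_le:
  assumes "finite Q" "\<And>k. k < m \<Longrightarrow> finite {c. P k c} \<and> card {c. P k c} \<le> B"
  shows "(\<Sum>(r, c)\<in>Q. card {k. k < m \<and> P k r \<and> P k c}) \<le> m * B\<^sup>2"
proof -
  let ?X = "SIGMA q:Q. {k. k < m \<and> P k (fst q) \<and> P k (snd q)}"
  let ?Y = "SIGMA k:{..<m}. {c. P k c} \<times> {c. P k c}"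
  have finY: "finite ?Y" using assms(2) by (intro finite_SigmaI) auto
  have "(\<Sum>(r, c)\<in>Q. card {k. k < m \<and> P k r \<and> P k c}) = card ?X"
    using assms(1) by (simp add: card_SigmaI split_beta)
  also have "\<dots> \<le> card ?Y"
    by (rule card_inj_on_le[of "\<lambda>(q, k). (k, q)", OF _ _ finY]) (auto intro!: inj_onI)
  also have "\<dots> = (\<Sum>k<m. (card {c. P k c})\<^sup>2)"
    using assms(2) by (subst card_SigmaI) (auto simp: card_cartesian_product power2_eq_square)
  also have "\<dots> \<le> (\<Sum>k<m. B\<^sup>2)"
    using assms(2) by (intro sum_mono power_mono) auto
  finally show ?thesis by simp
qed

section \<open>Parents in rooted trees\<close>

definition no_cycle :: "nat set set \<Rightarrow> bool" where
  "no_cycle E \<longleftrightarrow> \<not> (\<exists>u v xs. path_between E u xs v \<and> length xs \<ge> 3 \<and> {v, u} \<in> E)"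

text \<open>Two paths to \<open>r\<close> that leave \<open>v\<close> through different neighbours
  meet again, and up to the first meeting point they enclose a cycle through \<open>v\<close>. This
  makes the description operator in \<open>tree_parent\<close> well defined.\<close>

lemma second_vertex_unique:
  assumes "no_cycle E" "path_between E v (v # a # xs) r" "path_between E v (v # b # ys) r"
  shows "a = b"
proof (rule ccontr)
  assume ne: "a \<noteq> b"
  let ?S = "\<lambda>x y. {x, y} \<in> E"
  have p: "v \<notin> set (a # xs)" "distinct (a # xs)" "successively ?S (a # xs)" "?S v a" "last (a # xs) = r"
    and q: "v \<notin> set (b # ys)" "distinct (b # ys)" "successively ?S (b # ys)" "?S v b" "last (b # ys) = r"
    using assms(2,3) by (auto simp: path_between_def)
  have "r \<in> set (a # xs)" "r \<in> set (b # ys)"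
    using p(5) q(5) by (metis last_in_set list.distinct(1))+
  then have "\<exists>x\<in>set (a # xs). x \<in> set (b # ys)" by blast
  then obtain us x us' where us: "a # xs = us @ x # us'" "x \<in> set (b # ys)"
    "\<forall>y\<in>set us. y \<notin> set (b # ys)"
    using split_list_first_prop[of "a # xs" "\<lambda>x. x \<in> set (b # ys)"] by blast
  obtain vs vs' where vs: "b # ys = vs @ x # vs'"
    using us(2) by (meson split_list)
  \<comment> \<open>Out along the first path to \<open>x\<close>, its first vertex on the second
    path, then back along the second path to \<open>b\<close>; the edge from \<open>b\<close> to
    \<open>v\<close> closes the cycle.\<close>
  let ?c = "v # us @ x # rev vs"
  have "hd (us @ [x]) = a" using us(1) by (cases us) auto
  moreover have "hd (vs @ [x]) = b" using vs by (cases vs) auto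
  ultimately have ab: "hd (us @ [x]) = a" "hd (vs @ [x]) = b" .
  \<comment> \<open>If both were empty, \<open>x\<close> would be \<open>a\<close> as well as
    \<open>b\<close>. Hence the closed walk has at least three vertices.\<close>
  have nonempty: "us \<noteq> [] \<or> vs \<noteq> []" using ab ne by auto
  have "distinct ?c"
    using p(1,2) q(1,2) us(3) unfolding us(1) vs by auto
  moreover have "last ?c = b"
    using ab(2) by (cases vs) auto
  moreover have "successively ?S (x # rev vs)"
  proof -
    have "successively ?S (vs @ [x])"
      using q(3) unfolding vs by (simp add: successively_append_iff successively_Cons)
    then have "successively ?S (rev (vs @ [x]))"
      by (simp only: successively_rev insert_commute)
    then show ?thesis by simp
  qed
  then have "successively ?S (us @ x # rev vs)"
    using p(3) unfolding us(1) by (auto simp: successively_append_iff)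
  then have "successively ?S ?c"
    using p(4) ab(1) by (cases us) (auto simp: successively_Cons)
  ultimately have "path_between E v ?c b" by (simp add: path_between_def)
  moreover have "length ?c \<ge> 3" using nonempty by (cases us; cases vs) auto
  moreover have "{b, v} \<in> E" using q(4) by (simp add: insert_commute)
  ultimately show False using assms(1) unfolding no_cycle_def by blast
qed

lemma tree_parent_eq:
  assumes "no_cycle E" "path_between E v (v # u # xs) r" "v \<noteq> r"
  shows "tree_parent E r v = u"
  unfolding tree_parent_def using assms(2,3) second_vertex_unique[OF assms(1)]
  by (auto intro!: the_equality)

lemma is_tree_no_cycle: "is_tree V E \<Longrightarrow> no_cycle E"
  by (simp add: is_tree_def no_cycle_def)

lemma is_tree_edgeD: "is_tree V E \<Longrightarrow> {u, v} \<in> E \<Longrightarrow> u \<in> V \<and> v \<in> V \<and> u \<noteq> v"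
  unfolding is_tree_def simple_graph_def by (metis doubleton_eq_iff)

lemma tree_parent_edge:
  assumes "is_tree V E" "r \<in> V" "v \<in> V" "v \<noteq> r"
  shows "{v, tree_parent E r v} \<in> E"
proof -
  obtain ps where ps: "path_between E v ps r"
    using assms unfolding is_tree_def by blast
  then obtain u xs where "ps = v # u # xs"
    using assms(4) unfolding path_between_def
    by (metis last_ConsL list.exhaust_sel)
  with ps show ?thesis
    using tree_parent_eq[OF is_tree_no_cycle[OF assms(1)], of v u xs r] assms(4)
    by (auto simp: path_between_def)
qed

text \<open>Consider the path from \<open>u\<close> to \<open>r\<close>. If it avoids
  \<open>v\<close>, prefixing \<open>v\<close> yields the path from \<open>v\<close>, and
  \<open>u\<close> is the parent of \<open>v\<close>; if it meets \<open>v\<close>, then directly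
  after \<open>u\<close>, and \<open>v\<close> is the parent of \<open>u\<close>. The root is
  arbitrary because the lemma serves the root of the structure as well as that of an
  ordering.\<close>

lemma tree_edge_parent:
  assumes "is_tree V E" "r \<in> V" "{u, v} \<in> E"
  shows "(v \<noteq> r \<and> tree_parent E r v = u) \<or> (u \<noteq> r \<and> tree_parent E r u = v)"
proof -
  note nc = is_tree_no_cycle[OF assms(1)]
  have uv: "u \<in> V" "v \<in> V" "u \<noteq> v" using is_tree_edgeD[OF assms(1,3)] by auto
  obtain ps where ps: "path_between E u ps r"
    using assms uv unfolding is_tree_def by blast
  show ?thesis
  proof (cases "v \<in> set ps")
    case False
    have "ps = u # tl ps" using ps by (cases ps) (auto simp: path_between_def)
    then obtain qs where "ps = u # qs" by blast
    then have "path_between E v (v # u # qs) r"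
      using ps False assms(3) by (simp add: path_between_def insert_commute)
    moreover have "v \<noteq> r" using False ps unfolding path_between_def by (metis last_in_set)
    ultimately show ?thesis using tree_parent_eq[OF nc] by blast
  next
    case True
    obtain rest where rest: "ps = u # rest" using ps by (cases ps) (auto simp: path_between_def)
    then obtain as bs where as: "rest = as @ v # bs"
      using True uv(3) by (metis set_ConsD split_list)
    \<comment> \<open>A longer way from \<open>u\<close> to \<open>v\<close> would be closed to a
      cycle by the edge between them.\<close>
    have "as = []"
    proof (rule ccontr)
      assume "as \<noteq> []"
      have "path_between E u (u # as @ [v]) v"
        using ps unfolding rest as path_between_def
        by (cases as) (auto simp: successively_append_iff successively_Cons hd_append)
      moreover have "length (u # as @ [v]) \<ge> 3" using \<open>as \<noteq> []\<close> by (cases as) auto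
      moreover have "{v, u} \<in> E" using assms(3) by (simp add: insert_commute)
      ultimately show False using nc unfolding no_cycle_def by blast
    qed
    then have "path_between E u (u # v # bs) r" using ps rest as by simp
    moreover from this have "u \<noteq> r" unfolding path_between_def
      by (metis distinct.simps(2) last_ConsR last_in_set list.discI)
    ultimately show ?thesis using tree_parent_eq[OF nc] by blast
  qed
qed

section \<open>Cholesky factors and triangular systems\<close>

lemma forward_substitution_ex:
  fixes L :: "nat \<Rightarrow> nat \<Rightarrow> real"
  assumes "\<And>i. i < n \<Longrightarrow> L i i \<noteq> 0"
  shows "\<exists>y. \<forall>i<n. (\<Sum>k<Suc i. L i k * y k) = b i"
  using assms
proof (induction n)
  case (Suc n)
  then obtain y where y: "\<forall>i<n. (\<Sum>k<Suc i. L i k * y k) = b i" by auto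
  let ?y = "y(n := (b n - (\<Sum>k<n. L n k * y k)) / L n n)"
  have "(\<Sum>k<Suc i. L i k * ?y k) = b i" if "i < Suc n" for i
  proof (cases "i = n")
    case True
    have "(\<Sum>k<n. L n k * ?y k) = (\<Sum>k<n. L n k * y k)" by (rule sum.cong) auto
    then show ?thesis using True Suc.prems[of n] by simp
  next
    case False
    then have "(\<Sum>k<Suc i. L i k * ?y k) = (\<Sum>k<Suc i. L i k * y k)"
      using that by (intro sum.cong) auto
    then show ?thesis using y False that by simp
  qed
  then show ?case by blast
qed simp

lemma backward_substitution_ex:
  fixes L :: "nat \<Rightarrow> nat \<Rightarrow> real"
  assumes "\<And>i. i < n \<Longrightarrow> L i i \<noteq> 0"
  shows "\<exists>x. \<forall>i<n. (\<Sum>k = i..<n. L k i * x k) = b i"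
  using assms
proof (induction n arbitrary: b)
  case (Suc n)
  \<comment> \<open>The last unknown is determined by the last equation alone. Its column then moves
    to the right-hand side, which is why the induction generalises over \<open>b\<close>.\<close>
  let ?c = "b n / L n n"
  obtain x where x: "\<forall>i<n. (\<Sum>k = i..<n. L k i * x k) = b i - L n i * ?c"
    using Suc.IH[of "\<lambda>i. b i - L n i * ?c"] Suc.prems by auto
  let ?x = "x(n := ?c)"
  have "(\<Sum>k = i..<Suc n. L k i * ?x k) = b i" if "i < Suc n" for i
  proof (cases "i = n")
    case False
    have "(\<Sum>k = i..<n. L k i * ?x k) = (\<Sum>k = i..<n. L k i * x k)" by (rule sum.cong) auto
    then show ?thesis using x False that by simp
  qed (use Suc.prems[of n] in simp)
  then show ?case by blast
qed simp

lemma lower_triangular_row_sum: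
  fixes L :: "nat \<Rightarrow> nat \<Rightarrow> real"
  assumes "\<And>k. i < k \<Longrightarrow> L i k = 0" "i < n"
  shows "(\<Sum>k<n. L i k * f k) = (\<Sum>k<Suc i. L i k * f k)"
  using assms by (intro sum.mono_neutral_right) auto

lemma lower_triangular_column_sum:
  fixes L :: "nat \<Rightarrow> nat \<Rightarrow> real"
  assumes "\<And>k. k < i \<Longrightarrow> L k i = 0"
  shows "(\<Sum>k<n. L k i * f k) = (\<Sum>k = i..<n. L k i * f k)"
  using assms by (intro sum.mono_neutral_right) auto

text \<open>\<open>x^T (L L^T) x\<close> is the squared norm of \<open>L^T x\<close>.
  \<open>L\<close> may be rectangular, so besides Cholesky factors this covers the Gram matrices
  \<open>A^T A\<close> and \<open>N^T N\<close>.\<close>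

lemma quadratic_form_factored:
  fixes L :: "nat \<Rightarrow> nat \<Rightarrow> real"
  assumes "\<And>i j. i < n \<Longrightarrow> j < n \<Longrightarrow> (\<Sum>k<m. L i k * L j k) = M i j"
  shows "(\<Sum>i<n. \<Sum>j<n. x i * M i j * x j) = (\<Sum>k<m. (\<Sum>i<n. L i k * x i)\<^sup>2)"
proof -
  have "(\<Sum>i<n. \<Sum>j<n. x i * M i j * x j) = (\<Sum>i<n. \<Sum>j<n. \<Sum>k<m. (L i k * x i) * (L j k * x j))"
    by (intro sum.cong refl)
      (simp add: assms[symmetric] sum_distrib_left sum_distrib_right algebra_simps)
  also have "\<dots> = (\<Sum>i<n. \<Sum>k<m. \<Sum>j<n. (L i k * x i) * (L j k * x j))"
    by (intro sum.cong refl sum.swap)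
  also have "\<dots> = (\<Sum>k<m. \<Sum>i<n. \<Sum>j<n. (L i k * x i) * (L j k * x j))"
    by (rule sum.swap)
  finally show ?thesis by (simp add: power2_eq_square sum_product)
qed

text \<open>Induction by bordering: with \<open>b\<close> the last column of \<open>M\<close> above
  the diagonal, the factor \<open>L\<close> of the leading block gets a new last row
  \<open>y\<close> with \<open>L y = b\<close>, and the new diagonal entry is the square root of the
  pivot \<open>M n n - y \<bullet> y\<close>. Definiteness makes the pivot positive.\<close>

lemma cholesky_ex:
  fixes M :: "nat \<Rightarrow> nat \<Rightarrow> real"
  assumes "\<And>i j. i < n \<Longrightarrow> j < n \<Longrightarrow> M i j = M j i"
    and "\<And>x. \<exists>i<n. x i \<noteq> 0 \<Longrightarrow> 0 < (\<Sum>i<n. \<Sum>j<n. x i * M i j * x j)"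
  shows "\<exists>L. (\<forall>i<n. 0 < L i i) \<and> (\<forall>i j. i < j \<longrightarrow> L i j = 0) \<and>
    (\<forall>i<n. \<forall>j<n. (\<Sum>k<n. L i k * L j k) = M i j)"
  using assms
proof (induction n)
  case 0
  show ?case by (rule exI[of _ "\<lambda>_ _. 0"]) simp
next
  case (Suc n)
  have "0 < (\<Sum>i<n. \<Sum>j<n. x i * M i j * x j)" if "\<exists>i<n. x i \<noteq> 0" for x
  proof -
    \<comment> \<open>Padding with a zero transfers definiteness to the leading block.\<close>
    let ?x = "x(n := 0)"
    have "0 < (\<Sum>i<Suc n. \<Sum>j<Suc n. ?x i * M i j * ?x j)"
      using that by (intro Suc.prems(2)) (auto intro: less_SucI)
    also have "\<dots> = (\<Sum>i<n. \<Sum>j<n. ?x i * M i j * ?x j)" by simp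
    also have "\<dots> = (\<Sum>i<n. \<Sum>j<n. x i * M i j * x j)" by (intro sum.cong) auto
    finally show ?thesis .
  qed
  then obtain L where L: "\<forall>i<n. 0 < L i i" "\<forall>i j. i < j \<longrightarrow> L i j = 0"
    "\<forall>i<n. \<forall>j<n. (\<Sum>k<n. L i k * L j k) = M i j"
    using Suc.IH[OF Suc.prems(1)] by auto
  have L_diag: "L i i \<noteq> 0" if "i < n" for i using L(1) that by (simp add: less_imp_neq[symmetric])
  obtain y where y: "\<forall>i<n. (\<Sum>k<Suc i. L i k * y k) = M i n"
    using forward_substitution_ex[of n L "\<lambda>i. M i n"] L_diag by blast
  have Ly: "(\<Sum>k<n. L i k * y k) = M i n" if "i < n" for i
    using lower_triangular_row_sum[of i L n y] L(2) y[rule_format, OF that] that by (simp del: sum.lessThan_Suc)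
  \<comment> \<open>Since \<open>L^T x = y\<close>, this \<open>x\<close> solves the system of the
    leading block with the last column as right-hand side. It serves to build the test vector for
    the pivot.\<close>
  obtain x where x: "\<forall>i<n. (\<Sum>k = i..<n. L k i * x k) = y i"
    using backward_substitution_ex[of n L y] L_diag by blast
  have Lx: "(\<Sum>k<n. L k i * x k) = y i" if "i < n" for i
    using lower_triangular_column_sum[where L = L and i = i and n = n and f = x] L(2) x that by simp
  have xMx: "(\<Sum>i<n. \<Sum>j<n. x i * M i j * x j) = (\<Sum>k<n. (y k)\<^sup>2)"
    using quadratic_form_factored[of n L n M x] L(3) Lx by simp
  have "(\<Sum>i<n. x i * M i n) = (\<Sum>i<n. \<Sum>k<n. x i * (L i k * y k))"
    by (simp add: Ly[symmetric] sum_distrib_left)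
  also have "\<dots> = (\<Sum>k<n. \<Sum>i<n. x i * (L i k * y k))" by (rule sum.swap)
  also have "\<dots> = (\<Sum>k<n. (\<Sum>i<n. L i k * x i) * y k)"
    by (simp add: sum_distrib_left sum_distrib_right algebra_simps)
  finally have xb: "(\<Sum>i<n. x i * M i n) = (\<Sum>k<n. (y k)\<^sup>2)"
    by (simp add: Lx power2_eq_square)
  \<comment> \<open>At \<open>(x, -1)\<close> the form is
    \<open>x \<bullet> M x - 2 (b \<bullet> x) + M n n\<close> with \<open>b\<close> the last
    column. Both \<open>x \<bullet> M x\<close> and \<open>b \<bullet> x\<close> equal
    \<open>y \<bullet> y\<close>, so the value is exactly the pivot.\<close>
  let ?z = "x(n := - 1)"
  have "0 < (\<Sum>i<Suc n. \<Sum>j<Suc n. ?z i * M i j * ?z j)"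
    by (intro Suc.prems(2) exI[of _ n]) simp
  also have "\<dots> = (\<Sum>i<n. (\<Sum>j<n. x i * M i j * x j) - x i * M i n) - (\<Sum>j<n. M n j * x j) + M n n"
    by (simp add: sum_negf sum_subtractf)
  also have "(\<Sum>j<n. M n j * x j) = (\<Sum>i<n. x i * M i n)"
    using Suc.prems(1) by (intro sum.cong) auto
  finally have pivot: "0 < M n n - (\<Sum>k<n. (y k)\<^sup>2)"
    by (simp add: sum_subtractf xMx xb)
  define L' where "L' i j = (if i = n then if j < n then y j
      else if j = n then sqrt (M n n - (\<Sum>k<n. (y k)\<^sup>2)) else 0 else L i j)" for i j
  have "(\<Sum>k<Suc n. L' i k * L' j k) = M i j" if ij: "i < Suc n" "j < Suc n" for i j
  proof -
    have *: "(\<Sum>k<n. L' n k * f k) = (\<Sum>k<n. y k * f k)" "(\<Sum>k<n. f k * L' n k) = (\<Sum>k<n. f k * y k)" for f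
      by (auto simp: L'_def intro!: sum.cong)
    have nn: "L' n n * L' n n = M n n - (\<Sum>k<n. (y k)\<^sup>2)" using pivot by (simp add: L'_def)
    have Ln: "L' i n = 0" "L' i k = L i k" if "i < n" for i k using that L(2) by (auto simp: L'_def)
    consider "i < n" "j < n" | "i = n" "j = n" | "i < n" "j = n" | "i = n" "j < n"
      using ij by linarith
    then show ?thesis
    proof cases
      case 1
      then show ?thesis using L(2,3) by (simp add: Ln)
    next
      case 2
      then show ?thesis using nn by (simp add: * ) (simp add: L'_def power2_eq_square)
    next
      case 3
      then show ?thesis using L(2) by (simp add: Ln * Ly)
    next
      case 4
      then show ?thesis using Suc.prems(1)[of n j] L(2) by (simp add: Ln * Ly mult.commute[of "y _"])
    qed
  qed
  moreover have "\<forall>i<Suc n. 0 < L' i i" using L(1) pivot by (auto simp: L'_def)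
  moreover have "\<forall>i j. i < j \<longrightarrow> L' i j = 0" using L(2) by (auto simp: L'_def)
  ultimately show ?case by blast
qed

text \<open>All terms beyond \<open>k = c\<close> vanish because \<open>L c k\<close> does;
  splitting off the term \<open>k = c\<close> leaves the recurrence that the program
  evaluates.\<close>

lemma cholesky_recurrence:
  fixes L :: "nat \<Rightarrow> nat \<Rightarrow> real"
  assumes "\<And>i j. i < j \<Longrightarrow> L i j = 0" "(\<Sum>k<n. L r k * L c k) = M r c" "c < n"
  shows "L r c * L c c = M r c - (\<Sum>k<c. L r k * L c k)"
  using lower_triangular_row_sum[of c L n "L r"] assms by (simp add: mult.commute)

text \<open>Strong induction on the column: a nonzero product \<open>L r k * L c k\<close> in the
  recurrence would place \<open>(r, k)\<close> and \<open>(c, k)\<close> in the pattern, and the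
  closure condition on \<open>P\<close> would then put \<open>(r, c)\<close> there, too. That
  condition is the one of a perfect elimination ordering. Every factor of \<open>M\<close> is
  covered, also one supplied as input.\<close>

lemma cholesky_no_fill:
  fixes L :: "nat \<Rightarrow> nat \<Rightarrow> real"
  assumes lower: "\<And>i j. i < j \<Longrightarrow> L i j = 0" and diag: "\<And>i. i < n \<Longrightarrow> L i i \<noteq> 0"
    and LL: "\<And>i j. i < n \<Longrightarrow> j < n \<Longrightarrow> (\<Sum>k<n. L i k * L j k) = M i j"
    and M: "\<And>r c. c \<le> r \<Longrightarrow> r < n \<Longrightarrow> \<not> P r c \<Longrightarrow> M r c = 0"
    and P: "\<And>k r c. k < c \<Longrightarrow> c \<le> r \<Longrightarrow> r < n \<Longrightarrow> P r k \<Longrightarrow> P c k \<Longrightarrow> P r c"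
  shows "c \<le> r \<Longrightarrow> r < n \<Longrightarrow> \<not> P r c \<Longrightarrow> L r c = 0"
proof (induction c arbitrary: r rule: less_induct)
  case (less c)
  have "L r k * L c k = 0" if "k < c" for k
    using less.IH[OF that, of r] less.IH[OF that, of c] P[OF that less.prems(1,2)] less.prems that
    by (metis le_less_trans less_imp_le mult_eq_0_iff order.trans)
  then have "(\<Sum>k<c. L r k * L c k) = 0" by (intro sum.neutral) auto
  then have "L r c * L c c = 0"
    using cholesky_recurrence[where L = L and n = n and r = r and c = c and M = M] lower LL
      less.prems M by simp
  then show ?case using diag less.prems by auto
qed


text \<open>\<open>L^T x = a - \<beta> y\<close> gives \<open>M x = b - \<beta> q\<close> and
  \<open>q \<bullet> x = y \<bullet> (L^T x) = \<beta>\<close>, so the update term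
  \<open>q (q \<bullet> x)\<close> restores exactly what \<open>M x\<close> lacks.\<close>

lemma rank_one_update_solution:
  fixes L M :: "nat \<Rightarrow> nat \<Rightarrow> real"
  assumes LL: "\<And>i j. i < n \<Longrightarrow> j < n \<Longrightarrow> (\<Sum>k<n. L i k * L j k) = M i j"
    and y: "\<And>i. i < n \<Longrightarrow> (\<Sum>k<n. L i k * y k) = q i"
    and a: "\<And>i. i < n \<Longrightarrow> (\<Sum>k<n. L i k * a k) = b i"
    and \<beta>: "\<beta> = (\<Sum>k<n. y k * a k) / ((\<Sum>k<n. y k * y k) + 1)"
    and x: "\<And>k. k < n \<Longrightarrow> (\<Sum>s<n. L s k * x s) = a k - \<beta> * y k"
    and r: "r < n"
  shows "(\<Sum>s<n. (M r s + q r * q s) * x s) = b r"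
proof -
  have "(\<Sum>s<n. M r s * x s) = (\<Sum>s<n. \<Sum>k<n. L r k * (L s k * x s))"
    using r by (intro sum.cong refl) (simp add: LL[symmetric] sum_distrib_right mult.assoc)
  also have "\<dots> = (\<Sum>k<n. \<Sum>s<n. L r k * (L s k * x s))" by (rule sum.swap)
  also have "\<dots> = (\<Sum>k<n. L r k * a k - \<beta> * (L r k * y k))"
    by (simp add: sum_distrib_left[symmetric] x) (simp add: algebra_simps)
  also have "\<dots> = b r - \<beta> * q r"
    using r by (simp add: sum_subtractf sum_distrib_left[symmetric] y a)
  finally have M: "(\<Sum>s<n. M r s * x s) = b r - \<beta> * q r" .
  have "(\<Sum>s<n. q s * x s) = (\<Sum>s<n. \<Sum>k<n. y k * (L s k * x s))"
    by (intro sum.cong refl) (simp add: y[symmetric] sum_distrib_left sum_distrib_right algebra_simps)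
  also have "\<dots> = (\<Sum>k<n. \<Sum>s<n. y k * (L s k * x s))" by (rule sum.swap)
  also have "\<dots> = (\<Sum>k<n. y k * a k - \<beta> * (y k * y k))"
    by (simp add: sum_distrib_left[symmetric] x) (simp add: algebra_simps)
  also have "\<dots> = (\<Sum>k<n. y k * a k) - \<beta> * (\<Sum>k<n. y k * y k)"
    by (simp add: sum_subtractf sum_distrib_left[symmetric])
  \<comment> \<open>This is how \<open>\<beta>\<close> is chosen: it solves
    \<open>y \<bullet> a - \<beta> (y \<bullet> y) = \<beta>\<close>. The denominator is at least
    1.\<close>
  also have "\<dots> = \<beta>"
  proof -
    have "0 \<le> (\<Sum>k<n. y k * y k)" by (intro sum_nonneg) auto
    then show ?thesis unfolding \<beta> by (simp add: field_simps)
  qed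
  finally have q: "(\<Sum>s<n. q s * x s) = \<beta>" .
  have "(\<Sum>s<n. (M r s + q r * q s) * x s) = (\<Sum>s<n. M r s * x s) + q r * (\<Sum>s<n. q s * x s)"
    by (simp add: sum.distrib sum_distrib_left algebra_simps)
  with M q show ?thesis by simp
qed

section \<open>Sparse programs\<close>

definition tmp :: cell where
  "tmp = (Work, 0, 0)"

text \<open>The permuted matrix is never built: \<open>\<rho>\<close> redirects the reads to the
  stored \<open>H\<close>, so the permutation costs no operation.\<close>

definition chol_task :: "(nat \<times> nat) set \<Rightarrow> (nat \<Rightarrow> nat) \<Rightarrow> nat \<Rightarrow> nat \<Rightarrow> cell instr list" where
  "chol_task P \<rho> r c = task (Arr_L, r, c) tmp
     (map (\<lambda>k. ((Arr_L, r, k), (Arr_L, c, k))) (filter (\<lambda>k. (r, k) \<in> P \<and> (c, k) \<in> P) [0..<c]))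
     [Sub (Arr_L, r, c) (Arr_H, \<rho> r, \<rho> c) (Arr_L, r, c),
      if r = c then Sqrt (Arr_L, r, c) (Arr_L, r, c)
      else Div (Arr_L, r, c) (Arr_L, r, c) (Arr_L, c, c)]"

definition chol_prog :: "nat \<Rightarrow> (nat \<times> nat) set \<Rightarrow> (nat \<Rightarrow> nat) \<Rightarrow> cell instr list" where
  "chol_prog n P \<rho> = sweep n Suc P (chol_task P \<rho>)"

lemma sparse_row_sum:
  fixes f :: "nat \<Rightarrow> real"
  assumes "\<And>k. k < m \<Longrightarrow> \<not> Q k \<Longrightarrow> f k = 0"
  shows "(\<Sum>k\<leftarrow>filter Q [0..<m]. f k) = (\<Sum>k<m. f k)"
  unfolding sum_list_upt_filter using assms by (intro sum.mono_neutral_left) auto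

text \<open>\<open>L\<close> is a factor known beforehand. The task for \<open>(r, c)\<close> reads
  \<open>(r, k)\<close> and \<open>(c, k)\<close> with \<open>k < c\<close> and, off the diagonal,
  the pivot \<open>(c, c)\<close>; all of them precede \<open>(r, c)\<close> in row-major order. The
  terms omitted by the sparse sum are zero because \<open>L\<close> vanishes off
  \<open>P\<close>.\<close>

lemma valid_chol_prog:
  fixes L :: "nat \<Rightarrow> nat \<Rightarrow> real"
  assumes P: "P \<subseteq> (SIGMA r:{..<n}. {..<Suc r})" and diag: "\<And>r. r < n \<Longrightarrow> (r, r) \<in> P"
    and pos: "\<And>i. i < n \<Longrightarrow> 0 < L i i"
    and zero: "\<And>r c. c \<le> r \<Longrightarrow> r < n \<Longrightarrow> (r, c) \<notin> P \<Longrightarrow> L r c = 0"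
    and rec: "\<And>r c. c \<le> r \<Longrightarrow> r < n \<Longrightarrow> L r c * L c c = val (Arr_H, \<rho> r, \<rho> c) - (\<Sum>k<c. L r k * L c k)"
    and val: "\<And>r c. (r, c) \<in> P \<Longrightarrow> val (Arr_L, r, c) = L r c"
    and H: "\<And>r c. (r, c) \<in> P \<Longrightarrow> (\<rho> r, \<rho> c) \<in> H"
  shows "valid (agree val (mat_cells Arr_H H)) (chol_prog n P \<rho>) (agree val (mat_cells Arr_L P))"
proof -
  have "valid (agree val (mat_cells Arr_H H)) (chol_prog n P \<rho>)
    (agree val (mat_cells Arr_H H \<union> (\<lambda>rc. (Arr_L, rc)) ` P))"
    unfolding chol_prog_def
  proof (rule valid_sweep[OF P])
    fix r c
    assume rc: "(r, c) \<in> P"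
    then have le: "c \<le> r" "r < n" using P by auto
    let ?K = "mat_cells Arr_H H \<union> (\<lambda>rc. (Arr_L, rc)) ` {(a, b) \<in> P. a < r \<or> a = r \<and> b < c}"
    let ?sum = "\<Sum>k<c. L r k * L c k"
    have sum: "(\<Sum>(x, y)\<leftarrow>map (\<lambda>k. ((Arr_L, r, k), (Arr_L, c, k)))
        (filter (\<lambda>k. (r, k) \<in> P \<and> (c, k) \<in> P) [0..<c]). val x * val y) = ?sum"
    proof -
      have "(\<Sum>(x, y)\<leftarrow>map (\<lambda>k. ((Arr_L, r, k), (Arr_L, c, k)))
        (filter (\<lambda>k. (r, k) \<in> P \<and> (c, k) \<in> P) [0..<c]). val x * val y) =
        (\<Sum>k\<leftarrow>filter (\<lambda>k. (r, k) \<in> P \<and> (c, k) \<in> P) [0..<c]. L r k * L c k)"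
        by (auto simp: o_def val intro!: arg_cong[where f = sum_list])
      also have "\<dots> = ?sum"
      proof (rule sparse_row_sum)
        fix k
        assume "k < c" "\<not> ((r, k) \<in> P \<and> (c, k) \<in> P)"
        then show "L r k * L c k = 0"
          using zero[of k r] zero[of k c] le by (cases "(r, k) \<in> P") auto
      qed
      finally show ?thesis .
    qed
    show "valid (agree val ?K) (chol_task P \<rho> r c) (agree val (insert (Arr_L, r, c) ?K))"
      unfolding chol_task_def
    proof (rule valid_task, goal_cases)
      case (4 x y)
      then show ?case using le by auto
    next
      case (5 s)
      have sH: "s (Arr_H, \<rho> r, \<rho> c) = val (Arr_H, \<rho> r, \<rho> c)"
        using 5(1) H[OF rc] by (auto simp: agree_def mat_cells_def)
      have sz: "s (Arr_L, r, c) = ?sum" using 5(2) sum by simp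
      have *: "L r c * L c c = s (Arr_H, \<rho> r, \<rho> c) - ?sum" using rec[OF le] sH by simp
      show ?case
      proof (cases "r = c")
        case True
        \<comment> \<open>The radicand is the square of the positive number \<open>L c c\<close>, so
          the root neither fails nor has the wrong sign.\<close>
        then have "s (Arr_H, \<rho> r, \<rho> c) - ?sum = (L c c)\<^sup>2" using * by (simp add: power2_eq_square)
        then show ?thesis using True pos[of c] le sz val[OF rc] by auto
      next
        case False
        then have "(c, c) \<in> {(a, b) \<in> P. a < r \<or> a = r \<and> b < c}" using le diag by auto
        then have "s (Arr_L, c, c) = L c c" using 5(1) val diag le by (auto simp: agree_def)
        moreover have "L c c \<noteq> 0" using pos[of c] le by simp
        ultimately show ?thesis using False * sz val[OF rc] by (auto simp: field_simps)
      qed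
    qed (auto simp: tmp_def mat_cells_def)
  qed
  then show ?thesis by (rule valid_agree_mono) (auto simp: mat_cells_def)
qed

lemma length_chol_prog_le:
  assumes P: "P \<subseteq> (SIGMA r:{..<n}. {..<Suc r})"
  shows "length (chol_prog n P \<rho>) \<le> 3 * card P + 2 * (\<Sum>(r, c)\<in>P. card {k. k < n \<and> (r, k) \<in> P \<and> (c, k) \<in> P})"
proof -
  have "length (chol_prog n P \<rho>) = (\<Sum>(r, c)\<in>P. length (chol_task P \<rho> r c))"
    unfolding chol_prog_def by (rule length_sweep[OF P])
  \<comment> \<open>The 3 counts the reset and the two final instructions; each term of the inner
    product costs a multiplication and an addition. The range \<open>k < c\<close> is relaxed to
    \<open>k < n\<close> to fit \<open>sum_card_pairs_le\<close>.\<close>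
  also have "\<dots> \<le> (\<Sum>(r, c)\<in>P. 3 + 2 * card {k. k < n \<and> (r, k) \<in> P \<and> (c, k) \<in> P})"
  proof (rule sum_mono, clarify)
    fix r c
    assume "(r, c) \<in> P"
    then have "card {k. k < c \<and> (r, k) \<in> P \<and> (c, k) \<in> P} \<le> card {k. k < n \<and> (r, k) \<in> P \<and> (c, k) \<in> P}"
      using P by (intro card_mono) auto
    then show "length (chol_task P \<rho> r c) \<le> 3 + 2 * card {k. k < n \<and> (r, k) \<in> P \<and> (c, k) \<in> P}"
      by (simp add: chol_task_def length_filter_upt)
  qed
  also have "\<dots> = 3 * card P + 2 * (\<Sum>(r, c)\<in>P. card {k. k < n \<and> (r, k) \<in> P \<and> (c, k) \<in> P})"
    by (simp add: split_beta sum.distrib sum_distrib_left)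
  finally show ?thesis .
qed

lemma accessed_chol_prog:
  assumes P: "P \<subseteq> (SIGMA r:{..<n}. {..<Suc r})" and diag: "\<And>r. r < n \<Longrightarrow> (r, r) \<in> P"
    and H: "\<And>r c. (r, c) \<in> P \<Longrightarrow> (\<rho> r, \<rho> c) \<in> H"
  shows "accessed (chol_prog n P \<rho>) \<subseteq> mat_cells Arr_H H \<union> mat_cells Arr_L P \<union> {tmp}"
proof -
  have "accessed (chol_task P \<rho> r c) \<subseteq> mat_cells Arr_H H \<union> mat_cells Arr_L P \<union> {tmp}"
    if rc: "(r, c) \<in> P" for r c
  proof -
    have "(c, c) \<in> P" using P rc diag by auto
    then show ?thesis
      using rc H[OF rc] accessed_task unfolding chol_task_def
      by (intro order.trans[OF accessed_task]) (auto simp: mat_cells_def)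
  qed
  then show ?thesis
    unfolding chol_prog_def by (intro order.trans[OF accessed_sweep]) blast
qed

section \<open>Sparse triangular systems\<close>

definition tri_solve :: "nat \<Rightarrow> (nat \<Rightarrow> nat) \<Rightarrow> (nat \<Rightarrow> nat \<Rightarrow> bool) \<Rightarrow> (nat \<Rightarrow> nat \<Rightarrow> cell) \<Rightarrow>
    (nat \<Rightarrow> cell) \<Rightarrow> (nat \<Rightarrow> cell) \<Rightarrow> cell instr list" where
  "tri_solve n ord Q cell b z = concat (map (\<lambda>i.
     task (z (ord i)) tmp (map (\<lambda>k. (cell (ord i) k, z k)) (filter (Q (ord i)) [0..<n]))
       [Sub (z (ord i)) (b (ord i)) (z (ord i)), Div (z (ord i)) (z (ord i)) (cell (ord i) (ord i))])
     [0..<n])"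

text \<open>One scheme covers \<open>L\<close> and its transpose: \<open>ord\<close> is the order of
  elimination, \<open>Q r\<close> the off-diagonal positions of row \<open>r\<close>, and
  \<open>cell\<close> the place of an entry, so the transpose only swaps indices. The assumption on
  \<open>Q\<close> says that only unknowns computed earlier are read; injectivity of
  \<open>ord\<close> and \<open>z\<close> makes each target cell fresh.\<close>

lemma valid_tri_solve:
  assumes ord: "bij_betw ord {..<n} {..<n}"
    and Q: "\<And>i k. i < n \<Longrightarrow> k < n \<Longrightarrow> Q (ord i) k \<Longrightarrow> k \<in> ord ` {..<i}"
    and z: "inj_on z {..<n}" "\<And>r. r < n \<Longrightarrow> z r \<notin> K" "\<And>r. r < n \<Longrightarrow> z r \<noteq> tmp"
    and K: "tmp \<notin> K" "\<And>r. r < n \<Longrightarrow> b r \<in> K" "\<And>r. r < n \<Longrightarrow> cell r r \<in> K"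
      "\<And>r k. r < n \<Longrightarrow> k < n \<Longrightarrow> Q r k \<Longrightarrow> cell r k \<in> K"
    and diag: "\<And>r. r < n \<Longrightarrow> val (cell r r) \<noteq> 0"
    and eq: "\<And>r. r < n \<Longrightarrow>
      (\<Sum>k | k < n \<and> Q r k. val (cell r k) * val (z k)) + val (cell r r) * val (z r) = val (b r)"
  shows "valid (agree val K) (tri_solve n ord Q cell b z) (agree val (K \<union> z ` {..<n}))"
proof -
  let ?K = "\<lambda>i. K \<union> z ` ord ` {..<i}"
  have "valid (agree val (?K 0)) (tri_solve n ord Q cell b z) (agree val (?K n))"
    unfolding tri_solve_def
  proof (rule valid_loop[where K = ?K])
    fix i
    assume i: "i < n"
    define r where "r = ord i"
    have ordn: "ord j < n" if "j < n" for j using ord that by (auto simp: bij_betw_def)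
    have r: "r < n" using ordn i by (simp add: r_def)
    have fresh: "z r \<notin> ?K i"
    proof -
      have "z r \<noteq> z (ord j)" if "j < i" for j
      proof -
        have "ord j \<noteq> ord i" using ord that i by (auto simp: bij_betw_def inj_on_def)
        then show ?thesis using z(1) r ordn[of j] that i by (auto simp: inj_on_def r_def)
      qed
      then show ?thesis using z(2)[OF r] by auto
    qed
    have "valid (agree val (?K i)) (task (z r) tmp (map (\<lambda>k. (cell r k, z k)) (filter (Q r) [0..<n]))
       [Sub (z r) (b r) (z r), Div (z r) (z r) (cell r r)]) (agree val (insert (z r) (?K i)))"
    proof (rule valid_task, goal_cases)
      case 1
      show ?case using z(3) r by simp
    next
      case 2
      show ?case by (rule fresh)
    next
      case 3
      have "tmp \<notin> z ` ord ` {..<i}" 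
      using z(3) ordn i by (auto simp: image_iff) (metis order.strict_trans)
      then show ?case using K(1) by simp
    next
      case (4 x y)
      then obtain k where "k < n" "Q r k" "x = cell r k" "y = z k" by auto
      then show ?case using K(4)[OF r] Q[OF i, of k] by (auto simp: r_def)
    next
      case (5 s)
      have sb: "s (b r) = val (b r)" and sc: "s (cell r r) = val (cell r r)"
        using 5(1) K(2,3) r by (auto simp: agree_def)
      have ne: "z r \<noteq> cell r r" using K(3) z(2) r by metis
      have "s (z r) = (\<Sum>k | k < n \<and> Q r k. val (cell r k) * val (z k))"
        using 5(2) by (simp add: o_def sum_list_upt_filter)
      then have "val (b r) - s (z r) = val (cell r r) * val (z r)" using eq[OF r] by simp
      then show ?case using sb sc ne diag[OF r] by simp
    qed
    then show "valid (agree val (?K i)) (task (z (ord i)) tmp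
        (map (\<lambda>k. (cell (ord i) k, z k)) (filter (Q (ord i)) [0..<n]))
       [Sub (z (ord i)) (b (ord i)) (z (ord i)), Div (z (ord i)) (z (ord i)) (cell (ord i) (ord i))])
       (agree val (?K (Suc i)))"
      unfolding r_def by (rule valid_agree_mono) (auto simp: less_Suc_eq)
  qed
  moreover have "ord ` {..<n} = {..<n}" using ord by (simp add: bij_betw_def)
  ultimately show ?thesis by simp
qed

lemma length_tri_solve:
  assumes "bij_betw ord {..<n} {..<n}"
  shows "length (tri_solve n ord Q cell b z) = 3 * n + 2 * (\<Sum>r<n. card {k. k < n \<and> Q r k})"
proof -
  have "length (tri_solve n ord Q cell b z) = (\<Sum>i<n. 3 + 2 * card {k. k < n \<and> Q (ord i) k})"
    by (simp add: numeral_3_eq_3 tri_solve_def length_concat_upt length_filter_upt)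
  also have "\<dots> = (\<Sum>r<n. 3 + 2 * card {k. k < n \<and> Q r k})"
    by (rule sum.reindex_bij_betw[OF assms])
  finally show ?thesis by (simp add: sum.distrib sum_distrib_left)
qed

lemma accessed_tri_solve:
  assumes "bij_betw ord {..<n} {..<n}"
    and "\<And>r. r < n \<Longrightarrow> cell r r \<in> X" "\<And>r k. r < n \<Longrightarrow> k < n \<Longrightarrow> Q r k \<Longrightarrow> cell r k \<in> X"
  shows "accessed (tri_solve n ord Q cell b z) \<subseteq> z ` {..<n} \<union> b ` {..<n} \<union> X \<union> {tmp}"
proof -
  have step: "accessed (task (z (ord i)) tmp (map (\<lambda>k. (cell (ord i) k, z k)) (filter (Q (ord i)) [0..<n]))
       [Sub (z (ord i)) (b (ord i)) (z (ord i)), Div (z (ord i)) (z (ord i)) (cell (ord i) (ord i))])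
     \<subseteq> z ` {..<n} \<union> b ` {..<n} \<union> X \<union> {tmp}" if "i < n" for i
  proof -
    have "ord i < n" using assms(1) that by (auto simp: bij_betw_def)
    then show ?thesis using assms(2,3) by (intro order.trans[OF accessed_task]) auto
  qed
  show ?thesis
  proof
    fix x
    assume "x \<in> accessed (tri_solve n ord Q cell b z)"
    then obtain i where "i < n" and
      x: "x \<in> accessed (task (z (ord i)) tmp (map (\<lambda>k. (cell (ord i) k, z k)) (filter (Q (ord i)) [0..<n]))
       [Sub (z (ord i)) (b (ord i)) (z (ord i)), Div (z (ord i)) (z (ord i)) (cell (ord i) (ord i))])"
      unfolding tri_solve_def by auto
    show "x \<in> z ` {..<n} \<union> b ` {..<n} \<union> X \<union> {tmp}"
      by (rule subsetD[OF step[OF \<open>i < n\<close>] x])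
  qed
qed

lemma bij_betw_reverse: "bij_betw (\<lambda>i. n - Suc i) {..<n} {..<n :: nat}"
  by (rule bij_betw_byWitness[where f' = "\<lambda>i. n - Suc i"]) auto

text \<open>With \<open>L y = P q\<close>, \<open>L a = P r\<close> and \<open>\<beta> = (y \<bullet> a) / (1 + y \<bullet> y)\<close>, the Sherman-Morrison formula shows that
  \<open>P u\<close> solves \<open>L\<^sup>T (P u) = a - \<beta> y\<close>. Columns 1, 2, 3 of the work array hold \<open>y\<close>, \<open>a\<close> and \<open>a - \<beta> y\<close>;
  the cells \<open>(1, 0)\<close> and \<open>(2, 0)\<close> hold \<open>1 + y \<bullet> y\<close> and \<open>\<beta>\<close>.\<close>

definition solve_prog :: "nat \<Rightarrow> (nat \<times> nat) set \<Rightarrow> (nat \<Rightarrow> nat) \<Rightarrow> cell instr list" where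
  "solve_prog n P \<rho> =
     tri_solve n (\<lambda>i. i) (\<lambda>r k. k < r \<and> (r, k) \<in> P) (\<lambda>r k. (Arr_L, r, k))
       (\<lambda>r. (Arr_q, \<rho> r, 0)) (\<lambda>r. (Work, r, 1)) @
     tri_solve n (\<lambda>i. i) (\<lambda>r k. k < r \<and> (r, k) \<in> P) (\<lambda>r k. (Arr_L, r, k))
       (\<lambda>r. (Arr_r, \<rho> r, 0)) (\<lambda>r. (Work, r, 2)) @
     task (Work, 1, 0) tmp (map (\<lambda>k. ((Work, k, 1), (Work, k, 1))) [0..<n])
       [Const tmp 1, Add (Work, 1, 0) (Work, 1, 0) tmp] @
     task (Work, 2, 0) tmp (map (\<lambda>k. ((Work, k, 1), (Work, k, 2))) [0..<n])
       [Div (Work, 2, 0) (Work, 2, 0) (Work, 1, 0)] @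
     concat (map (\<lambda>r. task (Work, r, 3) tmp [((Work, 2, 0), (Work, r, 1))]
       [Sub (Work, r, 3) (Work, r, 2) (Work, r, 3)]) [0..<n]) @
     tri_solve n (\<lambda>i. n - Suc i) (\<lambda>r k. r < k \<and> (k, r) \<in> P) (\<lambda>r k. (Arr_L, k, r))
       (\<lambda>r. (Work, r, 3)) (\<lambda>r. (Arr_u, \<rho> r, 0))"

text \<open>The solution is fixed before any memory is considered: \<open>y\<close>,
  \<open>a\<close> and then \<open>x'\<close> come from the substitution lemmas and become the
  target contents of the work and output cells. Hence one \<open>x\<close> serves all initial
  memories.\<close>

lemma valid_solve_prog:
  fixes L M :: "nat \<Rightarrow> nat \<Rightarrow> real" and q b :: "nat \<Rightarrow> real"
  assumes P: "P \<subseteq> (SIGMA r:{..<n}. {..<Suc r})" and diag: "\<And>r. r < n \<Longrightarrow> (r, r) \<in> P"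
    and lower: "\<And>i j. i < j \<Longrightarrow> L i j = 0"
    and pos: "\<And>i. i < n \<Longrightarrow> 0 < L i i"
    and zero: "\<And>r c. c \<le> r \<Longrightarrow> r < n \<Longrightarrow> (r, c) \<notin> P \<Longrightarrow> L r c = 0"
    and LL: "\<And>i j. i < n \<Longrightarrow> j < n \<Longrightarrow> (\<Sum>k<n. L i k * L j k) = M i j"
    and \<rho>: "bij_betw \<rho> {..<n} {..<n}"
  obtains x where "\<And>r. r < n \<Longrightarrow> (\<Sum>s<n. (M r s + q (\<rho> r) * q (\<rho> s)) * x (\<rho> s)) = b (\<rho> r)"
    "valid (\<lambda>s. (\<forall>(r, c)\<in>P. s (Arr_L, r, c) = L r c) \<and>
        (\<forall>i<n. s (Arr_q, i, 0) = q i) \<and> (\<forall>i<n. s (Arr_r, i, 0) = b i))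
      (solve_prog n P \<rho>) (\<lambda>s. \<forall>i<n. s (Arr_u, i, 0) = x i)"
proof -
  have nz: "L i i \<noteq> 0" if "i < n" for i using pos[OF that] by simp
  obtain y where y: "\<And>i. i < n \<Longrightarrow> (\<Sum>k<Suc i. L i k * y k) = q (\<rho> i)"
    using forward_substitution_ex[of n L "\<lambda>i. q (\<rho> i)"] nz by blast
  obtain a where a: "\<And>i. i < n \<Longrightarrow> (\<Sum>k<Suc i. L i k * a k) = b (\<rho> i)"
    using forward_substitution_ex[of n L "\<lambda>i. b (\<rho> i)"] nz by blast
  define \<beta> where "\<beta> = (\<Sum>k<n. y k * a k) / ((\<Sum>k<n. y k * y k) + 1)"
  obtain x' where x': "\<And>i. i < n \<Longrightarrow> (\<Sum>k = i..<n. L k i * x' k) = a i - \<beta> * y i"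
    using backward_substitution_ex[of n L "\<lambda>i. a i - \<beta> * y i"] nz by blast
  \<comment> \<open>\<open>x'\<close> solves the permuted system; undoing \<open>\<rho>\<close>
    gives the solution in the original numbering, which is the one stored in
    \<open>Arr_u\<close>.\<close>
  define x where "x = (\<lambda>i. x' (inv_into {..<n} \<rho> i))"
  have \<rho>n: "\<rho> i < n" if "i < n" for i using \<rho> that by (auto simp: bij_betw_def)
  have x\<rho>: "x (\<rho> i) = x' i" if "i < n" for i
    using \<rho> that by (simp add: x_def bij_betw_def)
  have sol: "(\<Sum>s<n. (M r s + q (\<rho> r) * q (\<rho> s)) * x (\<rho> s)) = b (\<rho> r)" if "r < n" for r
  proof -
    have "(\<Sum>s<n. (M r s + q (\<rho> r) * q (\<rho> s)) * x' s) = b (\<rho> r)"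
    proof (rule rank_one_update_solution[OF LL _ _ \<beta>_def _ that, where q = "\<lambda>i. q (\<rho> i)" and b = "\<lambda>i. b (\<rho> i)"])
      fix i assume "i < n"
      then show "(\<Sum>k<n. L i k * y k) = q (\<rho> i)" "(\<Sum>k<n. L i k * a k) = b (\<rho> i)"
        "(\<Sum>s<n. L s i * x' s) = a i - \<beta> * y i"
        using lower_triangular_row_sum[where L = L and i = i and n = n] y a x'
          lower_triangular_column_sum[where L = L and i = i and n = n] lower
        by (simp_all del: sum.lessThan_Suc)
    qed
    then show ?thesis by (simp add: x\<rho>)
  qed
  \<comment> \<open>The catch-all case describes the work array, where in column 0 only rows 1 and 2
    are meaningful. The value given to \<open>tmp\<close> is a dummy: \<open>tmp\<close> never joins
    the sets \<open>K0\<close> to \<open>K6\<close>.\<close>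
  define val :: "cell \<Rightarrow> real" where "val = (\<lambda>(arr, i, j). case arr of
      Arr_L \<Rightarrow> L i j | Arr_q \<Rightarrow> q i | Arr_r \<Rightarrow> b i | Arr_u \<Rightarrow> x i
    | _ \<Rightarrow> if j = 1 then y i else if j = 2 then a i else if j = 3 then a i - \<beta> * y i
        else if i = 1 then (\<Sum>k<n. y k * y k) + 1 else \<beta>)"
  have [simp]: "val (Arr_L, i, j) = L i j" "val (Arr_q, i, 0) = q i" "val (Arr_r, i, 0) = b i"
    "val (Arr_u, i, 0) = x i" "val (Work, i, Suc 0) = y i" "val (Work, i, 2) = a i"
    "val (Work, i, 3) = a i - \<beta> * y i" "val (Work, Suc 0, 0) = (\<Sum>k<n. y k * y k) + 1"
    "val (Work, 2, 0) = \<beta>" for i j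
    by (simp_all add: val_def)
  have low_sum: "(\<Sum>k | k < n \<and> k < r \<and> (r, k) \<in> P. L r k * f k) + L r r * f r = (\<Sum>k<Suc r. L r k * f k)"
    if "r < n" for r and f :: "nat \<Rightarrow> real"
  proof -
    have "(\<Sum>k | k < n \<and> k < r \<and> (r, k) \<in> P. L r k * f k) = (\<Sum>k<r. L r k * f k)"
      using zero[of _ r] that by (intro sum.mono_neutral_left) auto
    then show ?thesis by simp
  qed
  have up_sum: "(\<Sum>k | k < n \<and> r < k \<and> (k, r) \<in> P. L k r * f k) + L r r * f r = (\<Sum>k = r..<n. L k r * f k)"
    if "r < n" for r and f :: "nat \<Rightarrow> real"
  proof -
    have "(\<Sum>k | k < n \<and> r < k \<and> (k, r) \<in> P. L k r * f k) = (\<Sum>k = Suc r..<n. L k r * f k)"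
      using zero[of r] that by (intro sum.mono_neutral_left) auto
    then show ?thesis using that by (simp add: sum.atLeast_Suc_lessThan)
  qed
  let ?y = "\<lambda>r. (Work, r, 1 :: nat)" and ?a = "\<lambda>r. (Work, r, 2 :: nat)" and ?v = "\<lambda>r. (Work, r, 3 :: nat)"
  define K0 where "K0 = mat_cells Arr_L P \<union> (\<lambda>i. (Arr_q, i, 0 :: nat)) ` {..<n} \<union> (\<lambda>i. (Arr_r, i, 0 :: nat)) ` {..<n}"
  have K0: "(Arr_L, r, c) \<in> K0 \<longleftrightarrow> (r, c) \<in> P" "(Arr_q, i, 0) \<in> K0 \<longleftrightarrow> i < n" "(Arr_r, i, 0) \<in> K0 \<longleftrightarrow> i < n"
    "(Work, r, c) \<notin> K0" "(Arr_u, r, c) \<notin> K0" for r c i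
    by (auto simp: K0_def mat_cells_def)
  define K1 where "K1 = K0 \<union> ?y ` {..<n}"
  define K2 where "K2 = K1 \<union> ?a ` {..<n}"
  define K3 where "K3 = insert (Work, 1, 0) K2"
  define K4 where "K4 = insert (Work, 2, 0) K3"
  define K5 where "K5 = K4 \<union> ?v ` {..<n}"
  define K6 where "K6 = K5 \<union> (\<lambda>r. (Arr_u, \<rho> r, 0)) ` {..<n}"
  have s1: "valid (agree val K0) (tri_solve n (\<lambda>i. i) (\<lambda>r k. k < r \<and> (r, k) \<in> P) (\<lambda>r k. (Arr_L, r, k))
       (\<lambda>r. (Arr_q, \<rho> r, 0)) ?y) (agree val K1)"
    unfolding K1_def using diag nz low_sum[of _ y] y \<rho>n
    by (intro valid_tri_solve) (auto simp: K0 tmp_def inj_on_def bij_betw_def simp del: sum.lessThan_Suc)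
  have s2: "valid (agree val K1) (tri_solve n (\<lambda>i. i) (\<lambda>r k. k < r \<and> (r, k) \<in> P) (\<lambda>r k. (Arr_L, r, k))
       (\<lambda>r. (Arr_r, \<rho> r, 0)) ?a) (agree val K2)"
    unfolding K2_def using diag nz low_sum[of _ a] a \<rho>n
    by (intro valid_tri_solve) (auto simp: K0 K1_def tmp_def inj_on_def bij_betw_def simp del: sum.lessThan_Suc)
  have s3: "valid (agree val K2) (task (Work, 1, 0) tmp (map (\<lambda>k. (?y k, ?y k)) [0..<n])
       [Const tmp 1, Add (Work, 1, 0) (Work, 1, 0) tmp]) (agree val K3)"
    unfolding K3_def
    by (rule valid_task)
      (auto simp: K0 K1_def K2_def tmp_def o_def interv_sum_list_conv_sum_set_nat atLeast0LessThan)
  have s4: "valid (agree val K3) (task (Work, 2, 0) tmp (map (\<lambda>k. (?y k, ?a k)) [0..<n])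
       [Div (Work, 2, 0) (Work, 2, 0) (Work, 1, 0)]) (agree val K4)"
    unfolding K4_def
  proof (rule valid_task, goal_cases)
    case (5 s)
    have "0 \<le> (\<Sum>k<n. y k * y k)" by (intro sum_nonneg) auto
    moreover have "s (Work, Suc 0, 0) = (\<Sum>k<n. y k * y k) + 1"
      using 5(1) by (simp add: agree_def K3_def)
    ultimately show ?case using 5(2)
      by (auto simp: o_def interv_sum_list_conv_sum_set_nat atLeast0LessThan \<beta>_def)
  qed (auto simp: K0 K1_def K2_def K3_def tmp_def)
  have s5: "valid (agree val K4) (concat (map (\<lambda>r. task (Work, r, 3) tmp [((Work, 2, 0), (Work, r, 1))]
       [Sub (Work, r, 3) (Work, r, 2) (Work, r, 3)]) [0..<n])) (agree val K5)"
  proof -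
    let ?K = "\<lambda>i. K4 \<union> ?v ` {..<i}"
    have "valid (agree val (?K 0)) (concat (map (\<lambda>r. task (Work, r, 3) tmp [((Work, 2, 0), (Work, r, 1))]
       [Sub (Work, r, 3) (Work, r, 2) (Work, r, 3)]) [0..<n])) (agree val (?K n))"
    proof (rule valid_loop[where K = ?K])
      fix r
      assume r: "r < n"
      have "valid (agree val (?K r)) (task (Work, r, 3) tmp [((Work, 2, 0), (Work, r, 1))]
         [Sub (Work, r, 3) (Work, r, 2) (Work, r, 3)]) (agree val (insert (Work, r, 3) (?K r)))"
        using r by (intro valid_task) (auto simp: K0 K1_def K2_def K3_def K4_def tmp_def agree_def)
      then show "valid (agree val (?K r)) (task (Work, r, 3) tmp [((Work, 2, 0), (Work, r, 1))]
         [Sub (Work, r, 3) (Work, r, 2) (Work, r, 3)]) (agree val (?K (Suc r)))"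
        by (rule valid_agree_mono) (auto simp: less_Suc_eq)
    qed
    then show ?thesis by (simp add: K5_def)
  qed
  have s6: "valid (agree val K5) (tri_solve n (\<lambda>i. n - Suc i) (\<lambda>r k. r < k \<and> (k, r) \<in> P)
      (\<lambda>r k. (Arr_L, k, r)) ?v (\<lambda>r. (Arr_u, \<rho> r, 0))) (agree val K6)"
    unfolding K6_def
  proof (rule valid_tri_solve[OF bij_betw_reverse], goal_cases)
    case (1 i k)
    then show ?case by (intro image_eqI[of _ _ "n - Suc k"]) auto
  next
    case 2
    show ?case using \<rho> by (auto simp: inj_on_def bij_betw_def)
  next
    case (10 r)
    then show ?case using up_sum[of r x'] x' by (simp add: x\<rho> cong: conj_cong)
  qed (use diag nz in \<open>auto simp: K0 K1_def K2_def K3_def K4_def K5_def tmp_def\<close>)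
  have "valid (agree val K0) (solve_prog n P \<rho>) (agree val K6)"
    unfolding solve_prog_def by (intro valid_append[OF s1] valid_append[OF s2] valid_append[OF s3]
        valid_append[OF s4] valid_append[OF s5] s6)
  then have "valid (\<lambda>s. (\<forall>(r, c)\<in>P. s (Arr_L, r, c) = L r c) \<and>
        (\<forall>i<n. s (Arr_q, i, 0) = q i) \<and> (\<forall>i<n. s (Arr_r, i, 0) = b i))
      (solve_prog n P \<rho>) (\<lambda>s. \<forall>i<n. s (Arr_u, i, 0) = x i)"
  proof (rule valid_weaken)
    fix s
    assume "(\<forall>(r, c)\<in>P. s (Arr_L, r, c) = L r c) \<and>
        (\<forall>i<n. s (Arr_q, i, 0) = q i) \<and> (\<forall>i<n. s (Arr_r, i, 0) = b i)"
    then show "agree val K0 s" by (auto simp: agree_def K0_def mat_cells_def)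
  next
    fix s
    assume s: "agree val K6 s"
    show "\<forall>i<n. s (Arr_u, i, 0) = x i"
    proof (intro allI impI)
      fix i
      assume "i < n"
      then obtain r where "r < n" "i = \<rho> r" using \<rho> by (auto simp: bij_betw_def)
      then show "s (Arr_u, i, 0) = x i" using s by (auto simp: agree_def K6_def)
    qed
  qed
  with sol show thesis by (rule that)
qed

text \<open>\<open>17 * n\<close> is \<open>9 * n\<close> for the three triangular solves,
  \<open>4 * n\<close> for the two inner products and \<open>4 * n\<close> for
  \<open>a - \<beta> y\<close>. Each solve reads every off-diagonal position of the pattern once, at
  two instructions each.\<close>

lemma length_solve_prog_le:
  assumes P: "P \<subseteq> (SIGMA r:{..<n}. {..<Suc r})"
  shows "length (solve_prog n P \<rho>) \<le> 17 * n + 5 + 6 * card P"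
proof -
  have fin: "finite P" using P by (rule finite_subset) auto
  have id: "bij_betw (\<lambda>i. i) {..<n} {..<n}" by (simp add: bij_betw_def)
  have "(\<Sum>r<n. card {k. k < n \<and> k < r \<and> (r, k) \<in> P}) = card (SIGMA r:{..<n}. {k. k < n \<and> k < r \<and> (r, k) \<in> P})"
    by (subst card_SigmaI) auto
  also have "\<dots> \<le> card P" by (rule card_mono[OF fin]) auto
  finally have low: "(\<Sum>r<n. card {k. k < n \<and> k < r \<and> (r, k) \<in> P}) \<le> card P" .
  have "(\<Sum>r<n. card {k. k < n \<and> r < k \<and> (k, r) \<in> P}) = card (SIGMA r:{..<n}. {k. k < n \<and> r < k \<and> (k, r) \<in> P})"
    by (subst card_SigmaI) auto
  also have "\<dots> \<le> card P"
    by (rule card_inj_on_le[of "\<lambda>(r, k). (k, r)", OF _ _ fin]) (auto simp: inj_on_def)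
  finally have up: "(\<Sum>r<n. card {k. k < n \<and> r < k \<and> (k, r) \<in> P}) \<le> card P" .
  show ?thesis
    using low up by (simp add: solve_prog_def length_tri_solve[OF id] length_tri_solve[OF bij_betw_reverse]
        length_concat_upt)
qed

lemma accessed_solve_prog:
  assumes P: "P \<subseteq> (SIGMA r:{..<n}. {..<Suc r})" and diag: "\<And>r. r < n \<Longrightarrow> (r, r) \<in> P"
    and \<rho>: "bij_betw \<rho> {..<n} {..<n}"
  shows "accessed (solve_prog n P \<rho>) \<subseteq> mat_cells Arr_L P \<union> vec_cells Arr_q n \<union> vec_cells Arr_r n \<union>
    vec_cells Arr_u n \<union> {Work} \<times> ({..<n} \<times> {1, 2, 3} \<union> {0, 1, 2} \<times> {0})" (is "_ \<subseteq> ?X")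
proof -
  have id: "bij_betw (\<lambda>i. i) {..<n} {..<n}" by (simp add: bij_betw_def)
  have \<rho>n: "\<rho> i < n" if "i < n" for i using \<rho> that by (auto simp: bij_betw_def)
  have 1: "accessed (tri_solve n (\<lambda>i. i) (\<lambda>r k. k < r \<and> (r, k) \<in> P) (\<lambda>r k. (Arr_L, r, k)) b z) \<subseteq>
      z ` {..<n} \<union> b ` {..<n} \<union> mat_cells Arr_L P \<union> {tmp}" for b z
    using diag by (intro accessed_tri_solve[OF id]) (auto simp: mat_cells_def)
  have 2: "accessed (tri_solve n (\<lambda>i. n - Suc i) (\<lambda>r k. r < k \<and> (k, r) \<in> P) (\<lambda>r k. (Arr_L, k, r)) b z) \<subseteq>
      z ` {..<n} \<union> b ` {..<n} \<union> mat_cells Arr_L P \<union> {tmp}" for b z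
    using diag by (intro accessed_tri_solve[OF bij_betw_reverse]) (auto simp: mat_cells_def)
  have 3: "accessed (concat (map (\<lambda>r. task (Work, r, 3) tmp [((Work, 2, 0), (Work, r, 1))]
       [Sub (Work, r, 3) (Work, r, 2) (Work, r, 3)]) [0..<n])) \<subseteq> ?X"
    by (auto simp: task_def tmp_def)
  have 4: "accessed (task (Work, 1, 0) tmp (map (\<lambda>k. ((Work, k, 1), (Work, k, 1))) [0..<n])
       [Const tmp 1, Add (Work, 1, 0) (Work, 1, 0) tmp]) \<subseteq> ?X"
    by (rule order.trans[OF accessed_task]) (auto simp: tmp_def)
  have 5: "accessed (task (Work, 2, 0) tmp (map (\<lambda>k. ((Work, k, 1), (Work, k, 2))) [0..<n])
       [Div (Work, 2, 0) (Work, 2, 0) (Work, 1, 0)]) \<subseteq> ?X"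
    by (rule order.trans[OF accessed_task]) (auto simp: tmp_def)
  show ?thesis
    unfolding solve_prog_def accessed_append
    by (intro Un_least 3 4 5 order.trans[OF 1] order.trans[OF 2])
      (auto simp: vec_cells_def tmp_def \<rho>n)
qed

section \<open>Forming H and q\<close>

definition form_H_task :: "nat \<Rightarrow> nat \<Rightarrow> (nat \<times> nat) set \<Rightarrow> (nat \<times> nat) set \<Rightarrow> (nat \<times> nat) set \<Rightarrow>
    nat \<Rightarrow> nat \<Rightarrow> cell instr list" where
  "form_H_task m m' PA PN PD r c = task (Arr_H, r, c) tmp
     (map (\<lambda>k. ((Arr_A, k, r), (Arr_A, k, c))) (filter (\<lambda>k. (k, r) \<in> PA \<and> (k, c) \<in> PA) [0..<m]) @
      map (\<lambda>k. ((Arr_N, k, r), (Arr_N, k, c))) (filter (\<lambda>k. (k, r) \<in> PN \<and> (k, c) \<in> PN) [0..<m']))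
     (Mul (Arr_H, r, c) (Arr_H, r, c) (Arr_sigma, 0, 0) #
      (if (r, c) \<in> PD then [Add (Arr_H, r, c) (Arr_H, r, c) (Arr_D, r, c)] else []))"

definition form_q_task :: "nat \<Rightarrow> nat \<Rightarrow> (nat \<times> nat) set \<Rightarrow> (nat \<times> nat) set \<Rightarrow> nat \<Rightarrow> cell instr list" where
  "form_q_task m m' PA PN r = task (Arr_q, r, 0) tmp
     (map (\<lambda>k. ((Arr_A, k, r), (Arr_w, k, 0))) (filter (\<lambda>k. (k, r) \<in> PA) [0..<m]) @
      map (\<lambda>k. ((Arr_N, k, r), (Arr_w, m + k, 0))) (filter (\<lambda>k. (k, r) \<in> PN) [0..<m'])) []"

definition form_prog :: "nat \<Rightarrow> nat \<Rightarrow> nat \<Rightarrow> (nat \<times> nat) set \<Rightarrow> (nat \<times> nat) set \<Rightarrow> (nat \<times> nat) set \<Rightarrow>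
    (nat \<times> nat) set \<Rightarrow> cell instr list" where
  "form_prog n m m' PA PN PD PH = sweep n (\<lambda>_. n) PH (form_H_task m m' PA PN PD) @
     concat (map (form_q_task m m' PA PN) [0..<n])"

text \<open>The products from \<open>A\<close> and \<open>N\<close> are accumulated in one inner
  product, so \<open>\<sigma>\<close> is multiplied in once per entry; \<open>D\<close> is added
  only on its own pattern, off which it is zero. The part of \<open>w\<close> belonging to
  \<open>N\<close> starts at position \<open>m\<close>.\<close>

lemma valid_form_prog:
  fixes A N D H :: "nat \<Rightarrow> nat \<Rightarrow> real" and q w :: "nat \<Rightarrow> real"
  assumes PH: "PH \<subseteq> {..<n} \<times> {..<n}"
    and zero: "\<And>k c. k < m \<Longrightarrow> c < n \<Longrightarrow> (k, c) \<notin> PA \<Longrightarrow> A k c = 0"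
      "\<And>k c. k < m' \<Longrightarrow> c < n \<Longrightarrow> (k, c) \<notin> PN \<Longrightarrow> N k c = 0"
      "\<And>r c. r < n \<Longrightarrow> c < n \<Longrightarrow> (r, c) \<notin> PD \<Longrightarrow> D r c = 0"
    and H: "\<And>r c. r < n \<Longrightarrow> c < n \<Longrightarrow>
      H r c = D r c + \<sigma> * (\<Sum>k<m. A k r * A k c) + \<sigma> * (\<Sum>k<m'. N k r * N k c)"
    and q: "\<And>r. r < n \<Longrightarrow> q r = (\<Sum>k<m. A k r * w k) + (\<Sum>k<m'. N k r * w (m + k))"
  shows "valid (\<lambda>s. (\<forall>(k, c)\<in>PA. s (Arr_A, k, c) = A k c) \<and> (\<forall>(k, c)\<in>PN. s (Arr_N, k, c) = N k c) \<and>
      (\<forall>(r, c)\<in>PD. s (Arr_D, r, c) = D r c) \<and> s (Arr_sigma, 0, 0) = \<sigma> \<and> (\<forall>k<m + m'. s (Arr_w, k, 0) = w k))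
    (form_prog n m m' PA PN PD PH)
    (\<lambda>s. (\<forall>(r, c)\<in>PH. s (Arr_H, r, c) = H r c) \<and> (\<forall>r<n. s (Arr_q, r, 0) = q r))"
proof -
  define val :: "cell \<Rightarrow> real" where "val = (\<lambda>(arr, i, j). case arr of
      Arr_A \<Rightarrow> A i j | Arr_N \<Rightarrow> N i j | Arr_D \<Rightarrow> D i j | Arr_sigma \<Rightarrow> \<sigma> | Arr_w \<Rightarrow> w i
    | Arr_H \<Rightarrow> H i j | _ \<Rightarrow> q i)"
  have [simp]: "val (Arr_A, i, j) = A i j" "val (Arr_N, i, j) = N i j" "val (Arr_D, i, j) = D i j"
    "val (Arr_sigma, i, j) = \<sigma>" "val (Arr_w, i, j) = w i" "val (Arr_H, i, j) = H i j"
    "val (Arr_q, i, j) = q i" for i j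
    by (simp_all add: val_def)
  define K0 where "K0 = mat_cells Arr_A PA \<union> mat_cells Arr_N PN \<union> mat_cells Arr_D PD \<union>
    {(Arr_sigma, 0, 0)} \<union> vec_cells Arr_w (m + m')"
  have K0: "(Arr_A, r, c) \<in> K0 \<longleftrightarrow> (r, c) \<in> PA" "(Arr_N, r, c) \<in> K0 \<longleftrightarrow> (r, c) \<in> PN"
    "(Arr_D, r, c) \<in> K0 \<longleftrightarrow> (r, c) \<in> PD" "(Arr_sigma, 0, 0) \<in> K0" "(Arr_w, k, 0) \<in> K0 \<longleftrightarrow> k < m + m'"
    "(Work, r, c) \<notin> K0" "(Arr_H, r, c) \<notin> K0" "(Arr_q, r, c) \<notin> K0" for r c k
    by (auto simp: K0_def mat_cells_def vec_cells_def)
  let ?KH = "K0 \<union> (\<lambda>rc. (Arr_H, rc)) ` PH"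
  have "valid (agree val K0) (sweep n (\<lambda>_. n) PH (form_H_task m m' PA PN PD)) (agree val ?KH)"
  proof (rule valid_sweep)
    fix r c
    assume "(r, c) \<in> PH"
    then have rc: "r < n" "c < n" using PH by auto
    let ?K = "K0 \<union> (\<lambda>rc. (Arr_H, rc)) ` {(a, b). (a, b) \<in> PH \<and> (a < r \<or> a = r \<and> b < c)}"
    show "valid (agree val ?K) (form_H_task m m' PA PN PD r c) (agree val (insert (Arr_H, r, c) ?K))"
      unfolding form_H_task_def
    proof (rule valid_task, goal_cases)
      case (5 s)
      have "(\<Sum>k\<leftarrow>filter (\<lambda>k. (k, r) \<in> PA \<and> (k, c) \<in> PA) [0..<m]. A k r * A k c) = (\<Sum>k<m. A k r * A k c)"
        using zero(1) rc by (intro sparse_row_sum) auto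
      moreover have "(\<Sum>k\<leftarrow>filter (\<lambda>k. (k, r) \<in> PN \<and> (k, c) \<in> PN) [0..<m']. N k r * N k c) = (\<Sum>k<m'. N k r * N k c)"
        using zero(2) rc by (intro sparse_row_sum) auto
      moreover have "s (Arr_sigma, 0, 0) = \<sigma>" "(r, c) \<in> PD \<Longrightarrow> s (Arr_D, r, c) = D r c"
        using 5(1) by (auto simp: agree_def K0)
      ultimately show ?case
        using 5(2) zero(3)[OF rc] H[OF rc] by (auto simp: o_def algebra_simps)
    qed (auto simp: K0 tmp_def)
  qed (use PH in auto)
  moreover have "valid (agree val ?KH) (concat (map (form_q_task m m' PA PN) [0..<n]))
    (agree val (?KH \<union> (\<lambda>r. (Arr_q, r, 0)) ` {..<n}))"
  proof -
    let ?K = "\<lambda>r. ?KH \<union> (\<lambda>r. (Arr_q, r, 0)) ` {..<r}"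
    have "valid (agree val (?K 0)) (concat (map (form_q_task m m' PA PN) [0..<n])) (agree val (?K n))"
    proof (rule valid_loop[where K = ?K])
      fix r
      assume r: "r < n"
      have "valid (agree val (?K r)) (form_q_task m m' PA PN r) (agree val (insert (Arr_q, r, 0) (?K r)))"
        unfolding form_q_task_def
      proof (rule valid_task, goal_cases)
        case (5 s)
        have "(\<Sum>k\<leftarrow>filter (\<lambda>k. (k, r) \<in> PA) [0..<m]. A k r * w k) = (\<Sum>k<m. A k r * w k)"
          using zero(1) r by (intro sparse_row_sum) auto
        moreover have "(\<Sum>k\<leftarrow>filter (\<lambda>k. (k, r) \<in> PN) [0..<m']. N k r * w (m + k)) = (\<Sum>k<m'. N k r * w (m + k))"
          using zero(2) r by (intro sparse_row_sum) auto
        ultimately show ?case using 5(2) q[OF r] by (auto simp: o_def)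
      qed (auto simp: K0 tmp_def)
      then show "valid (agree val (?K r)) (form_q_task m m' PA PN r) (agree val (?K (Suc r)))"
        by (rule valid_agree_mono) (auto simp: less_Suc_eq)
    qed
    then show ?thesis by simp
  qed
  ultimately have "valid (agree val K0) (form_prog n m m' PA PN PD PH)
      (agree val (?KH \<union> (\<lambda>r. (Arr_q, r, 0)) ` {..<n}))"
    unfolding form_prog_def by (rule valid_append)
  then show ?thesis
    by (rule valid_weaken) (auto simp: agree_def K0_def mat_cells_def vec_cells_def)
qed

lemma length_form_prog_le:
  assumes PH: "PH \<subseteq> {..<n} \<times> {..<n}" and fin: "finite PA" "finite PN"
  shows "length (form_prog n m m' PA PN PD PH) \<le> 3 * card PH +
    2 * (\<Sum>(r, c)\<in>PH. card {k. k < m \<and> (k, r) \<in> PA \<and> (k, c) \<in> PA}) +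
    2 * (\<Sum>(r, c)\<in>PH. card {k. k < m' \<and> (k, r) \<in> PN \<and> (k, c) \<in> PN}) +
    n + 2 * card PA + 2 * card PN"
proof -
  \<comment> \<open>Summed over all components of \<open>q\<close>, the inner products have at most
    one term per stored entry of \<open>A\<close> or \<open>N\<close>.\<close>
  have col: "(\<Sum>r<n. card {k. k < j \<and> (k, r) \<in> Q}) \<le> card Q" if "finite Q" for Q :: "(nat \<times> nat) set" and j
  proof -
    have "finite {k. k < j \<and> (k, r) \<in> Q}" for r
      by (rule finite_subset[of _ "{..<j}"]) auto
    then have "(\<Sum>r<n. card {k. k < j \<and> (k, r) \<in> Q}) = card (SIGMA r:{..<n}. {k. k < j \<and> (k, r) \<in> Q})"
      by (subst card_SigmaI) blast+
    also have "\<dots> \<le> card Q"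
      by (rule card_inj_on_le[of "\<lambda>(r, k). (k, r)", OF _ _ that]) (auto simp: inj_on_def)
    finally show ?thesis .
  qed
  have "length (sweep n (\<lambda>_. n) PH (form_H_task m m' PA PN PD)) =
      (\<Sum>(r, c)\<in>PH. length (form_H_task m m' PA PN PD r c))"
    using PH by (intro length_sweep) auto
  also have "\<dots> \<le> (\<Sum>(r, c)\<in>PH. 3 + 2 * card {k. k < m \<and> (k, r) \<in> PA \<and> (k, c) \<in> PA} +
      2 * card {k. k < m' \<and> (k, r) \<in> PN \<and> (k, c) \<in> PN})"
    by (intro sum_mono) (auto simp: form_H_task_def length_filter_upt)
  also have "\<dots> = 3 * card PH + 2 * (\<Sum>(r, c)\<in>PH. card {k. k < m \<and> (k, r) \<in> PA \<and> (k, c) \<in> PA}) +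
    2 * (\<Sum>(r, c)\<in>PH. card {k. k < m' \<and> (k, r) \<in> PN \<and> (k, c) \<in> PN})"
    by (simp add: split_beta sum.distrib sum_distrib_left)
  finally have "length (sweep n (\<lambda>_. n) PH (form_H_task m m' PA PN PD)) \<le> \<dots>" .
  moreover have "length (concat (map (form_q_task m m' PA PN) [0..<n])) =
      n + 2 * (\<Sum>r<n. card {k. k < m \<and> (k, r) \<in> PA}) + 2 * (\<Sum>r<n. card {k. k < m' \<and> (k, r) \<in> PN})"
    by (simp add: length_concat_upt form_q_task_def length_filter_upt sum.distrib sum_distrib_left sum_Suc)
  ultimately show ?thesis
    using col[OF fin(1), of m] col[OF fin(2), of m'] by (simp add: form_prog_def)
qed

lemma accessed_form_prog:
  assumes "PH \<subseteq> {..<n} \<times> {..<n}"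
  shows "accessed (form_prog n m m' PA PN PD PH) \<subseteq> mat_cells Arr_A PA \<union> mat_cells Arr_N PN \<union>
    mat_cells Arr_D PD \<union> vec_cells Arr_sigma 1 \<union> vec_cells Arr_w (m + m') \<union> mat_cells Arr_H PH \<union>
    vec_cells Arr_q n \<union> {tmp}" (is "_ \<subseteq> ?X")
proof -
  have "accessed (form_H_task m m' PA PN PD r c) \<subseteq> ?X" if "(r, c) \<in> PH" for r c
    unfolding form_H_task_def using that
    by (intro order.trans[OF accessed_task]) (auto simp: mat_cells_def vec_cells_def)
  then have "accessed (sweep n (\<lambda>_. n) PH (form_H_task m m' PA PN PD)) \<subseteq> ?X"
    by (intro order.trans[OF accessed_sweep]) blast
  moreover have "accessed (form_q_task m m' PA PN r) \<subseteq> ?X" if "r < n" for r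
    unfolding form_q_task_def using that
    by (intro order.trans[OF accessed_task]) (auto simp: mat_cells_def vec_cells_def)
  then have "accessed (concat (map (form_q_task m m' PA PN) [0..<n])) \<subseteq> ?X" by force
  ultimately show ?thesis by (simp add: form_prog_def)
qed

section \<open>Matrices of the clique tree conversion\<close>

lemma tri_0 [simp]: "tri 0 = 0"
  by (simp add: tri_def)

lemma tri_Suc: "tri (Suc k) = tri k + Suc k"
  by (simp add: tri_def)

lemma tri_mono: "i \<le> j \<Longrightarrow> tri i \<le> tri j"
  unfolding tri_def by (intro div_le_mono mult_le_mono) auto

lemma tri_le_square: "tri k \<le> k\<^sup>2"
  by (induction k) (auto simp: tri_Suc power2_eq_square)

lemma length_lower_positions [simp]: "length (lower_positions k) = tri k"
proof -
  have "(\<Sum>j<k. k - j) = tri k"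
    by (induction k) (auto simp: tri_Suc sum.lessThan_Suc_shift simp del: sum.lessThan_Suc)
  then show ?thesis by (simp add: lower_positions_def length_concat_upt)
qed

lemma set_lower_positions: "set (lower_positions k) = {(i, j). j \<le> i \<and> i < k}"
  by (auto simp: lower_positions_def image_iff)

lemma distinct_lower_positions: "distinct (lower_positions k)"
proof -
  have "distinct (concat (map (\<lambda>j. map (\<lambda>i. (i, j)) [j..<k]) js))" if "distinct js" for js :: "nat list"
    using that by (induction js) (auto simp: distinct_map inj_on_def)
  then show ?thesis by (simp add: lower_positions_def)
qed

lemma dim_svec [simp]: "dim_vec (svec X) = tri (dim_row X)"
  by (simp add: svec_def)

lemma svec_index:
  assumes "t < tri (dim_row X)" "lower_positions (dim_row X) ! t = (i, j)"
  shows "svec X $ t = (if i = j then 1 else sqrt 2) * X $$ (i, j)"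
  using assms by (simp add: svec_def vec_of_list_index)

lemma lower_position_ex:
  assumes "j \<le> i" "i < k"
  obtains t where "t < tri k" "lower_positions k ! t = (i, j)"
proof -
  have "(i, j) \<in> set (lower_positions k)" using assms by (simp add: set_lower_positions)
  then show thesis using that by (metis in_set_conv_nth length_lower_positions)
qed

text \<open>Dividing the off-diagonal entries by \<open>sqrt 2\<close> inverts the scaling, and
  \<open>max\<close> and \<open>min\<close> mirror the lower triangle. Surjectivity allows a matrix
  to be recovered from its action on all vectors \<open>svec X\<close>.\<close>

lemma svec_surj:
  assumes "v \<in> carrier_vec (tri k)"
  obtains X where "X \<in> sym_mats k" "svec X = v"
proof -
  define idx where "idx = inv_into {..<tri k} ((!) (lower_positions k))"
  have idx: "idx (lower_positions k ! t) = t" if "t < tri k" for t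
    unfolding idx_def using that distinct_lower_positions[of k]
    by (intro inv_into_f_f) (auto intro: inj_on_nth)
  define X where "X = mat k k (\<lambda>(i, j).
    if i = j then v $ idx (i, j) else v $ idx (max i j, min i j) / sqrt 2)"
  have "svec X = v"
  proof (rule eq_vecI)
    fix t
    assume "t < dim_vec v"
    then have t: "t < tri k" using assms by simp
    obtain i j where ij: "lower_positions k ! t = (i, j)" by force
    then have "(i, j) \<in> set (lower_positions k)" using t by (metis length_lower_positions nth_mem)
    then have "j \<le> i" "i < k" by (auto simp: set_lower_positions)
    moreover have "svec X $ t = (if i = j then 1 else sqrt 2) * X $$ (i, j)"
      using t ij by (intro svec_index) (auto simp: X_def)
    ultimately show "svec X $ t = v $ t"
      using ij idx[OF t] by (cases "i = j") (simp_all add: X_def max_def min_def)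
  qed (use assms in \<open>simp add: X_def\<close>)
  moreover have "X \<in> sym_mats k"
    by (auto simp: sym_mats_def X_def max.commute min.commute intro!: eq_matI)
  ultimately show thesis using that by blast
qed

text \<open>Each lower-triangular entry occurs in \<open>svec\<close> up to a factor 1 or
  \<open>sqrt 2\<close>, and symmetry supplies the rest; a linear relation among the vectors thus
  passes to the matrices.\<close>

lemma svec_lin_comb_eq_0:
  assumes X: "\<And>i. i < m \<Longrightarrow> X i \<in> sym_mats k"
    and y: "\<And>t. t < tri k \<Longrightarrow> (\<Sum>i<m. y i * svec (X i) $ t) = 0"
    and ab: "a < k" "b < k"
  shows "(\<Sum>i<m. y i * X i $$ (a, b)) = 0"
proof -
  have low: "(\<Sum>i<m. y i * X i $$ (a, b)) = 0" if ba: "b \<le> a" "a < k" for a b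
  proof -
    obtain t where t: "t < tri k" "lower_positions k ! t = (a, b)"
      by (rule lower_position_ex[OF ba])
    let ?c = "if a = b then 1 else sqrt 2"
    have "svec (X i) $ t = ?c * X i $$ (a, b)" if "i < m" for i
      using X[OF that] t by (intro svec_index) (auto simp: sym_mats_def)
    then have "(\<Sum>i<m. y i * svec (X i) $ t) = ?c * (\<Sum>i<m. y i * X i $$ (a, b))"
      unfolding sum_distrib_left by (intro sum.cong) (auto simp: algebra_simps)
    then show ?thesis using y[OF t(1)] by (simp split: if_splits)
  qed
  show ?thesis
  proof (cases "b \<le> a")
    case False
    have "X i $$ (a, b) = X i $$ (b, a)" if "i < m" for i
      using X[OF that] ab by (auto simp: sym_mats_def) (metis carrier_matD index_transpose_mat(1))
    then show ?thesis using low[of a b] False ab by simp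
  qed (use low ab in simp)
qed

lemma mat_eqI_mult_vec:
  fixes A B :: "real mat"
  assumes "A \<in> carrier_mat nr nc" "B \<in> carrier_mat nr nc"
    and "\<And>v. v \<in> carrier_vec nc \<Longrightarrow> A *\<^sub>v v = B *\<^sub>v v"
  shows "A = B"
proof (rule eq_matI)
  fix i j
  assume ij: "i < dim_row B" "j < dim_col B"
  have "(A *\<^sub>v unit_vec nc j) $ i = (B *\<^sub>v unit_vec nc j) $ i" using assms(3) by simp
  then show "A $$ (i, j) = B $$ (i, j)"
    using assms(1,2) ij by (simp add: scalar_prod_right_unit)
qed (use assms in auto)

section \<open>Blocks of N, A and D\<close>

lemma block_index [simp]:
  "a < rs i \<Longrightarrow> b < cs j \<Longrightarrow> block rs cs M i j $$ (a, b) = M $$ (offset rs i + a, offset cs j + b)"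
  by (simp add: block_def)

lemma block_carrier [simp]: "block rs cs M i j \<in> carrier_mat (rs i) (cs j)"
  by (simp add: block_def)

text \<open>\<open>N\<close> is prescribed only through its action on vectors \<open>svec X\<close>,
  but these fill the whole space, so the blocks at a node and its parent are fixed; all others are
  zero. No row index falls into the block row of the root, whose dimension is 0.\<close>

lemma overlap_matrix_unique:
  assumes N: "overlap_matrix S N" and N': "overlap_matrix S N'"
  shows "N = N'"
proof (rule eq_matI)
  have car: "N \<in> carrier_mat (offset (overlap_dim S) (num_bags S)) (total_dim S)"
    "N' \<in> carrier_mat (offset (overlap_dim S) (num_bags S)) (total_dim S)"
    using N N' by (auto simp: overlap_matrix_def)
  then show "dim_row N = dim_row N'" "dim_col N = dim_col N'" by auto
  fix r c
  assume "r < dim_row N'" "c < dim_col N'"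
  then have rc: "r < offset (overlap_dim S) (num_bags S)" "c < offset (bag_dim S) (num_bags S)"
    using car by (auto simp: total_dim_def)
  obtain i a where i: "i < num_bags S" "a < overlap_dim S i" "r = offset (overlap_dim S) i + a"
    using rc(1) by (rule offset_decompose)
  obtain j b where j: "j < num_bags S" "b < bag_dim S j" "c = offset (bag_dim S) j + b"
    using rc(2) by (rule offset_decompose)
  have root: "i \<noteq> root_node S" using i(2) by (auto simp: overlap_dim_def)
  let ?B = "block (overlap_dim S) (bag_dim S)"
  let ?p = "parent S i"
  have eqI: "?B N i j = ?B N' i j"
    if "\<And>X. X \<in> sym_mats (card (bag S j)) \<Longrightarrow> ?B N i j *\<^sub>v svec X = ?B N' i j *\<^sub>v svec X"
    using that svec_surj unfolding bag_dim_def[symmetric]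
    by (intro mat_eqI_mult_vec[of _ "overlap_dim S i" "bag_dim S j"] block_carrier)
      (metis bag_dim_def)
  have "?B N i j = ?B N' i j"
  proof (cases "j = i \<or> j = ?p")
    case True
    then show ?thesis using N N' i(1) root
      by (intro eqI) (auto simp: overlap_matrix_def Let_def)
  next
    case False
    then show ?thesis using N N' i(1) j(1) root by (auto simp: overlap_matrix_def Let_def)
  qed
  then have "?B N i j $$ (a, b) = ?B N' i j $$ (a, b)" by simp
  then show "N $$ (r, c) = N' $$ (r, c)" using i j by simp
qed

lemma overlap_matrix_nonzero:
  assumes N: "overlap_matrix S N" and rc: "r < dim_row N" "c < dim_col N" and nz: "N $$ (r, c) \<noteq> 0"
  shows "block_of (overlap_dim S) r < num_bags S"
    and "block_of (overlap_dim S) r \<noteq> root_node S"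
    and "block_of (bag_dim S) c \<in> {block_of (overlap_dim S) r, parent S (block_of (overlap_dim S) r)}"
proof -
  have "r < offset (overlap_dim S) (num_bags S)" "c < offset (bag_dim S) (num_bags S)"
    using N rc by (auto simp: overlap_matrix_def total_dim_def)
  then obtain i a j b where i: "i < num_bags S" "a < overlap_dim S i" "r = offset (overlap_dim S) i + a"
    and j: "j < num_bags S" "b < bag_dim S j" "c = offset (bag_dim S) j + b"
    by (meson offset_decompose)
  have root: "i \<noteq> root_node S" using i(2) by (auto simp: overlap_dim_def)
  have "j = i \<or> j = parent S i"
  proof (rule ccontr)
    assume "\<not> ?thesis"
    then have "block (overlap_dim S) (bag_dim S) N i j = 0\<^sub>m (overlap_dim S i) (bag_dim S j)"
      using N i(1) j(1) root by (auto simp: overlap_matrix_def Let_def)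
    then have "block (overlap_dim S) (bag_dim S) N i j $$ (a, b) = 0" using i j by simp
    then show False using nz i j by simp
  qed
  then show "block_of (overlap_dim S) r < num_bags S" "block_of (overlap_dim S) r \<noteq> root_node S"
    "block_of (bag_dim S) c \<in> {block_of (overlap_dim S) r, parent S (block_of (overlap_dim S) r)}"
    using i j root by auto
qed

lemma concat_upt_nth:
  assumes "\<And>j. j < l \<Longrightarrow> length (F j) = g j" "j < l" "t < g j"
  shows "concat (map F [0..<l]) ! (offset g j + t) = F j ! t"
  using assms
proof (induction l)
  case (Suc l)
  have len: "length (concat (map F [0..<l])) = offset g l"
    using Suc.prems(1) by (simp add: length_concat_upt offset_def)
  show ?case
  proof (cases "j = l")
    case False
    then have "j < l" using Suc.prems(2) by simp
    moreover from this have "offset g j + t < offset g l" using Suc.prems(3) by (rule offset_add_less)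
    ultimately show ?thesis using Suc len by (simp add: nth_append)
  qed (use Suc.prems len in \<open>simp add: nth_append\<close>)
qed simp

lemma concat_vecs_index:
  assumes "\<And>j. j < l \<Longrightarrow> dim_vec (f j) = g j" "j < l" "t < g j"
  shows "concat_vecs l f $ (offset g j + t) = f j $ t"
  unfolding concat_vecs_def vec_of_list_index
  using concat_upt_nth[of l "\<lambda>j. list_of_vec (f j)" g j t] assms by (simp add: list_of_vec_index)

lemma constraint_matrix_carrier [simp]:
  "constraint_matrix S As \<in> carrier_mat (num_cons S) (total_dim S)"
  by (simp add: constraint_matrix_def mat_of_rows_def)

lemma constraint_matrix_index:
  assumes "\<And>j. j < num_bags S \<Longrightarrow> As i j \<in> sym_mats (card (bag S j))"
    and "i < num_cons S" "j < num_bags S" "t < bag_dim S j"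
  shows "constraint_matrix S As $$ (i, offset (bag_dim S) j + t) = svec (As i j) $ t"
proof -
  have "offset (bag_dim S) j + t < total_dim S"
    unfolding total_dim_def using assms(3,4) by (rule offset_add_less)
  moreover have "concat_vecs (num_bags S) (\<lambda>j. svec (As i j)) $ (offset (bag_dim S) j + t) = svec (As i j) $ t"
  proof (rule concat_vecs_index[where g = "bag_dim S" and f = "\<lambda>j. svec (As i j)"])
    fix j
    assume "j < num_bags S"
    then have "As i j \<in> carrier_mat (card (bag S j)) (card (bag S j))"
      using assms(1) by (simp add: sym_mats_def)
    then show "dim_vec (svec (As i j)) = bag_dim S j" by (simp add: bag_dim_def)
  qed (use assms in auto)
  ultimately show ?thesis using assms(2) by (simp add: constraint_matrix_def mat_of_rows_def)
qed

lemma block_diag_carrier: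
  assumes "\<And>j. j < l \<Longrightarrow> D j \<in> carrier_mat (g j) (g j)"
  shows "diag_block_mat (map D [0..<l]) \<in> carrier_mat (offset g l) (offset g l)"
proof -
  have "sum_list (map dim_row (map D [0..<l])) = offset g l" "sum_list (map dim_col (map D [0..<l])) = offset g l"
    using assms by (induction l) auto
  then show ?thesis by (intro carrier_matI) (simp_all only: dim_diag_block_mat)
qed

lemma block_diag_index:
  assumes "\<And>j. j < l \<Longrightarrow> D j \<in> carrier_mat (g j) (g j)" "i < l" "j < l" "a < g i" "b < g j"
  shows "diag_block_mat (map D [0..<l]) $$ (offset g i + a, offset g j + b) = (if i = j then D i $$ (a, b) else 0)"
  using assms
proof (induction l)
  case (Suc l)
  let ?E = "diag_block_mat (map D [0..<l])"
  have E: "?E \<in> carrier_mat (offset g l) (offset g l)"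
    using Suc.prems(1) by (intro block_diag_carrier) auto
  have Dl: "D l \<in> carrier_mat (g l) (g l)" using Suc.prems(1) by simp
  have dims: "dim_row (D l) = g l" "dim_col (D l) = g l" using Dl by auto
  have eq: "diag_block_mat (map D [0..<Suc l]) =
      four_block_mat ?E (0\<^sub>m (offset g l) (g l)) (0\<^sub>m (g l) (offset g l)) (D l)"
    using E Dl by (simp add: diag_block_mat_last Let_def)
  have less: "offset g i + a < offset g l" if "i < l" "a < g i" for i a
    using that offset_add_less[of i l a g] by simp
  have lessS: "offset g i + a < offset g l + g l" if "i < Suc l" "a < g i" for i a
    using that offset_add_less[of i "Suc l" a g] by simp
  show ?case
    unfolding eq using Suc.prems lessS[of i a] lessS[of j b] less[of i a] less[of j b] E dims
      Suc.IH less_SucI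
    by (cases "i = l"; cases "j = l") (auto simp: less_Suc_eq)
qed simp

section \<open>Bound on the number of constraints\<close>

lemma underdetermined_system:
  fixes A :: "'i \<Rightarrow> nat \<Rightarrow> real"
  assumes "finite I" "d < card I"
  shows "\<exists>y. (\<exists>i\<in>I. y i \<noteq> 0) \<and> (\<forall>c<d. (\<Sum>i\<in>I. y i * A i c) = 0)"
  using assms
proof (induction d arbitrary: A I)
  case 0
  then have "I \<noteq> {}" by auto
  then show ?case by (intro exI[of _ "\<lambda>_. 1"]) auto
next
  case (Suc d)
  show ?case
  proof (cases "\<exists>p\<in>I. A p d \<noteq> 0")
    case False
    obtain y where "\<exists>i\<in>I. y i \<noteq> 0" "\<forall>c<d. (\<Sum>i\<in>I. y i * A i c) = 0"
      using Suc.IH[of I A] Suc.prems by auto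
    then show ?thesis using False by (intro exI[of _ y]) (auto simp: less_Suc_eq)
  next
    case True
    then obtain p where p: "p \<in> I" "A p d \<noteq> 0" by blast
    \<comment> \<open>Gaussian elimination with pivot \<open>A p d\<close>: equation
      \<open>d\<close> becomes trivial in \<open>?A\<close>. The value of \<open>?y p\<close> below
      makes equation \<open>d\<close> hold, and the sums with \<open>?y\<close> then equal the
      reduced sums in every equation.\<close>
    let ?I = "I - {p}" and ?A = "\<lambda>i c. A i c - A i d / A p d * A p c"
    have "d < card ?I" using Suc.prems p(1) by simp
    then obtain y where y: "\<exists>i\<in>?I. y i \<noteq> 0" "\<forall>c<d. (\<Sum>i\<in>?I. y i * ?A i c) = 0"
      using Suc.IH[of ?I ?A] Suc.prems(1) by auto
    let ?y = "y(p := - (\<Sum>i\<in>?I. y i * A i d) / A p d)"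
    have "(\<Sum>i\<in>I. ?y i * A i c) = (\<Sum>i\<in>?I. y i * ?A i c)" for c
    proof -
      have "(\<Sum>i\<in>I. ?y i * A i c) = ?y p * A p c + (\<Sum>i\<in>?I. ?y i * A i c)"
        using Suc.prems(1) p(1) by (rule sum.remove)
      also have "(\<Sum>i\<in>?I. ?y i * A i c) = (\<Sum>i\<in>?I. y i * A i c)" by (rule sum.cong) auto
      also have "?y p * A p c = - (\<Sum>i\<in>?I. y i * (A i d / A p d * A p c))"
        by (simp add: sum_divide_distrib sum_distrib_right mult.assoc)
      finally show ?thesis by (simp add: sum_subtractf algebra_simps)
    qed
    moreover have "?A i d = 0" for i using p(2) by simp
    ultimately have "\<forall>c<Suc d. (\<Sum>i\<in>I. ?y i * A i c) = 0"
      using y(2) by (auto simp: less_Suc_eq)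
    moreover have "\<exists>i\<in>I. ?y i \<noteq> 0" using y(1) by auto
    ultimately show ?thesis by blast
  qed
qed

lemma frob_inner_eq_sum:
  assumes "M \<in> carrier_mat k k" "X \<in> carrier_mat k k"
  shows "frob_inner M X = (\<Sum>b<k. \<Sum>a<k. M $$ (a, b) * X $$ (a, b))"
  using assms by (simp add: frob_inner_def mat_trace_def scalar_prod_def atLeast0LessThan)

lemma submatrix_carrier:
  assumes "X \<in> carrier_mat n n" "J \<subseteq> {..<n}"
  shows "submatrix X J J \<in> carrier_mat (card J) (card J)"
proof -
  have "{i. i < n \<and> i \<in> J} = J" using assms(2) by auto
  moreover have "dim_row X = n" "dim_col X = n" using assms(1) by auto
  ultimately show ?thesis by (intro carrier_matI) (simp_all only: dim_submatrix)
qed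

text \<open>More constraints than variables would yield a nontrivial relation \<open>y\<close> among
  the rows of \<open>constraint_matrix S As\<close>, hence among the split matrices bag by bag. The
  combination of the \<open>A i\<close> with coefficients \<open>y i\<close> is then orthogonal to
  every symmetric matrix, in particular to itself, so it vanishes, against linear
  independence.\<close>

lemma num_cons_le_total_dim:
  assumes A: "\<And>i. i < num_cons S \<Longrightarrow> A i \<in> sym_mats (size_n S)"
    and indep: "\<And>y. y \<in> carrier_vec (num_cons S) \<Longrightarrow>
      lin_comb_mats (size_n S) (num_cons S) y A = 0\<^sub>m (size_n S) (size_n S) \<Longrightarrow> y = 0\<^sub>v (num_cons S)"
    and split: "\<And>i. i < num_cons S \<Longrightarrow> is_split S (A i) (As i)"
    and bags: "\<And>j. j < num_bags S \<Longrightarrow> bag S j \<subseteq> {..<size_n S}"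
  shows "num_cons S \<le> total_dim S"
proof (rule ccontr)
  let ?m = "num_cons S" and ?n = "size_n S" and ?l = "num_bags S"
  assume "\<not> ?m \<le> total_dim S"
  then obtain y where y: "\<exists>i<?m. y i \<noteq> 0"
    "\<And>c. c < total_dim S \<Longrightarrow> (\<Sum>i<?m. y i * constraint_matrix S As $$ (i, c)) = 0"
    using underdetermined_system[of "{..<?m}" "total_dim S" "\<lambda>i c. constraint_matrix S As $$ (i, c)"] by auto
  have sym: "As i j \<in> sym_mats (card (bag S j))" if "i < ?m" "j < ?l" for i j
    using split that by (auto simp: is_split_def)
  have zero: "(\<Sum>i<?m. y i * As i j $$ (a, b)) = 0"
    if "j < ?l" "a < card (bag S j)" "b < card (bag S j)" for j a b
  proof (rule svec_lin_comb_eq_0[OF _ _ that(2,3)])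
    fix t
    assume t: "t < tri (card (bag S j))"
    then have "offset (bag_dim S) j + t < total_dim S"
      unfolding total_dim_def using that by (intro offset_add_less) (auto simp: bag_dim_def)
    from y(2)[OF this] show "(\<Sum>i<?m. y i * svec (As i j) $ t) = 0"
      using constraint_matrix_index[of S As _ j t] sym that t by (simp add: bag_dim_def)
  qed (use sym that in auto)
  define X where "X = lin_comb_mats ?n ?m (vec ?m y) A"
  have X_index: "X $$ (a, b) = (\<Sum>i<?m. y i * A i $$ (a, b))" if "a < ?n" "b < ?n" for a b
    using that by (simp add: X_def lin_comb_mats_def)
  have X: "X \<in> sym_mats ?n"
  proof -
    have "A i $$ (b, a) = A i $$ (a, b)" if "i < ?m" "a < ?n" "b < ?n" for i a b
      using A[OF that(1)] that(2,3) by (auto simp: sym_mats_def) (metis carrier_matD index_transpose_mat(1))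
    then show ?thesis
      by (auto simp: sym_mats_def X_def lin_comb_mats_def intro!: eq_matI sum.cong)
  qed
  then have Xc: "X \<in> carrier_mat ?n ?n" by (simp add: sym_mats_def)
  have "(\<Sum>i<?m. y i * frob_inner (A i) X) = (\<Sum>i<?m. \<Sum>j<?l. y i * frob_inner (As i j) (submatrix X (bag S j) (bag S j)))"
    using split X by (auto simp: is_split_def sum_distrib_left[symmetric] intro!: sum.cong)
  also have "\<dots> = (\<Sum>j<?l. \<Sum>i<?m. y i * frob_inner (As i j) (submatrix X (bag S j) (bag S j)))"
    by (rule sum.swap)
  also have "\<dots> = 0"
  proof (rule sum.neutral, rule ballI)
    fix j
    assume "j \<in> {..<?l}"
    then have j: "j < ?l" by simp
    let ?k = "card (bag S j)" and ?Y = "submatrix X (bag S j) (bag S j)"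
    have Y: "?Y \<in> carrier_mat ?k ?k" using Xc bags[OF j] by (rule submatrix_carrier)
    have "(\<Sum>i<?m. y i * frob_inner (As i j) ?Y) = (\<Sum>i<?m. \<Sum>b<?k. \<Sum>a<?k. y i * As i j $$ (a, b) * ?Y $$ (a, b))"
      using sym[OF _ j] Y
      by (intro sum.cong refl) (simp add: frob_inner_eq_sum[of _ ?k] sym_mats_def sum_distrib_left mult.assoc)
    also have "\<dots> = (\<Sum>b<?k. \<Sum>i<?m. \<Sum>a<?k. y i * As i j $$ (a, b) * ?Y $$ (a, b))" by (rule sum.swap)
    also have "\<dots> = (\<Sum>b<?k. \<Sum>a<?k. \<Sum>i<?m. y i * As i j $$ (a, b) * ?Y $$ (a, b))"
      by (intro sum.cong refl sum.swap)
    also have "\<dots> = 0"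
      using zero[OF j] by (simp add: sum_distrib_right[symmetric])
    finally show "(\<Sum>i<?m. y i * frob_inner (As i j) ?Y) = 0" .
  qed
  finally have "0 = (\<Sum>i<?m. y i * frob_inner (A i) X)" by simp
  also have "\<dots> = (\<Sum>i<?m. \<Sum>b<?n. \<Sum>a<?n. y i * A i $$ (a, b) * X $$ (a, b))"
    using A Xc by (intro sum.cong refl) (simp add: frob_inner_eq_sum[of _ ?n] sym_mats_def sum_distrib_left mult.assoc)
  also have "\<dots> = (\<Sum>b<?n. \<Sum>i<?m. \<Sum>a<?n. y i * A i $$ (a, b) * X $$ (a, b))" by (rule sum.swap)
  also have "\<dots> = (\<Sum>b<?n. \<Sum>a<?n. \<Sum>i<?m. y i * A i $$ (a, b) * X $$ (a, b))"
    by (intro sum.cong refl sum.swap)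
  also have "\<dots> = (\<Sum>b<?n. \<Sum>a<?n. (X $$ (a, b))\<^sup>2)"
    by (intro sum.cong refl) (simp add: X_index sum_distrib_right[symmetric] power2_eq_square)
  finally have sq: "(\<Sum>b<?n. \<Sum>a<?n. (X $$ (a, b))\<^sup>2) = 0" by simp
  have "X $$ (a, b) = 0" if "a < ?n" "b < ?n" for a b
  proof -
    have "(\<Sum>a<?n. (X $$ (a, b))\<^sup>2) = 0"
      using sq that(2) by (subst (asm) sum_nonneg_eq_0_iff) (auto intro!: sum_nonneg)
    then show ?thesis
      using that(1) by (subst (asm) sum_nonneg_eq_0_iff) auto
  qed
  then have "X = 0\<^sub>m ?n ?n" using Xc by (intro eq_matI) auto
  then have "vec ?m y = 0\<^sub>v ?m" by (intro indep) (auto simp: X_def)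
  then have "vec ?m y $ i = 0" if "i < ?m" for i using that by simp
  then show False using y(1) by auto
qed

section \<open>Entries of H and q, and positive quadratic forms\<close>

lemma H_mat_index:
  assumes "Ds \<in> carrier_mat d d" "A \<in> carrier_mat m d" "N \<in> carrier_mat m' d" "r < d" "c < d"
  shows "H_mat Ds \<sigma> A N $$ (r, c) = Ds $$ (r, c) + \<sigma> * (\<Sum>k<m. A $$ (k, r) * A $$ (k, c))
    + \<sigma> * (\<Sum>k<m'. N $$ (k, r) * N $$ (k, c))"
  using assms by (simp add: H_mat_def scalar_prod_def atLeast0LessThan)

lemma H_mat_carrier:
  assumes "Ds \<in> carrier_mat d d" "A \<in> carrier_mat m d" "N \<in> carrier_mat m' d"
  shows "H_mat Ds \<sigma> A N \<in> carrier_mat d d"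
  using assms by (simp add: H_mat_def)

lemma q_vec_index:
  assumes "A \<in> carrier_mat m d" "N \<in> carrier_mat m' d" "w \<in> carrier_vec (m + m')" "r < d"
  shows "q_vec A N w $ r = (\<Sum>k<m. A $$ (k, r) * w $ k) + (\<Sum>k<m'. N $$ (k, r) * w $ (m + k))"
proof -
  have *: "sum g {..<m + m'} = sum g {..<m} + (\<Sum>k<m'. g (m + k))" for g :: "nat \<Rightarrow> real"
    by (induction m') (auto simp: add.assoc)
  show ?thesis
    using assms by (simp add: q_vec_def append_rows_def scalar_prod_def atLeast0LessThan * )
qed

lemma pos_def_quadratic_form:
  assumes "pos_def k M" "\<exists>a<k. x a \<noteq> 0"
  shows "0 < (\<Sum>a<k. \<Sum>b<k. x a * M $$ (a, b) * x b)"
proof -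
  have M: "M \<in> carrier_mat k k" using assms(1) by (simp add: pos_def_def sym_mats_def)
  have "vec k x \<noteq> 0\<^sub>v k" using assms(2) by (metis index_vec index_zero_vec(1))
  then have "0 < vec k x \<bullet> (M *\<^sub>v vec k x)" using assms(1) by (auto simp: pos_def_def)
  also have "\<dots> = (\<Sum>a<k. \<Sum>b<k. x a * M $$ (a, b) * x b)"
    using M by (simp add: scalar_prod_def atLeast0LessThan sum_distrib_left mult.assoc)
  finally show ?thesis .
qed

lemma block_diag_quadratic_form:
  assumes D: "\<And>j. j < l \<Longrightarrow> pos_def (g j) (D j)" and x: "\<exists>r<offset g l. x r \<noteq> 0"
  shows "0 < (\<Sum>r<offset g l. \<Sum>c<offset g l. x r * diag_block_mat (map D [0..<l]) $$ (r, c) * x c)"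
proof -
  let ?x = "\<lambda>i a. x (offset g i + a)"
  let ?Q = "\<lambda>i. \<Sum>a<g i. \<Sum>b<g i. ?x i a * D i $$ (a, b) * ?x i b"
  have car: "D j \<in> carrier_mat (g j) (g j)" if "j < l" for j
    using D[OF that] by (simp add: pos_def_def sym_mats_def)
  have "(\<Sum>r<offset g l. \<Sum>c<offset g l. x r * diag_block_mat (map D [0..<l]) $$ (r, c) * x c) =
    (\<Sum>i<l. \<Sum>a<g i. \<Sum>j<l. \<Sum>b<g j. if i = j then ?x i a * D i $$ (a, b) * ?x j b else 0)"
    by (auto simp: sum_offset block_diag_index[OF car] intro!: sum.cong)
  also have "\<dots> = (\<Sum>i<l. ?Q i)"
  proof (rule sum.cong[OF refl], rule sum.cong[OF refl])
    fix i a
    assume "i \<in> {..<l}"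
    have "(\<Sum>j<l. \<Sum>b<g j. if i = j then ?x i a * D i $$ (a, b) * ?x j b else 0) =
        (\<Sum>j<l. if i = j then \<Sum>b<g j. ?x i a * D i $$ (a, b) * ?x j b else 0)"
      by (intro sum.cong) auto
    then show "(\<Sum>j<l. \<Sum>b<g j. if i = j then ?x i a * D i $$ (a, b) * ?x j b else 0) =
        (\<Sum>b<g i. ?x i a * D i $$ (a, b) * ?x i b)"
      using \<open>i \<in> {..<l}\<close> by simp
  qed
  also have "0 < \<dots>"
  proof -
    obtain i a where ia: "i < l" "a < g i" "?x i a \<noteq> 0"
      using x by (metis offset_decompose)
    have "0 \<le> ?Q j" if "j < l" for j
      using pos_def_quadratic_form[OF D[OF that], of "?x j"]
      by (cases "\<exists>a<g j. ?x j a \<noteq> 0") auto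
    moreover have "0 < ?Q i" using ia by (intro pos_def_quadratic_form D) auto
    ultimately show ?thesis using ia(1) by (subst sum_pos2[of _ i]) auto
  qed
  finally show ?thesis .
qed

section \<open>Sparsity patterns\<close>

lemma program_meetsI:
  assumes "valid pre p post" "length p \<le> t" "inp \<union> outp \<union> accessed p \<subseteq> X" "finite X" "card X \<le> s"
  shows "program_meets p inp pre outp post t s"
  using assms(1,2) finite_subset[OF assms(3,4)] order.trans[OF card_mono[OF assms(4,3)] assms(5)]
  by (simp add: program_meets_def valid_def)

lemma finite_mat_cells [simp]: "finite P \<Longrightarrow> finite (mat_cells x P)"
  and card_mat_cells [simp]: "card (mat_cells x P) = card P"
  by (simp_all add: mat_cells_def card_cartesian_product_singleton)

lemma vec_cells_eq: "vec_cells x k = (\<lambda>i. (x, i, 0)) ` {..<k}"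
  by (auto simp: vec_cells_def)

lemma finite_vec_cells [simp]: "finite (vec_cells x k)"
  and card_vec_cells [simp]: "card (vec_cells x k) = k"
  by (simp_all add: vec_cells_eq card_image inj_on_def)

lemma card_by_rows:
  assumes "P \<subseteq> {..<m} \<times> UNIV" "\<And>k. k < m \<Longrightarrow> finite {c. (k, c) \<in> P} \<and> card {c. (k, c) \<in> P} \<le> b"
  shows "finite P" "card P \<le> m * b"
proof -
  have P: "P = (SIGMA k:{..<m}. {c. (k, c) \<in> P})" using assms(1) by auto
  show "finite P" by (subst P, rule finite_SigmaI) (use assms(2) in auto)
  have "card P = (\<Sum>k<m. card {c. (k, c) \<in> P})"
    by (subst P, rule card_SigmaI) (use assms(2) in auto)
  also have "\<dots> \<le> m * b" using sum_bounded_above[of "{..<m}" _ b] assms(2) by simp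
  finally show "card P \<le> m * b" .
qed

locale bag_tree =
  fixes S :: ctc_structure
  assumes tree: "is_tree {..<num_bags S} (tree_edges S)"
    and root_less: "root_node S < num_bags S"
    and bag_subset: "\<And>j. j < num_bags S \<Longrightarrow> bag S j \<subseteq> {..<size_n S}"
    and num_bags_le: "num_bags S \<le> size_n S"
    and bags_cover: "\<And>a. a < size_n S \<Longrightarrow> \<exists>j<num_bags S. a \<in> bag S j"
begin

abbreviation "n \<equiv> size_n S"
abbreviation "m \<equiv> num_cons S"
abbreviation "l \<equiv> num_bags S"
abbreviation "d \<equiv> total_dim S"
abbreviation "\<omega> \<equiv> max_bag S"

text \<open>Adjacency refers to no root and can therefore mediate between \<open>root_node S\<close>
  and the root designated by an ordering. Reflexivity spares a separate treatment of diagonal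
  blocks.\<close>

definition adj :: "nat \<Rightarrow> nat \<Rightarrow> bool" where
  "adj i j \<longleftrightarrow> i = j \<or> {i, j} \<in> tree_edges S"

lemma adj_sym: "adj i j \<longleftrightarrow> adj j i"
  by (auto simp: adj_def insert_commute)

lemma adj_parent: "v < l \<Longrightarrow> adj v (parent S v)"
  using tree_parent_edge[OF tree, of "root_node S" v] root_less
  by (cases "v = root_node S") (auto simp: adj_def parent_def tree_parent_def)

text \<open>A row of \<open>A\<close> or \<open>N\<close> lives on such a pair \<open>v\<close>,
  \<open>parent S v\<close>, so all products of its entries stay within
  \<open>H_positions S\<close>. The root is included, being its own parent.\<close>

lemma adj_family: "v < l \<Longrightarrow> i \<in> {v, parent S v} \<Longrightarrow> j \<in> {v, parent S v} \<Longrightarrow> adj i j"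
  using adj_parent[of v] by (auto simp: adj_sym) (auto simp: adj_def)

lemma adjD: "adj i j \<Longrightarrow> j = i \<or> j = parent S i \<or> i = parent S j"
  using tree_edge_parent[OF tree, of "root_node S" i j] root_less by (auto simp: adj_def parent_def)

lemma finite_bag: "j < l \<Longrightarrow> finite (bag S j)"
  using bag_subset finite_subset by blast

lemma card_bag_le: "j < l \<Longrightarrow> card (bag S j) \<le> \<omega>"
  unfolding max_bag_def by (intro Max_ge) auto

text \<open>There is at least one node and no more nodes than vertices, so vertex 0 exists, and a
  bag containing it is nonempty. Positivity lets additive constants and lower powers of
  \<open>\<omega>\<close> be absorbed into the bounds.\<close>

lemma n_pos: "0 < n" and max_bag_pos: "0 < \<omega>"
proof -
  show "0 < n" using root_less num_bags_le by simp
  then obtain j where "j < l" "0 \<in> bag S j" using bags_cover by blast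
  then have "card (bag S j) \<noteq> 0" using finite_bag by auto
  then show "0 < \<omega>" using card_bag_le[OF \<open>j < l\<close>] by simp
qed

lemma tri_le: "k \<le> \<omega> \<Longrightarrow> tri k \<le> \<omega>\<^sup>2"
  using tri_mono[of k \<omega>] tri_le_square[of \<omega>] by simp

lemma bag_dim_le: "j < l \<Longrightarrow> bag_dim S j \<le> \<omega>\<^sup>2"
  by (simp add: bag_dim_def tri_le card_bag_le)

lemma overlap_dim_le: "j < l \<Longrightarrow> overlap_dim S j \<le> \<omega>\<^sup>2"
proof -
  assume j: "j < l"
  have "card (bag S j \<inter> bag S (parent S j)) \<le> card (bag S j)"
    using finite_bag[OF j] by (intro card_mono) auto
  then show ?thesis using card_bag_le[OF j] by (auto simp: overlap_dim_def intro!: tri_le)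
qed

lemma total_dim_le: "d \<le> n * \<omega>\<^sup>2"
proof -
  have "d \<le> l * \<omega>\<^sup>2" unfolding total_dim_def by (rule offset_le[OF bag_dim_le])
  also have "\<dots> \<le> n * \<omega>\<^sup>2" using num_bags_le by (rule mult_right_mono) simp
  finally show ?thesis .
qed

lemma overlap_rows_le: "offset (overlap_dim S) l \<le> n * \<omega>\<^sup>2"
proof -
  have "offset (overlap_dim S) l \<le> l * \<omega>\<^sup>2" by (rule offset_le[OF overlap_dim_le])
  also have "\<dots> \<le> n * \<omega>\<^sup>2" using num_bags_le by (rule mult_right_mono) simp
  finally show ?thesis .
qed

lemma card_blocks_pair_le:
  "finite {c. c < d \<and> block_of (bag_dim S) c \<in> {i, j}}"
  "card {c. c < d \<and> block_of (bag_dim S) c \<in> {i, j}} \<le> 2 * \<omega>\<^sup>2"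
proof -
  show "finite {c. c < d \<and> block_of (bag_dim S) c \<in> {i, j}}" by simp
  have "card {i, j} \<le> 2" by (simp add: card_insert_if)
  then have "card {i, j} * \<omega>\<^sup>2 \<le> 2 * \<omega>\<^sup>2" by (rule mult_right_mono) simp
  then show "card {c. c < d \<and> block_of (bag_dim S) c \<in> {i, j}} \<le> 2 * \<omega>\<^sup>2"
    using card_blocks_le(2)[where f = "bag_dim S" and l = l and X = "{i, j}", OF bag_dim_le]
    unfolding total_dim_def by (metis (no_types, lifting) finite.emptyI finite_insert order.trans)
qed

lemma A_positions_iff:
  "(k, c) \<in> A_positions S \<longleftrightarrow> k < m \<and> c < d \<and>
    block_of (bag_dim S) c \<in> {host S k, parent S (host S k)}"
  by (simp add: A_positions_def mem_block_positions total_dim_def)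

lemma H_positions_iff:
  "(r, c) \<in> H_positions S \<longleftrightarrow> r < d \<and> c < d \<and> adj (block_of (bag_dim S) r) (block_of (bag_dim S) c)"
  by (simp add: H_positions_def mem_block_positions total_dim_def adj_def)

lemma D_positions_iff:
  "(r, c) \<in> D_positions S \<longleftrightarrow> r < d \<and> c < d \<and> block_of (bag_dim S) r = block_of (bag_dim S) c"
  by (simp add: D_positions_def mem_block_positions total_dim_def)

lemma A_positions_row: "finite {c. (k, c) \<in> A_positions S} \<and> card {c. (k, c) \<in> A_positions S} \<le> 2 * \<omega>\<^sup>2"
proof -
  have sub: "{c. (k, c) \<in> A_positions S} \<subseteq> {c. c < d \<and> block_of (bag_dim S) c \<in> {host S k, parent S (host S k)}}"
    by (auto simp: A_positions_iff)
  show ?thesis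
    using finite_subset[OF sub card_blocks_pair_le(1)] card_mono[OF card_blocks_pair_le(1) sub]
      card_blocks_pair_le(2) order.trans by blast
qed

lemma finite_A_positions: "finite (A_positions S)"
  and card_A_positions: "card (A_positions S) \<le> m * (2 * \<omega>\<^sup>2)"
proof -
  have "A_positions S \<subseteq> {..<m} \<times> UNIV" by (auto simp: A_positions_iff)
  from card_by_rows[OF this A_positions_row]
  show "finite (A_positions S)" "card (A_positions S) \<le> m * (2 * \<omega>\<^sup>2)" .
qed

lemma H_positions_square: "H_positions S \<subseteq> {..<d} \<times> {..<d}"
  by (auto simp: H_positions_iff)

lemma finite_H_positions: "finite (H_positions S)"
  using H_positions_square by (rule finite_subset) simp

lemma D_subset_H: "D_positions S \<subseteq> H_positions S"
  by (auto simp: D_positions_iff H_positions_iff adj_def)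

text \<open>A row of \<open>H\<close> may be long, since a node may have many children. Orienting
  each adjacent pair towards the parent gives \<open>?Q\<close>, with at most
  \<open>2 * \<omega>^2\<close> entries per row, and \<open>?Q\<close> together with its transpose
  covers \<open>H_positions S\<close>; hence the factor 4.\<close>

lemma card_H_positions: "card (H_positions S) \<le> 4 * d * \<omega>\<^sup>2"
proof -
  let ?Q = "{(r, c). r < d \<and> c < d \<and> block_of (bag_dim S) c \<in> {block_of (bag_dim S) r, parent S (block_of (bag_dim S) r)}}"
  have row: "finite {c. (r, c) \<in> ?Q} \<and> card {c. (r, c) \<in> ?Q} \<le> 2 * \<omega>\<^sup>2" if "r < d" for r
    using card_blocks_pair_le[of "block_of (bag_dim S) r" "parent S (block_of (bag_dim S) r)"] that by simp
  have Q: "finite ?Q" "card ?Q \<le> d * (2 * \<omega>\<^sup>2)"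
    using card_by_rows[of ?Q d, OF _ row] by auto
  have "H_positions S \<subseteq> ?Q \<union> prod.swap ` ?Q"
  proof
    fix x
    assume "x \<in> H_positions S"
    then obtain r c where x: "x = (r, c)" and rc: "r < d" "c < d"
      "adj (block_of (bag_dim S) r) (block_of (bag_dim S) c)"
      by (cases x) (auto simp: H_positions_iff)
    from adjD[OF rc(3)] have "(r, c) \<in> ?Q \<or> (c, r) \<in> ?Q" using rc(1,2) by auto
    then show "x \<in> ?Q \<union> prod.swap ` ?Q" unfolding x by (auto simp del: mem_Collect_eq intro: image_eqI[of _ _ "(c, r)"])
  qed
  then have "card (H_positions S) \<le> card (?Q \<union> prod.swap ` ?Q)"
    using Q(1) by (intro card_mono) auto
  also have "\<dots> \<le> card ?Q + card (prod.swap ` ?Q)" by (rule card_Un_le)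
  also have "\<dots> \<le> card ?Q + card ?Q" using card_image_le[OF Q(1)] by simp
  finally show ?thesis using Q(2) by simp
qed

lemma overlap_positions_row:
  assumes N: "overlap_matrix S N"
  shows "finite {c. (k, c) \<in> nonzero_positions N} \<and> card {c. (k, c) \<in> nonzero_positions N} \<le> 2 * \<omega>\<^sup>2"
proof -
  let ?i = "block_of (overlap_dim S) k"
  have dim: "dim_col N = d" using N by (auto simp: overlap_matrix_def)
  have sub: "{c. (k, c) \<in> nonzero_positions N} \<subseteq> {c. c < d \<and> block_of (bag_dim S) c \<in> {?i, parent S ?i}}"
  proof
    fix c
    assume "c \<in> {c. (k, c) \<in> nonzero_positions N}"
    then have c: "k < dim_row N" "c < dim_col N" "N $$ (k, c) \<noteq> 0" by (auto simp: nonzero_positions_def)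
    show "c \<in> {c. c < d \<and> block_of (bag_dim S) c \<in> {?i, parent S ?i}}"
      using overlap_matrix_nonzero(3)[OF N c] c(2) dim by simp
  qed
  show ?thesis
    using finite_subset[OF sub card_blocks_pair_le(1)] card_mono[OF card_blocks_pair_le(1) sub]
      card_blocks_pair_le(2) order.trans by blast
qed

lemma
  assumes "overlap_matrix S N"
  shows finite_overlap_positions: "finite (nonzero_positions N)"
    and card_overlap_positions: "card (nonzero_positions N) \<le> dim_row N * (2 * \<omega>\<^sup>2)"
proof -
  have "nonzero_positions N \<subseteq> {..<dim_row N} \<times> UNIV" by (auto simp: nonzero_positions_def)
  from card_by_rows[OF this overlap_positions_row[OF assms]]
  show "finite (nonzero_positions N)" "card (nonzero_positions N) \<le> dim_row N * (2 * \<omega>\<^sup>2)" .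
qed

lemma power_bound: "k \<le> j \<Longrightarrow> \<omega> ^ k * n \<le> \<omega> ^ j * n"
  using max_bag_pos by (intro mult_right_mono power_increasing) auto

end

section \<open>Permutation of the blocks\<close>

definition perm_index :: "ctc_structure \<Rightarrow> (nat \<Rightarrow> nat) \<Rightarrow> nat \<Rightarrow> nat" where
  "perm_index S \<pi> r = (let i = block_of (bag_dim S \<circ> \<pi>) r in
     offset (bag_dim S) (\<pi> i) + (r - offset (bag_dim S \<circ> \<pi>) i))"

locale ordered_bag_tree = bag_tree +
  fixes \<pi> :: "nat \<Rightarrow> nat"
  assumes topo: "topological_ordering (num_bags S) (tree_edges S) \<pi>"
begin

abbreviation "\<rho> \<equiv> perm_index S \<pi>"
abbreviation "blk \<equiv> block_of (bag_dim S \<circ> \<pi>)"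

definition up :: "nat \<Rightarrow> nat" where
  "up j = inv_into {..<l} \<pi> (tree_parent (tree_edges S) (\<pi> (l - 1)) (\<pi> j))"

lemma bij_\<pi>: "bij_betw \<pi> {..<l} {..<l}"
  using topo by (simp add: topological_ordering_def)

lemma \<pi>_less: "i < l \<Longrightarrow> \<pi> i < l"
  using bij_\<pi> by (auto simp: bij_betw_def)

lemma \<pi>_inj: "i < l \<Longrightarrow> j < l \<Longrightarrow> \<pi> i = \<pi> j \<longleftrightarrow> i = j"
  using bij_\<pi> by (auto simp: bij_betw_def inj_on_def)

lemma inv_\<pi>: "i < l \<Longrightarrow> inv_into {..<l} \<pi> (\<pi> i) = i"
  using bij_\<pi> by (simp add: bij_betw_def)

text \<open>With respect to the root \<open>\<pi> (l - 1)\<close>, which may differ from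
  \<open>root_node S\<close>, one end of a tree edge is the parent of the other. The earlier end
  cannot be the parent because children come first, so a node has at most one later
  neighbour.\<close>

lemma later_adj_eq_up:
  assumes "j < i" "i < l" "adj (\<pi> i) (\<pi> j)"
  shows "i = up j"
proof -
  let ?r = "\<pi> (l - 1)" and ?p = "tree_parent (tree_edges S) (\<pi> (l - 1))"
  have l: "0 < l" using assms(2) by simp
  have order: "inv_into {..<l} \<pi> v < inv_into {..<l} \<pi> (?p v)" if "v < l" "v \<noteq> ?r" for v
    using topo that by (simp add: topological_ordering_def Let_def)
  have "{\<pi> i, \<pi> j} \<in> tree_edges S"
    using assms \<pi>_inj[of i j] by (auto simp: adj_def)
  then have "\<pi> j \<noteq> ?r \<and> ?p (\<pi> j) = \<pi> i \<or> \<pi> i \<noteq> ?r \<and> ?p (\<pi> i) = \<pi> j"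
    using tree_edge_parent[OF tree, of ?r "\<pi> i" "\<pi> j"] \<pi>_less[of "l - 1"] l by auto
  then show ?thesis
  proof
    assume "\<pi> j \<noteq> ?r \<and> ?p (\<pi> j) = \<pi> i"
    then show ?thesis using assms inv_\<pi> by (simp add: up_def)
  next
    assume "\<pi> i \<noteq> ?r \<and> ?p (\<pi> i) = \<pi> j"
    then show ?thesis using order[of "\<pi> i"] \<pi>_less[of i] assms inv_\<pi>[of i] inv_\<pi>[of j] by simp
  qed
qed

lemma offset_perm: "offset (bag_dim S \<circ> \<pi>) l = d"
  unfolding total_dim_def offset_def using sum.reindex_bij_betw[OF bij_\<pi>, of "bag_dim S"] by simp

lemma perm_decompose:
  assumes "r < d"
  obtains i a where "i < l" "a < bag_dim S (\<pi> i)" "r = offset (bag_dim S \<circ> \<pi>) i + a"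
    "blk r = i" "\<rho> r = offset (bag_dim S) (\<pi> i) + a"
proof -
  have "r < offset (bag_dim S \<circ> \<pi>) l" using assms by (simp add: offset_perm)
  then obtain i a where ia: "i < l" "a < (bag_dim S \<circ> \<pi>) i" "r = offset (bag_dim S \<circ> \<pi>) i + a"
    by (rule offset_decompose)
  then have "blk r = i" by simp
  with ia that show thesis by (simp add: perm_index_def)
qed

lemma \<rho>_less: "r < d \<Longrightarrow> \<rho> r < d"
  by (erule perm_decompose) (auto simp: total_dim_def \<pi>_less intro!: offset_add_less)

lemma block_of_\<rho>: "r < d \<Longrightarrow> block_of (bag_dim S) (\<rho> r) = \<pi> (blk r)"
  by (erule perm_decompose) simp

lemma bij_\<rho>: "bij_betw \<rho> {..<d} {..<d}"
proof -
  have "inj_on \<rho> {..<d}"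
  proof (rule inj_onI)
    fix r s
    assume rs: "r \<in> {..<d}" "s \<in> {..<d}" "\<rho> r = \<rho> s"
    obtain i a where i: "i < l" "a < bag_dim S (\<pi> i)" "r = offset (bag_dim S \<circ> \<pi>) i + a"
      "blk r = i" "\<rho> r = offset (bag_dim S) (\<pi> i) + a"
      using rs(1) by (auto elim: perm_decompose)
    obtain j b where j: "j < l" "b < bag_dim S (\<pi> j)" "s = offset (bag_dim S \<circ> \<pi>) j + b"
      "blk s = j" "\<rho> s = offset (bag_dim S) (\<pi> j) + b"
      using rs(2) by (auto elim: perm_decompose)
    have "\<pi> i = \<pi> j" using rs block_of_\<rho>[of r] block_of_\<rho>[of s] i(4) j(4) by simp
    then show "r = s" using i j rs(3) \<pi>_inj by simp
  qed
  moreover have "\<rho> ` {..<d} \<subseteq> {..<d}" using \<rho>_less by auto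
  ultimately show ?thesis by (simp add: bij_betw_def endo_inj_surj)
qed

lemma block_perm_mat_carrier: "block_perm_mat S \<pi> \<in> carrier_mat d d"
  by (simp add: block_perm_mat_def)

text \<open>Identifies \<open>\<rho>\<close> as the index map of the permutation matrix, so that
  conjugating by it amounts to reading the entry at \<open>(\<rho> r, \<rho> c)\<close>.\<close>

lemma block_perm_mat_index:
  assumes "r < d" "c < d"
  shows "block_perm_mat S \<pi> $$ (r, c) = (if c = \<rho> r then 1 else 0)"
proof -
  obtain i a where i: "i < l" "a < bag_dim S (\<pi> i)" "r = offset (bag_dim S \<circ> \<pi>) i + a"
      "blk r = i" "\<rho> r = offset (bag_dim S) (\<pi> i) + a"
    using assms(1) by (rule perm_decompose)
  have "(\<exists>i<l. \<exists>t<bag_dim S (\<pi> i). r = offset (bag_dim S \<circ> \<pi>) i + t \<and> c = offset (bag_dim S) (\<pi> i) + t)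
      \<longleftrightarrow> c = \<rho> r"
  proof
    assume "\<exists>i<l. \<exists>t<bag_dim S (\<pi> i). r = offset (bag_dim S \<circ> \<pi>) i + t \<and> c = offset (bag_dim S) (\<pi> i) + t"
    then obtain j t where j: "t < bag_dim S (\<pi> j)" "r = offset (bag_dim S \<circ> \<pi>) j + t" "c = offset (bag_dim S) (\<pi> j) + t"
      by blast
    then have "blk r = j" by simp
    then show "c = \<rho> r" using i j by simp
  qed (use i in blast)
  then show ?thesis using assms by (simp add: block_perm_mat_def)
qed

lemma permute_blocks_carrier: "H \<in> carrier_mat d d \<Longrightarrow> permute_blocks S \<pi> H \<in> carrier_mat d d"
  using block_perm_mat_carrier by (simp add: permute_blocks_def)

lemma permute_blocks_index:
  assumes H: "H \<in> carrier_mat d d" and rc: "r < d" "c < d"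
  shows "permute_blocks S \<pi> H $$ (r, c) = H $$ (\<rho> r, \<rho> c)"
proof -
  let ?P = "block_perm_mat S \<pi>"
  note P = block_perm_mat_carrier
  have PH: "(?P * H) $$ (r, k) = H $$ (\<rho> r, k)" if "k < d" for k
  proof -
    have "(?P * H) $$ (r, k) = (\<Sum>s<d. ?P $$ (r, s) * H $$ (s, k))"
      using P H rc that by (simp add: scalar_prod_def atLeast0LessThan)
    also have "\<dots> = (\<Sum>s<d. if s = \<rho> r then H $$ (s, k) else 0)"
      using rc by (intro sum.cong) (auto simp: block_perm_mat_index)
    finally show ?thesis using \<rho>_less[OF rc(1)] by simp
  qed
  have "(X * transpose_mat ?P) $$ (r, c) = (\<Sum>k<d. X $$ (r, k) * ?P $$ (c, k))"
    if "X \<in> carrier_mat d d" for X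
    using P that rc by (simp add: scalar_prod_def atLeast0LessThan)
  from this[OF mult_carrier_mat[OF P H]]
  have "permute_blocks S \<pi> H $$ (r, c) = (\<Sum>k<d. (?P * H) $$ (r, k) * ?P $$ (c, k))"
    unfolding permute_blocks_def .
  also have "\<dots> = (\<Sum>k<d. if k = \<rho> c then H $$ (\<rho> r, k) else 0)"
    using rc by (intro sum.cong) (auto simp: block_perm_mat_index PH)
  finally show ?thesis using \<rho>_less[OF rc(2)] by simp
qed

section \<open>Pattern of the permuted Cholesky factor\<close>

abbreviation "PL \<equiv> L_positions S \<pi>"

lemma L_positions_iff: "(r, c) \<in> PL \<longleftrightarrow> c \<le> r \<and> r < d \<and> adj (\<pi> (blk r)) (\<pi> (blk c))"
  using offset_perm by (auto simp: L_positions_def mem_block_positions adj_def)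

lemma L_positions_lower: "PL \<subseteq> (SIGMA r:{..<d}. {..<Suc r})"
  by (auto simp: L_positions_iff)

lemma L_positions_diag: "r < d \<Longrightarrow> (r, r) \<in> PL"
  by (simp add: L_positions_iff adj_def)

lemma L_positions_perm: "(r, c) \<in> PL \<Longrightarrow> (\<rho> r, \<rho> c) \<in> H_positions S"
  by (auto simp: L_positions_iff H_positions_iff block_of_\<rho> \<rho>_less)

lemma L_positions_perm_iff: "c \<le> r \<Longrightarrow> r < d \<Longrightarrow> (r, c) \<in> PL \<longleftrightarrow> (\<rho> r, \<rho> c) \<in> H_positions S"
  by (auto simp: L_positions_iff H_positions_iff block_of_\<rho> \<rho>_less)

lemma blk_less: "r < d \<Longrightarrow> blk r < l"
  using block_of_eqD(1)[of r "bag_dim S \<circ> \<pi>" l] by (simp add: offset_perm)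

lemma blk_mono:
  assumes "c \<le> r" "r < d"
  shows "blk c \<le> blk r"
proof (rule ccontr)
  assume "\<not> blk c \<le> blk r"
  then have "offset (bag_dim S \<circ> \<pi>) (Suc (blk r)) \<le> offset (bag_dim S \<circ> \<pi>) (blk c)"
    by (intro offset_mono) simp
  moreover have "offset (bag_dim S \<circ> \<pi>) (blk c) \<le> c"
    "r - offset (bag_dim S \<circ> \<pi>) (blk r) < (bag_dim S \<circ> \<pi>) (blk r)"
    using block_of_eqD[of c "bag_dim S \<circ> \<pi>" l] block_of_eqD[of r "bag_dim S \<circ> \<pi>" l] assms
    by (simp_all add: offset_perm)
  ultimately show False using assms(1) by simp
qed

lemma L_positions_blk:
  assumes "(r, c) \<in> PL"
  shows "blk r = blk c \<or> blk r = up (blk c)"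
proof (cases "blk c < blk r")
  case True
  then show ?thesis
    using assms later_adj_eq_up[of "blk c" "blk r"] blk_less[of r] by (simp add: L_positions_iff)
next
  case False
  then show ?thesis using assms blk_mono[of c r] by (simp add: L_positions_iff)
qed

text \<open>If \<open>c\<close> lies in the block of \<open>k\<close>, then \<open>(r, c)\<close>
  and \<open>(r, k)\<close> lie in the same pair of blocks. Otherwise \<open>c\<close> lies in the
  block \<open>up (blk k)\<close>, and so does \<open>r\<close>, whose block is no earlier;
  \<open>(r, c)\<close> is then in a diagonal block.\<close>

lemma L_positions_no_fill:
  assumes "k < c" "c \<le> r" "r < d" "(r, k) \<in> PL" "(c, k) \<in> PL"
  shows "(r, c) \<in> PL"
proof (cases "blk c = blk k")
  case True
  then show ?thesis using assms by (simp add: L_positions_iff)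
next
  case False
  then have "blk c = up (blk k)" using L_positions_blk[OF assms(5)] by simp
  moreover have "blk k < blk c" "blk c \<le> blk r"
    using False blk_mono[of k c] blk_mono[of c r] assms by auto
  moreover from this have "blk r = up (blk k)" using L_positions_blk[OF assms(4)] by auto
  ultimately show ?thesis using assms by (simp add: L_positions_iff adj_def)
qed

text \<open>A row of \<open>L\<close> may meet the blocks of many children, but column
  \<open>k\<close> meets only its own block and \<open>up (blk k)\<close>. Entries and elimination
  cost are therefore counted by columns.\<close>

lemma L_positions_column:
  "finite {r. (r, k) \<in> PL} \<and> card {r. (r, k) \<in> PL} \<le> 2 * \<omega>\<^sup>2"
proof -
  let ?X = "{r. r < offset (bag_dim S \<circ> \<pi>) l \<and> blk r \<in> {blk k, up (blk k)}}"
  have dims: "(bag_dim S \<circ> \<pi>) j \<le> \<omega>\<^sup>2" if "j < l" for j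
    using bag_dim_le \<pi>_less that by simp
  have fin: "finite ?X" by simp
  have sub: "{r. (r, k) \<in> PL} \<subseteq> ?X"
    using L_positions_blk offset_perm by (fastforce simp: L_positions_iff)
  have "card {blk k, up (blk k)} \<le> 2" by (simp add: card_insert_if)
  then have "card {blk k, up (blk k)} * \<omega>\<^sup>2 \<le> 2 * \<omega>\<^sup>2" by (rule mult_right_mono) simp
  moreover have "card ?X \<le> card {blk k, up (blk k)} * \<omega>\<^sup>2"
    using dims by (intro card_blocks_le(2)) auto
  ultimately have "card ?X \<le> 2 * \<omega>\<^sup>2" by (rule order.trans[rotated])
  then show ?thesis using finite_subset[OF sub fin] card_mono[OF fin sub] by simp
qed

lemma finite_L_positions: "finite PL"
  using L_positions_lower by (rule finite_subset) simp

lemma card_L_positions: "card PL \<le> d * (2 * \<omega>\<^sup>2)"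
proof -
  let ?Q = "{(k, r). (r, k) \<in> PL}"
  have col: "finite {r. (k, r) \<in> ?Q} \<and> card {r. (k, r) \<in> ?Q} \<le> 2 * \<omega>\<^sup>2" for k
    using L_positions_column[of k] by simp
  have "?Q \<subseteq> {..<d} \<times> UNIV" by (auto simp: L_positions_iff)
  from card_by_rows[OF this col] have Q: "finite ?Q" "card ?Q \<le> d * (2 * \<omega>\<^sup>2)" .
  have "card PL \<le> card ?Q"
    by (rule card_inj_on_le[of prod.swap, OF _ _ Q(1)]) auto
  with Q(2) show ?thesis by simp
qed

end

section \<open>Correctness and cost\<close>

lemma cholesky_factorD:
  assumes "cholesky_factor M L" "M \<in> carrier_mat d d"
  shows "L \<in> carrier_mat d d"
    and "\<And>i. i < d \<Longrightarrow> 0 < L $$ (i, i)"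
    and "\<And>i j. i < j \<Longrightarrow> j < d \<Longrightarrow> L $$ (i, j) = 0"
    and "\<And>i j. i < d \<Longrightarrow> j < d \<Longrightarrow> (\<Sum>k<d. L $$ (i, k) * L $$ (j, k)) = M $$ (i, j)"
proof -
  show L: "L \<in> carrier_mat d d" and "\<And>i. i < d \<Longrightarrow> 0 < L $$ (i, i)"
    using assms by (auto simp: cholesky_factor_def)
  show "L $$ (i, j) = 0" if "i < j" "j < d" for i j
  proof -
    have "transpose_mat L $$ (j, i) = 0"
      using assms L that by (auto simp: cholesky_factor_def upper_triangular_def)
    then show ?thesis using L that by simp
  qed
  show "(\<Sum>k<d. L $$ (i, k) * L $$ (j, k)) = M $$ (i, j)" if "i < d" "j < d" for i j
  proof -
    have "M $$ (i, j) = (L * transpose_mat L) $$ (i, j)"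
      using assms(1) by (simp add: cholesky_factor_def)
    then show ?thesis using L that by (simp add: scalar_prod_def atLeast0LessThan)
  qed
qed

lemma cholesky_factorI:
  assumes "M \<in> carrier_mat d d" "\<And>i. i < d \<Longrightarrow> 0 < L i i" "\<And>i j. i < j \<Longrightarrow> L i j = 0"
    and "\<And>i j. i < d \<Longrightarrow> j < d \<Longrightarrow> (\<Sum>k<d. L i k * L j k) = M $$ (i, j)"
  shows "cholesky_factor M (mat d d (\<lambda>(i, j). L i j))"
proof -
  have "mat d d (\<lambda>(i, j). L i j) * transpose_mat (mat d d (\<lambda>(i, j). L i j)) = M"
    using assms(1,4) by (intro eq_matI) (auto simp: scalar_prod_def atLeast0LessThan)
  then show ?thesis
    using assms by (auto simp: cholesky_factor_def upper_triangular_def)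
qed

lemma q_vec_carrier:
  assumes "A \<in> carrier_mat m d" "N \<in> carrier_mat m' d"
  shows "q_vec A N w \<in> carrier_vec d"
  using assms by (intro carrier_vecI) (simp add: q_vec_def append_rows_def)

text \<open>The positions of the nonzeros of \<open>N\<close> are known to the program because \<open>N\<close> is determined by the structure
  (\<open>overlap_matrix_unique\<close>).\<close>

definition form_program :: "ctc_structure \<Rightarrow> cell instr list" where
  "form_program S = (let N = (SOME N. overlap_matrix S N) in
     form_prog (total_dim S) (num_cons S) (dim_row N) (A_positions S) (nonzero_positions N)
       (D_positions S) (H_positions S))"

definition factor_program :: "ctc_structure \<Rightarrow> (nat \<Rightarrow> nat) \<Rightarrow> cell instr list" where
  "factor_program S \<pi> = chol_prog (total_dim S) (L_positions S \<pi>) (perm_index S \<pi>)"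

definition solve_program :: "ctc_structure \<Rightarrow> (nat \<Rightarrow> nat) \<Rightarrow> cell instr list" where
  "solve_program S \<pi> = solve_prog (total_dim S) (L_positions S \<pi>) (perm_index S \<pi>)"

context bag_tree
begin

text \<open>The number of variables, of constraints and of rows of \<open>N\<close> are all at most
  \<open>n * \<omega>^2\<close>. These five products are what the cost estimates combine
  linearly.\<close>

lemma scale_bounds:
  assumes "x \<le> n * \<omega>\<^sup>2"
  shows "x \<le> \<omega> ^ 4 * n" "x * \<omega>\<^sup>2 \<le> \<omega> ^ 4 * n" "x \<le> \<omega> ^ 6 * n" "x * \<omega>\<^sup>2 \<le> \<omega> ^ 6 * n"
    "x * (\<omega>\<^sup>2)\<^sup>2 \<le> \<omega> ^ 6 * n"
proof -
  have 2: "x \<le> \<omega> ^ 2 * n" using assms by (simp add: mult.commute)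
  have "x * \<omega> ^ 2 \<le> (\<omega> ^ 2 * n) * \<omega> ^ 2" using 2 by (rule mult_right_mono) simp
  also have "\<dots> = \<omega> ^ 4 * n" by (simp add: power_add[symmetric] mult_ac)
  finally show 4: "x * \<omega>\<^sup>2 \<le> \<omega> ^ 4 * n" .
  have "x * \<omega> ^ 4 \<le> (\<omega> ^ 2 * n) * \<omega> ^ 4" using 2 by (rule mult_right_mono) simp
  also have "\<dots> = \<omega> ^ 6 * n" by (simp add: power_add[symmetric] mult_ac)
  finally show "x * (\<omega>\<^sup>2)\<^sup>2 \<le> \<omega> ^ 6 * n" by (simp add: power_mult[symmetric])
  show "x \<le> \<omega> ^ 4 * n" "x \<le> \<omega> ^ 6 * n" "x * \<omega>\<^sup>2 \<le> \<omega> ^ 6 * n"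
    using 2 4 power_bound[of 2 4] power_bound[of 2 6] power_bound[of 4 6] by linarith+
qed

lemma one_le_bound: "1 \<le> \<omega> ^ k * n"
  using n_pos max_bag_pos by (simp add: Suc_le_eq)

end

section \<open>Sparsity and definiteness of H for given data, and the cost of forming it\<close>

locale ctc_data = bag_tree +
  fixes As :: "nat \<Rightarrow> nat \<Rightarrow> real mat" and N :: "real mat" and D :: "nat \<Rightarrow> real mat" and \<sigma> :: real
  assumes num_cons_le: "num_cons S \<le> total_dim S"
    and As_sym: "\<And>i j. i < num_cons S \<Longrightarrow> j < num_bags S \<Longrightarrow> As i j \<in> sym_mats (card (bag S j))"
    and host_less: "\<And>i. i < num_cons S \<Longrightarrow> host S i < num_bags S"
    and host: "\<And>i j. i < num_cons S \<Longrightarrow> j < num_bags S \<Longrightarrow>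
      As i j \<noteq> 0\<^sub>m (card (bag S j)) (card (bag S j)) \<Longrightarrow> j = host S i \<or> j = parent S (host S i)"
    and N: "overlap_matrix S N"
    and D_pos_def: "\<And>j. j < num_bags S \<Longrightarrow> pos_def (bag_dim S j) (D j)"
    and \<sigma>_pos: "0 < \<sigma>"
begin

abbreviation "m' \<equiv> dim_row N"
abbreviation "Ab \<equiv> constraint_matrix S As"
abbreviation "Ds \<equiv> block_diag S D"
abbreviation "H \<equiv> H_mat Ds \<sigma> Ab N"
abbreviation "PN \<equiv> nonzero_positions N"

lemma N_carrier: "N \<in> carrier_mat m' d" and N_rows: "m' \<le> n * \<omega>\<^sup>2"
  using N overlap_rows_le by (auto simp: overlap_matrix_def)

lemma N_cols: "dim_col N = d"
  using N_carrier by (rule carrier_matD)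

lemma D_carrier: "j < l \<Longrightarrow> D j \<in> carrier_mat (bag_dim S j) (bag_dim S j)"
  using D_pos_def by (simp add: pos_def_def sym_mats_def)

lemma Ds_carrier: "Ds \<in> carrier_mat d d"
  unfolding block_diag_def total_dim_def by (rule block_diag_carrier[OF D_carrier])

lemma H_carrier: "H \<in> carrier_mat d d"
  by (rule H_mat_carrier[OF Ds_carrier constraint_matrix_carrier N_carrier])

lemma H_index:
  "r < d \<Longrightarrow> c < d \<Longrightarrow> H $$ (r, c) = Ds $$ (r, c) + \<sigma> * (\<Sum>k<m. Ab $$ (k, r) * Ab $$ (k, c))
    + \<sigma> * (\<Sum>k<m'. N $$ (k, r) * N $$ (k, c))"
  by (rule H_mat_index[OF Ds_carrier constraint_matrix_carrier N_carrier])

lemma Ab_zero: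
  assumes "k < m" "c < d" "(k, c) \<notin> A_positions S"
  shows "Ab $$ (k, c) = 0"
proof -
  have "c < offset (bag_dim S) l" using assms(2) by (simp add: total_dim_def)
  then obtain j t where j: "j < l" "t < bag_dim S j" "c = offset (bag_dim S) j + t"
    by (rule offset_decompose)
  then have "As k j = 0\<^sub>m (card (bag S j)) (card (bag S j))"
    using host[OF assms(1) j(1)] assms by (auto simp: A_positions_iff)
  moreover obtain a b where "lower_positions (card (bag S j)) ! t = (a, b)" by force
  moreover from this have "b \<le> a \<and> a < card (bag S j)"
    using j(2) nth_mem[of t "lower_positions (card (bag S j))"] by (simp add: bag_dim_def set_lower_positions)
  ultimately have "svec (As k j) $ t = 0"
    using j(2) by (subst svec_index[of t _ a b]) (auto simp: bag_dim_def)
  then show ?thesis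
    using constraint_matrix_index[of S As k j t] As_sym[OF assms(1)] assms(1) j by simp
qed

lemma N_zero: "k < m' \<Longrightarrow> c < d \<Longrightarrow> (k, c) \<notin> PN \<Longrightarrow> N $$ (k, c) = 0"
  by (simp add: nonzero_positions_def N_cols)

lemma Ds_eq:
  assumes "i < l" "j < l" "a < bag_dim S i" "b < bag_dim S j"
  shows "Ds $$ (offset (bag_dim S) i + a, offset (bag_dim S) j + b) = (if i = j then D i $$ (a, b) else 0)"
  unfolding block_diag_def by (rule block_diag_index[OF D_carrier assms])

lemma Ds_zero:
  assumes "r < d" "c < d" "(r, c) \<notin> D_positions S"
  shows "Ds $$ (r, c) = 0"
proof -
  have "r < offset (bag_dim S) l" "c < offset (bag_dim S) l" using assms(1,2) by (simp_all add: total_dim_def)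
  then obtain i a j b where "i < l" "a < bag_dim S i" "r = offset (bag_dim S) i + a"
      "j < l" "b < bag_dim S j" "c = offset (bag_dim S) j + b"
    by (meson offset_decompose)
  then show ?thesis using assms by (auto simp: D_positions_iff Ds_eq)
qed

lemma Ds_sym:
  assumes "r < d" "c < d"
  shows "Ds $$ (r, c) = Ds $$ (c, r)"
proof -
  have "r < offset (bag_dim S) l" "c < offset (bag_dim S) l" using assms by (simp_all add: total_dim_def)
  then obtain i a j b where i: "i < l" "a < bag_dim S i" "r = offset (bag_dim S) i + a"
      and j: "j < l" "b < bag_dim S j" "c = offset (bag_dim S) j + b"
    by (meson offset_decompose)
  have "D i $$ (a, b) = D i $$ (b, a)" if "i = j"
  proof -
    have "transpose_mat (D i) = D i" using D_pos_def[OF i(1)] by (simp add: pos_def_def sym_mats_def)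
    then have "D i $$ (a, b) = transpose_mat (D i) $$ (a, b)" by simp
    also have "\<dots> = D i $$ (b, a)" using D_carrier[OF i(1)] i j that by simp
    finally show ?thesis .
  qed
  then show ?thesis using i j by (cases "i = j") (simp_all add: Ds_eq)
qed

lemma H_sym: "r < d \<Longrightarrow> c < d \<Longrightarrow> H $$ (r, c) = H $$ (c, r)"
  using Ds_sym by (simp add: H_index mult.commute)

text \<open>A nonzero entry stems from a diagonal block or from a row of \<open>A\<close> or
  \<open>N\<close> that meets both blocks; such a row is confined to a node and its parent, which
  makes the two blocks adjacent.\<close>

lemma H_zero:
  assumes "r < d" "c < d" "(r, c) \<notin> H_positions S"
  shows "H $$ (r, c) = 0"
proof -
  let ?b = "block_of (bag_dim S)"
  have na: "\<not> adj (?b r) (?b c)" using assms by (simp add: H_positions_iff)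
  have "Ds $$ (r, c) = 0" using assms D_subset_H Ds_zero by blast
  moreover have "Ab $$ (k, r) * Ab $$ (k, c) = 0" if "k < m" for k
    using Ab_zero[OF that assms(1)] Ab_zero[OF that assms(2)] na adj_family[OF host_less[OF that], of "?b r" "?b c"]
    unfolding A_positions_iff by auto
  moreover have "N $$ (k, r) * N $$ (k, c) = 0" if "k < m'" for k
  proof (rule ccontr)
    assume "\<not> ?thesis"
    then have "N $$ (k, r) \<noteq> 0" "N $$ (k, c) \<noteq> 0" by auto
    moreover have "r < dim_col N" "c < dim_col N" using N_cols assms by auto
    ultimately show False
      using overlap_matrix_nonzero[OF N that, of r] overlap_matrix_nonzero[OF N that, of c] na
        adj_family[of "block_of (overlap_dim S) k" "?b r" "?b c"] by blast
  qed
  ultimately have "Ds $$ (r, c) = 0" "(\<Sum>k<m. Ab $$ (k, r) * Ab $$ (k, c)) = 0"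
    "(\<Sum>k<m'. N $$ (k, r) * N $$ (k, c)) = 0"
    by (auto intro!: sum.neutral simp del: mult_eq_0_iff)
  then show ?thesis using assms by (simp add: H_index)
qed

text \<open>The block-diagonal part is positive on \<open>x\<close>, and the two Gram parts
  contribute squared norms times the positive \<open>\<sigma>\<close>.\<close>

lemma H_pos_def:
  assumes "\<exists>r<d. x r \<noteq> 0"
  shows "0 < (\<Sum>r<d. \<Sum>c<d. x r * H $$ (r, c) * x c)"
proof -
  have "(\<Sum>r<d. \<Sum>c<d. x r * H $$ (r, c) * x c) = (\<Sum>r<d. \<Sum>c<d. x r * Ds $$ (r, c) * x c)
      + \<sigma> * (\<Sum>r<d. \<Sum>c<d. x r * (\<Sum>k<m. Ab $$ (k, r) * Ab $$ (k, c)) * x c)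
      + \<sigma> * (\<Sum>r<d. \<Sum>c<d. x r * (\<Sum>k<m'. N $$ (k, r) * N $$ (k, c)) * x c)"
  proof -
    have "(\<Sum>r<d. \<Sum>c<d. x r * H $$ (r, c) * x c) = (\<Sum>r<d. \<Sum>c<d. x r * Ds $$ (r, c) * x c
      + \<sigma> * (x r * (\<Sum>k<m. Ab $$ (k, r) * Ab $$ (k, c)) * x c)
      + \<sigma> * (x r * (\<Sum>k<m'. N $$ (k, r) * N $$ (k, c)) * x c))"
      by (rule sum.cong[OF refl], rule sum.cong[OF refl]) (simp add: H_index ring_distribs mult_ac)
    then show ?thesis by (simp only: sum.distrib sum_distrib_left)
  qed
  also have "(\<Sum>r<d. \<Sum>c<d. x r * (\<Sum>k<m. Ab $$ (k, r) * Ab $$ (k, c)) * x c) = (\<Sum>k<m. (\<Sum>r<d. Ab $$ (k, r) * x r)\<^sup>2)"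
    by (rule quadratic_form_factored[where L = "\<lambda>r k. Ab $$ (k, r)"]) simp
  also have "(\<Sum>r<d. \<Sum>c<d. x r * (\<Sum>k<m'. N $$ (k, r) * N $$ (k, c)) * x c) = (\<Sum>k<m'. (\<Sum>r<d. N $$ (k, r) * x r)\<^sup>2)"
    by (rule quadratic_form_factored[where L = "\<lambda>r k. N $$ (k, r)"]) simp
  finally have eq: "(\<Sum>r<d. \<Sum>c<d. x r * H $$ (r, c) * x c) = (\<Sum>r<d. \<Sum>c<d. x r * Ds $$ (r, c) * x c)
      + \<sigma> * (\<Sum>k<m. (\<Sum>r<d. Ab $$ (k, r) * x r)\<^sup>2) + \<sigma> * (\<Sum>k<m'. (\<Sum>r<d. N $$ (k, r) * x r)\<^sup>2)" .
  have "0 < (\<Sum>r<d. \<Sum>c<d. x r * Ds $$ (r, c) * x c)"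
    using block_diag_quadratic_form[of l "bag_dim S" D x] D_pos_def assms
    unfolding total_dim_def block_diag_def by blast
  moreover have "0 \<le> \<sigma> * (\<Sum>k<m. (\<Sum>r<d. Ab $$ (k, r) * x r)\<^sup>2)" "0 \<le> \<sigma> * (\<Sum>k<m'. (\<Sum>r<d. N $$ (k, r) * x r)\<^sup>2)"
    using \<sigma>_pos by (auto intro!: mult_nonneg_nonneg sum_nonneg)
  ultimately show ?thesis unfolding eq by linarith
qed

lemma form_program_eq: "form_program S = form_prog d m m' (A_positions S) PN (D_positions S) (H_positions S)"
proof -
  have "overlap_matrix S (SOME N. overlap_matrix S N)" using N by (rule someI)
  then have "(SOME N. overlap_matrix S N) = N" using N by (rule overlap_matrix_unique)
  then show ?thesis by (simp add: form_program_def Let_def)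
qed

lemma form_program_meets:
  assumes w: "w \<in> carrier_vec (m + m')"
  shows "program_meets (form_program S)
           (mat_cells Arr_A (A_positions S) \<union> mat_cells Arr_N PN \<union>
            mat_cells Arr_D (D_positions S) \<union> vec_cells Arr_sigma 1 \<union>
            vec_cells Arr_w (dim_vec w))
           (\<lambda>s. holds_mat Arr_A (A_positions S) Ab s \<and>
                holds_mat Arr_N PN N s \<and>
                holds_mat Arr_D (D_positions S) Ds s \<and>
                holds_scalar Arr_sigma \<sigma> s \<and> holds_vec Arr_w w s)
           (mat_cells Arr_H (H_positions S) \<union> vec_cells Arr_q d)
           (\<lambda>s. holds_mat Arr_H (H_positions S) H s \<and> zero_outside (H_positions S) H \<and>
                holds_vec Arr_q (q_vec Ab N w) s)
           (40 * \<omega> ^ 6 * n) (40 * \<omega> ^ 4 * n)" (is "program_meets _ ?inp ?pre ?outp ?post _ _")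
proof (rule program_meetsI)
  let ?q = "q_vec Ab N w"
  have q: "?q $ r = (\<Sum>k<m. Ab $$ (k, r) * w $ k) + (\<Sum>k<m'. N $$ (k, r) * w $ (m + k))" if "r < d" for r
    by (rule q_vec_index[OF constraint_matrix_carrier N_carrier w that])
  have dim_q: "dim_vec ?q = d"
    using q_vec_carrier[OF constraint_matrix_carrier N_carrier] by (rule carrier_vecD)
  have zero: "zero_outside (H_positions S) H"
    using H_zero H_carrier by (auto simp: zero_outside_def)
  have "valid (\<lambda>s. (\<forall>(k, c)\<in>A_positions S. s (Arr_A, k, c) = Ab $$ (k, c)) \<and> (\<forall>(k, c)\<in>PN. s (Arr_N, k, c) = N $$ (k, c)) \<and>
      (\<forall>(r, c)\<in>D_positions S. s (Arr_D, r, c) = Ds $$ (r, c)) \<and> s (Arr_sigma, 0, 0) = \<sigma> \<and> (\<forall>k<m + m'. s (Arr_w, k, 0) = w $ k))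
    (form_program S)
    (\<lambda>s. (\<forall>(r, c)\<in>H_positions S. s (Arr_H, r, c) = H $$ (r, c)) \<and> (\<forall>r<d. s (Arr_q, r, 0) = ?q $ r))"
    unfolding form_program_eq
    by (rule valid_form_prog[OF H_positions_square]) (simp_all add: Ab_zero N_zero Ds_zero H_index q)
  then show "valid ?pre (form_program S) ?post"
    by (rule valid_weaken) (use zero dim_q w in \<open>auto simp: holds_mat_def holds_vec_def holds_scalar_def\<close>)
  \<comment> \<open>Makes the space bound an atom, so that the final comparison is linear.\<close>
  define Z where "Z = \<omega> ^ 4 * n"
  have Z: "40 * \<omega> ^ 4 * n = 40 * Z" by (simp add: Z_def)
  note bounds = scale_bounds[OF total_dim_le] scale_bounds[OF order.trans[OF num_cons_le total_dim_le]]
    scale_bounds[OF N_rows]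
  note cards = card_A_positions card_overlap_positions[OF N] card_H_positions
    card_mono[OF finite_H_positions D_subset_H]
  have "(\<Sum>(r, c)\<in>H_positions S. card {k. k < m \<and> (k, r) \<in> A_positions S \<and> (k, c) \<in> A_positions S}) \<le> m * (2 * \<omega>\<^sup>2)\<^sup>2"
    by (rule sum_card_pairs_le[OF finite_H_positions A_positions_row])
  moreover have "(\<Sum>(r, c)\<in>H_positions S. card {k. k < m' \<and> (k, r) \<in> PN \<and> (k, c) \<in> PN}) \<le> m' * (2 * \<omega>\<^sup>2)\<^sup>2"
    by (rule sum_card_pairs_le[OF finite_H_positions overlap_positions_row[OF N]])
  \<comment> \<open>At most \<open>12 + 8 + 8 + 1 + 4 + 4 = 37\<close> multiples of
    \<open>\<omega>^6 * n\<close>: the fixed cost per entry of \<open>H\<close>, its inner products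
    over \<open>A\<close> and over \<open>N\<close>, and three contributions for \<open>q\<close>.
    This is the largest count among all time and space bounds, so 40 serves throughout.\<close>
  ultimately show "length (form_program S) \<le> 40 * \<omega> ^ 6 * n"
    using length_form_prog_le[OF H_positions_square finite_A_positions finite_overlap_positions[OF N],
        of m m' "D_positions S"] bounds cards
    unfolding form_program_eq by (simp add: power_mult_distrib)
  let ?X = "mat_cells Arr_A (A_positions S) \<union> mat_cells Arr_N PN \<union>
    mat_cells Arr_D (D_positions S) \<union> vec_cells Arr_sigma 1 \<union> vec_cells Arr_w (m + m') \<union> mat_cells Arr_H (H_positions S) \<union>
    vec_cells Arr_q d \<union> {tmp}"
  have dim_w: "dim_vec w = m + m'" using w by simp
  show "?inp \<union> ?outp \<union> accessed (form_program S) \<subseteq> ?X"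
    unfolding form_program_eq dim_w by (intro Un_least accessed_form_prog[OF H_positions_square]) auto
  have fin: "finite (D_positions S)" using D_subset_H finite_H_positions by (rule finite_subset)
  show "finite ?X" using fin finite_A_positions finite_H_positions finite_overlap_positions[OF N] by simp
  have "card ?X \<le> card (A_positions S) + card PN + card (D_positions S) + 1 + (m + m') + card (H_positions S) + d + 1"
    by (intro order.trans[OF card_Un_le] add_mono) auto
  then show "card ?X \<le> 40 * \<omega> ^ 4 * n"
    unfolding Z using bounds[folded Z_def] cards one_le_bound[of 4, folded Z_def] by simp
qed

end

section \<open>Factoring and solving in a topological ordering\<close>

locale ordered_ctc_data = ctc_data + ordered_bag_tree
begin

abbreviation "M \<equiv> permute_blocks S \<pi> H"

lemma M_carrier: "M \<in> carrier_mat d d"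
  by (rule permute_blocks_carrier[OF H_carrier])

lemma M_index: "r < d \<Longrightarrow> c < d \<Longrightarrow> M $$ (r, c) = H $$ (\<rho> r, \<rho> c)"
  by (rule permute_blocks_index[OF H_carrier])

lemma M_sym: "r < d \<Longrightarrow> c < d \<Longrightarrow> M $$ (r, c) = M $$ (c, r)"
  by (simp add: M_index H_sym \<rho>_less)

lemma M_zero: "c \<le> r \<Longrightarrow> r < d \<Longrightarrow> (r, c) \<notin> PL \<Longrightarrow> M $$ (r, c) = 0"
  by (simp add: M_index H_zero \<rho>_less L_positions_perm_iff)

text \<open>Conjugation by a permutation only renames the coordinates of \<open>x\<close>.\<close>

lemma M_pos_def:
  assumes "\<exists>r<d. x r \<noteq> 0"
  shows "0 < (\<Sum>r<d. \<Sum>c<d. x r * M $$ (r, c) * x c)"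
proof -
  let ?x = "\<lambda>i. x (inv_into {..<d} \<rho> i)"
  have inv: "inv_into {..<d} \<rho> (\<rho> r) = r" if "r < d" for r
    using bij_\<rho> that by (simp add: bij_betw_def)
  have "(\<Sum>r<d. \<Sum>c<d. x r * M $$ (r, c) * x c) = (\<Sum>r<d. \<Sum>c<d. ?x (\<rho> r) * H $$ (\<rho> r, \<rho> c) * ?x (\<rho> c))"
    by (rule sum.cong[OF refl], rule sum.cong[OF refl]) (simp add: M_index inv)
  also have "\<dots> = (\<Sum>r<d. \<Sum>c<d. ?x (\<rho> r) * H $$ (\<rho> r, c) * ?x c)"
    by (rule sum.cong[OF refl], rule sum.reindex_bij_betw[OF bij_\<rho>])
  also have "\<dots> = (\<Sum>r<d. \<Sum>c<d. ?x r * H $$ (r, c) * ?x c)"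
    by (rule sum.reindex_bij_betw[OF bij_\<rho>])
  also have "0 < \<dots>"
  proof (rule H_pos_def)
    obtain r where "r < d" "x r \<noteq> 0" using assms by blast
    then show "\<exists>r<d. ?x r \<noteq> 0" using inv \<rho>_less by (intro exI[of _ "\<rho> r"]) simp
  qed
  finally show ?thesis .
qed

text \<open>Stated for an arbitrary factor because it is applied twice: to the factor whose
  existence is proved, and to the one handed to the solver.\<close>

lemma cholesky_factor_pattern:
  assumes "\<And>i j. i < j \<Longrightarrow> L i j = 0" "\<And>i. i < d \<Longrightarrow> 0 < L i i"
    and "\<And>i j. i < d \<Longrightarrow> j < d \<Longrightarrow> (\<Sum>k<d. L i k * L j k) = M $$ (i, j)"
    and "c \<le> r" "r < d" "(r, c) \<notin> PL"
  shows "L r c = 0"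
proof (rule cholesky_no_fill[where n = d and M = "\<lambda>r c. M $$ (r, c)" and P = "\<lambda>r c. (r, c) \<in> PL"])
  show "L i i \<noteq> 0" if "i < d" for i using assms(2)[OF that] by simp
  show "(r, c) \<in> PL" if "k < c" "c \<le> r" "r < d" "(r, k) \<in> PL" "(c, k) \<in> PL" for k r c
    by (rule L_positions_no_fill[OF that])
qed (use assms M_zero in auto)

lemma factor_program_meets:
  "program_meets (factor_program S \<pi>)
     (mat_cells Arr_H (H_positions S))
     (holds_mat Arr_H (H_positions S) H)
     (mat_cells Arr_L PL)
     (\<lambda>s. \<exists>L. cholesky_factor M L \<and> holds_mat Arr_L PL L s \<and> zero_outside PL L)
     (40 * \<omega> ^ 6 * n) (40 * \<omega> ^ 4 * n)" (is "program_meets _ ?inp ?pre ?outp ?post _ _")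
proof (rule program_meetsI)
  \<comment> \<open>The factor is obtained from positive definiteness before the program runs; the
    recurrence then shows that the program recomputes exactly this \<open>L\<close>.\<close>
  obtain L where pos: "\<And>i. i < d \<Longrightarrow> 0 < L i i" and lower: "\<And>i j. i < j \<Longrightarrow> L i j = 0"
    and LL: "\<And>i j. i < d \<Longrightarrow> j < d \<Longrightarrow> (\<Sum>k<d. L i k * L j k) = M $$ (i, j)"
    using cholesky_ex[of d "\<lambda>i j. M $$ (i, j)", OF M_sym M_pos_def] by blast
  let ?L = "mat d d (\<lambda>(i, j). L i j)"
  have chol: "cholesky_factor M ?L" by (rule cholesky_factorI[OF M_carrier pos lower LL])
  have zero: "L r c = 0" if "c \<le> r" "r < d" "(r, c) \<notin> PL" for r c
    by (rule cholesky_factor_pattern[OF lower pos LL that])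
  have "L r c = 0" if "r < d" "(r, c) \<notin> PL" for r c
    using lower[of r c] zero[of c r] that by (cases "r < c") auto
  then have outside: "zero_outside PL ?L" by (auto simp: zero_outside_def)
  define val :: "cell \<Rightarrow> real" where "val = (\<lambda>(arr, i, j). if arr = Arr_H then H $$ (i, j) else L i j)"
  have "valid (agree val (mat_cells Arr_H (H_positions S))) (factor_program S \<pi>) (agree val (mat_cells Arr_L PL))"
    unfolding factor_program_def
  proof (rule valid_chol_prog[OF L_positions_lower L_positions_diag pos zero _ _ L_positions_perm])
    fix r c
    assume rc: "c \<le> r" "r < d"
    then have "L r c * L c c = M $$ (r, c) - (\<Sum>k<c. L r k * L c k)"
      using LL by (intro cholesky_recurrence[where n = d and M = "\<lambda>r c. M $$ (r, c)"] lower) auto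
    then show "L r c * L c c = val (Arr_H, \<rho> r, \<rho> c) - (\<Sum>k<c. L r k * L c k)"
      using rc by (simp add: val_def M_index)
  qed (simp_all add: val_def)
  then show "valid ?pre (factor_program S \<pi>) ?post"
  proof (rule valid_weaken)
    fix s
    assume "agree val (mat_cells Arr_L PL) s"
    then have "holds_mat Arr_L PL ?L s"
      using L_positions_lower by (auto simp: holds_mat_def agree_def mat_cells_def val_def)
    with chol outside show "?post s" by blast
  qed (auto simp: holds_mat_def agree_def mat_cells_def val_def)
  define Z where "Z = \<omega> ^ 4 * n"
  have Z: "40 * \<omega> ^ 4 * n = 40 * Z" by (simp add: Z_def)
  note bounds = scale_bounds[OF total_dim_le]
  have "(\<Sum>(r, c)\<in>PL. card {k. k < d \<and> (r, k) \<in> PL \<and> (c, k) \<in> PL}) \<le> d * (2 * \<omega>\<^sup>2)\<^sup>2"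
    by (rule sum_card_pairs_le[OF finite_L_positions L_positions_column])
  then show "length (factor_program S \<pi>) \<le> 40 * \<omega> ^ 6 * n"
    using length_chol_prog_le[OF L_positions_lower, of "\<rho>"] card_L_positions bounds
    unfolding factor_program_def by (simp add: power_mult_distrib)
  let ?X = "mat_cells Arr_H (H_positions S) \<union> mat_cells Arr_L PL \<union> {tmp}"
  show "?inp \<union> ?outp \<union> accessed (factor_program S \<pi>) \<subseteq> ?X"
    unfolding factor_program_def
    by (intro Un_least accessed_chol_prog[OF L_positions_lower L_positions_diag L_positions_perm]) auto
  show "finite ?X" using finite_H_positions finite_L_positions by simp
  have "card ?X \<le> card (H_positions S) + card PL + 1"
    by (intro order.trans[OF card_Un_le] add_mono) auto
  then show "card ?X \<le> 40 * \<omega> ^ 4 * n"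
    unfolding Z using bounds[folded Z_def] card_H_positions card_L_positions
      one_le_bound[of 4, folded Z_def] by simp
qed

lemma solve_program_meets:
  assumes L: "cholesky_factor M L" and q: "q \<in> carrier_vec d" and r: "r \<in> carrier_vec d"
  shows "program_meets (solve_program S \<pi>)
     (mat_cells Arr_L PL \<union> vec_cells Arr_q d \<union> vec_cells Arr_r d)
     (\<lambda>s. holds_mat Arr_L PL L s \<and> holds_vec Arr_q q s \<and> holds_vec Arr_r r s)
     (vec_cells Arr_u d)
     (\<lambda>s. \<exists>u \<in> carrier_vec d. (H + outer q) *\<^sub>v u = r \<and> holds_vec Arr_u u s)
     (40 * \<omega> ^ 4 * n) (40 * \<omega> ^ 4 * n)" (is "program_meets _ ?inp ?pre ?outp ?post _ _")
proof (rule program_meetsI)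
  note L = cholesky_factorD[OF L M_carrier]
  \<comment> \<open>Extension by zero: entries of a matrix beyond its dimension are unspecified,
    while the lemmas on functions need triangularity for all indices.\<close>
  define L' where "L' i j = (if i < d \<and> j < d then L $$ (i, j) else 0)" for i j
  have lower: "L' i j = 0" if "i < j" for i j using L(3) that by (simp add: L'_def)
  have pos: "0 < L' i i" if "i < d" for i using L(2) that by (simp add: L'_def)
  have LL: "(\<Sum>k<d. L' i k * L' j k) = M $$ (i, j)" if "i < d" "j < d" for i j
    using L(4) that by (simp add: L'_def)
  have zero: "L' r c = 0" if "c \<le> r" "r < d" "(r, c) \<notin> PL" for r c
    by (rule cholesky_factor_pattern[OF lower pos LL that])
  obtain x where x: "\<And>i. i < d \<Longrightarrow> (\<Sum>s<d. (M $$ (i, s) + q $ \<rho> i * q $ \<rho> s) * x (\<rho> s)) = r $ \<rho> i"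
    and run: "valid (\<lambda>s. (\<forall>(r, c)\<in>PL. s (Arr_L, r, c) = L' r c) \<and>
        (\<forall>i<d. s (Arr_q, i, 0) = q $ i) \<and> (\<forall>i<d. s (Arr_r, i, 0) = r $ i))
      (solve_prog d PL \<rho>) (\<lambda>s. \<forall>i<d. s (Arr_u, i, 0) = x i)"
    using valid_solve_prog[OF L_positions_lower L_positions_diag lower pos zero LL bij_\<rho>,
      of "\<lambda>i. q $ i" "\<lambda>i. r $ i"] by blast
  have sol: "(H + outer q) *\<^sub>v vec d x = r"
  proof (rule eq_vecI)
    fix i
    assume "i < dim_vec r"
    \<comment> \<open>Row \<open>i\<close> of the original system is row \<open>k\<close> of the
      permuted one, for which \<open>x\<close> was constructed.\<close>
    then have "i \<in> \<rho> ` {..<d}" using bij_\<rho> r by (simp add: bij_betw_def)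
    then obtain k where k: "k < d" "i = \<rho> k" by auto
    have "((H + outer q) *\<^sub>v vec d x) $ i = (\<Sum>s<d. (H $$ (\<rho> k, s) + q $ \<rho> k * q $ s) * x s)"
      using H_carrier q k \<rho>_less by (simp add: scalar_prod_def outer_def atLeast0LessThan)
    also have "\<dots> = (\<Sum>s<d. (H $$ (\<rho> k, \<rho> s) + q $ \<rho> k * q $ \<rho> s) * x (\<rho> s))"
      by (rule sum.reindex_bij_betw[OF bij_\<rho>, symmetric])
    also have "\<dots> = r $ i" using x[OF k(1)] k by (simp add: M_index)
    finally show "((H + outer q) *\<^sub>v vec d x) $ i = r $ i" .
  qed (use q r in \<open>simp add: outer_def\<close>)
  show "valid ?pre (solve_program S \<pi>) ?post"
    unfolding solve_program_def
  proof (rule valid_weaken[OF run])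
    fix s :: "cell \<Rightarrow> real"
    assume "holds_mat Arr_L PL L s \<and> holds_vec Arr_q q s \<and> holds_vec Arr_r r s"
    then show "(\<forall>(r, c)\<in>PL. s (Arr_L, r, c) = L' r c) \<and>
        (\<forall>i<d. s (Arr_q, i, 0) = q $ i) \<and> (\<forall>i<d. s (Arr_r, i, 0) = r $ i)"
      using q r L_positions_lower by (fastforce simp: holds_mat_def holds_vec_def L'_def)
  next
    fix s :: "cell \<Rightarrow> real"
    assume "\<forall>i<d. s (Arr_u, i, 0) = x i"
    then show "?post s" using sol by (intro bexI[of _ "vec d x"]) (auto simp: holds_vec_def)
  qed
  define Z where "Z = \<omega> ^ 4 * n"
  have Z: "40 * \<omega> ^ 4 * n = 40 * Z" by (simp add: Z_def)
  note bounds = scale_bounds[OF total_dim_le]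
  show "length (solve_program S \<pi>) \<le> 40 * \<omega> ^ 4 * n"
    unfolding Z solve_program_def
    using length_solve_prog_le[OF L_positions_lower, of "\<rho>"] card_L_positions
      bounds[folded Z_def] one_le_bound[of 4, folded Z_def] by simp
  let ?W = "{Work} \<times> ({..<d} \<times> {1, 2, 3} \<union> {0, 1, 2} \<times> {0}) :: cell set"
  let ?X = "mat_cells Arr_L PL \<union> vec_cells Arr_q d \<union> vec_cells Arr_r d \<union> vec_cells Arr_u d \<union> ?W"
  show "?inp \<union> ?outp \<union> accessed (solve_program S \<pi>) \<subseteq> ?X"
    unfolding solve_program_def
    by (intro Un_least accessed_solve_prog[OF L_positions_lower L_positions_diag bij_\<rho>]) auto
  show "finite ?X" using finite_L_positions by simp
  have "card ({..<d} \<times> {1, 2, 3 :: nat} \<union> {0, 1, 2 :: nat} \<times> {0 :: nat}) \<le> 3 * d + 3"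
    by (rule order.trans[OF card_Un_le]) (simp add: card_cartesian_product)
  then have "card ?W \<le> 3 * d + 3" by (simp add: card_cartesian_product_singleton)
  then have "card ?X \<le> card PL + d + d + d + (3 * d + 3)"
    by (intro order.trans[OF card_Un_le] add_mono) auto
  then show "card ?X \<le> 40 * \<omega> ^ 4 * n"
    unfolding Z using bounds[folded Z_def] card_L_positions one_le_bound[of 4, folded Z_def] by simp
qed

end

lemma bag_treeI:
  assumes "tree_decomposition (size_n S) G (num_bags S) (bag S) (tree_edges S)" "root_node S < num_bags S"
  shows "bag_tree S"
  using assms by unfold_locales (auto simp: tree_decomposition_def)

theorem lemma5:
  shows "\<exists>(K :: nat)
      (form :: ctc_structure \<Rightarrow> cell instr list)
      (factor :: ctc_structure \<Rightarrow> (nat \<Rightarrow> nat) \<Rightarrow> cell instr list)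
      (solve :: ctc_structure \<Rightarrow> (nat \<Rightarrow> nat) \<Rightarrow> cell instr list).
    \<forall>(S :: ctc_structure) (C :: real mat) (A :: nat \<Rightarrow> real mat)
      (Cs :: nat \<Rightarrow> real mat) (As :: nat \<Rightarrow> nat \<Rightarrow> real mat) (N :: real mat)
      (D :: nat \<Rightarrow> real mat) (\<sigma> :: real) (w :: real vec) (n :: nat) (m :: nat) (l :: nat).
      n = size_n S \<longrightarrow> m = num_cons S \<longrightarrow> l = num_bags S \<longrightarrow>
      C \<in> sym_mats n \<longrightarrow>
      (\<forall>i<m. A i \<in> sym_mats n) \<longrightarrow>
      (\<forall>y \<in> carrier_vec m. lin_comb_mats n m y A = 0\<^sub>m n n \<longleftrightarrow> y = 0\<^sub>v m) \<longrightarrow>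
      tree_decomposition n (sparsity_edges n ({C} \<union> A ` {..<m})) l (bag S) (tree_edges S) \<longrightarrow>
      root_node S < l \<longrightarrow>
      is_split S C Cs \<longrightarrow>
      (\<forall>i<m. is_split S (A i) (As i)) \<longrightarrow>
      overlap_matrix S N \<longrightarrow>
      (\<forall>i<m. host S i < l \<and>
         (\<forall>j<l. As i j \<noteq> 0\<^sub>m (card (bag S j)) (card (bag S j)) \<longrightarrow>
            j = host S i \<or> j = parent S (host S i))) \<longrightarrow>
      (\<forall>j<l. pos_def (bag_dim S j) (D j)) \<longrightarrow>
      \<sigma> > 0 \<longrightarrow>
      w \<in> carrier_vec (m + dim_row N) \<longrightarrow>
      (let \<omega> = max_bag S; d = total_dim S;
           Ab = constraint_matrix S As;
           Ds = block_diag S D;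
           H = H_mat Ds \<sigma> Ab N;
           q = q_vec Ab N w
       in
         program_meets (form S)
           (mat_cells Arr_A (A_positions S) \<union> mat_cells Arr_N (nonzero_positions N) \<union>
            mat_cells Arr_D (D_positions S) \<union> vec_cells Arr_sigma 1 \<union>
            vec_cells Arr_w (dim_vec w))
           (\<lambda>s. holds_mat Arr_A (A_positions S) Ab s \<and>
                holds_mat Arr_N (nonzero_positions N) N s \<and>
                holds_mat Arr_D (D_positions S) Ds s \<and>
                holds_scalar Arr_sigma \<sigma> s \<and> holds_vec Arr_w w s)
           (mat_cells Arr_H (H_positions S) \<union> vec_cells Arr_q d)
           (\<lambda>s. holds_mat Arr_H (H_positions S) H s \<and> zero_outside (H_positions S) H \<and>
                holds_vec Arr_q q s)
           (K * \<omega> ^ 6 * n) (K * \<omega> ^ 4 * n)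
       \<and> (\<forall>\<pi>. topological_ordering l (tree_edges S) \<pi> \<longrightarrow>
           program_meets (factor S \<pi>)
             (mat_cells Arr_H (H_positions S))
             (holds_mat Arr_H (H_positions S) H)
             (mat_cells Arr_L (L_positions S \<pi>))
             (\<lambda>s. \<exists>L. cholesky_factor (permute_blocks S \<pi> H) L \<and>
                  holds_mat Arr_L (L_positions S \<pi>) L s \<and> zero_outside (L_positions S \<pi>) L)
             (K * \<omega> ^ 6 * n) (K * \<omega> ^ 4 * n)
         \<and> (\<forall>L r. cholesky_factor (permute_blocks S \<pi> H) L \<longrightarrow> r \<in> carrier_vec d \<longrightarrow>
             program_meets (solve S \<pi>)
               (mat_cells Arr_L (L_positions S \<pi>) \<union> vec_cells Arr_q d \<union> vec_cells Arr_r d)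
               (\<lambda>s. holds_mat Arr_L (L_positions S \<pi>) L s \<and> holds_vec Arr_q q s \<and>
                    holds_vec Arr_r r s)
               (vec_cells Arr_u d)
               (\<lambda>s. \<exists>u \<in> carrier_vec d. (H + outer q) *\<^sub>v u = r \<and> holds_vec Arr_u u s)
               (K * \<omega> ^ 4 * n) (K * \<omega> ^ 4 * n))))"
proof (rule exI[of _ 40], rule exI[of _ form_program], rule exI[of _ factor_program],
    rule exI[of _ solve_program], intro allI impI, goal_cases)
  case (1 S C A Cs As N D \<sigma> w n m l)
  note n = \<open>n = size_n S\<close> and l = \<open>l = num_bags S\<close>
  interpret bag_tree S
    using 1 by (intro bag_treeI) auto
  interpret ctc_data S As N D \<sigma>
  proof unfold_locales
    \<comment> \<open>Here the linear independence of the \<open>A i\<close> enters, converted into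
      the bound that limits the number of rows of \<open>Ab\<close>.\<close>
    show "num_cons S \<le> total_dim S"
      using 1 bag_subset by (intro num_cons_le_total_dim[of S A As]) auto
  qed (use 1 in \<open>auto simp: is_split_def\<close>)
  have w: "w \<in> carrier_vec (num_cons S + dim_row N)" using 1 by simp
  have dim_q: "q_vec Ab N w \<in> carrier_vec (total_dim S)"
    by (rule q_vec_carrier[OF constraint_matrix_carrier N_carrier])
  \<comment> \<open>The ordering is quantified inside the conclusion, so the locale is instantiated
    for each \<open>\<pi>\<close> separately.\<close>
  have topo: "ordered_ctc_data S As N D \<sigma> \<pi>" if "topological_ordering (num_bags S) (tree_edges S) \<pi>" for \<pi>
    using that by unfold_locales
  show ?case
    unfolding Let_def n l
    using form_program_meets[OF w] ordered_ctc_data.factor_program_meets[OF topo]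
      ordered_ctc_data.solve_program_meets[OF topo _ dim_q]
    by blast
qed

end
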